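(* For every $\varepsilon>0$ and $N\ge 0$ there is a constant $A$, depending only on $\varepsilon$ and $N$, with the following property. Let $\mu$ be a positive Borel measure on $\mathbb{C}$ with $\mu(B(x,r))\le r$ for all $x\in\mathbb{C}$, $r>0$, let $K$ be a Calderón–Zygmund kernel with exponent $\varepsilon$, and assume that the operator $T\varphi(x)=\int_{\mathbb{C}}K(x,y)\varphi(y)\,d\mu(y)$ is bounded on $L^2(\mu)$ with $\|T\|_{L^2(\mu)\to L^2(\mu)}\le N$. Then for every finite signed Borel measure $\nu$ on $\mathbb{C}$ and every $t>0$, $$\mu\{x\in\mathbb{C}:\ |T^\sharp\nu(x)|>t\}\le \frac{A\,\|\nu\|}{t}.$$
   Context: $B(x,r)=\{y\in\mathbb{C}:|x-y|<r\}$. $\|\nu\|$ is the total variation of $\nu$. A Calderón–Zygmund kernel with exponent $\varepsilon>0$ is a function $K:\{(x,y)\in\mathbb{C}^2:x\ne y\}\to\mathbb{C}$ such that $|K(x,y)|\le \frac{1}{|x-y|}$ for $x\neq y$, and $$|K(x,y)-K(x',y)|\le\frac{|x-x'|^{\varepsilon}}{|x-y|^{1+\varepsilon}},\qquad |K(y,x)-K(y,x')|\le\frac{|x-x'|^{\varepsilon}}{|x-y|^{1+\varepsilon}}\qquad\text{whenever } |x-x'|\le\tfrac12|x-y|,\ x\ne y.$$ That $T\varphi(x)=\int K(x,y)\varphi(y)\,d\mu(y)$ is a bounded operator on $L^2(\mu)$ means: $T$ is a bounded linear operator on $L^2(\mu)$ such that for every $\varphi\in L^2(\mu)$ this formula holds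 for $\mu$-a.e. $x$ outside the closed support of $\varphi$ (where the integral converges absolutely). Truncations and maximal singular operator on measures: $T_r\nu(x)=\int_{\mathbb{C}\setminus B(x,r)}K(x,y)\,d\nu(y)$ and $T^\sharp\nu(x)=\sup_{r>0}|T_r\nu(x)|$. *)

theory Defs
  imports "HOL-Analysis.Analysis"
begin

section \<open>Finite signed Borel measures\<close>

text \<open>A finite signed measure is a real-valued set function; only its values on Borel sets matter.\<close>

definition finite_signed_borel_measure :: "('a::topological_space set \<Rightarrow> real) \<Rightarrow> bool" where
  "finite_signed_borel_measure \<nu> \<longleftrightarrow>
     \<nu> {} = 0 \<and>
     (\<forall>B :: nat \<Rightarrow> 'a set. range B \<subseteq> sets borel \<longrightarrow> disjoint_family B \<longrightarrow>
        (\<lambda>i. \<nu> (B i)) sums \<nu> (\<Union>i. B i))"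

definition total_variation :: "('a::topological_space set \<Rightarrow> real) \<Rightarrow> ennreal" where
  "total_variation \<nu> =
     (SUP P \<in> {P. finite P \<and> P \<subseteq> sets borel \<and> disjoint P \<and> \<Union>P = UNIV}.
        \<Sum>E\<in>P. ennreal \<bar>\<nu> E\<bar>)"

text \<open>
  The upper variation is the positive part of the Jordan decomposition; the negative part is
  the upper variation of \<open>- \<nu>\<close>. Negative values of \<open>\<nu>\<close> are sent to 0 by \<open>ennreal\<close>, which
  does not change the supremum because \<open>F = {}\<close> is admitted. For a finite signed measure the
  set function below is countably additive, so \<open>measure_of\<close> keeps it.
\<close>

definition upper_variation :: "('a::topological_space set \<Rightarrow> real) \<Rightarrow> 'a measure" where
  "upper_variation \<nu> =
     measure_of UNIV (sets borel) (\<lambda>E. SUP F \<in> {F \<in> sets borel. F \<subseteq> E}. ennreal (\<nu> F))"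

definition signed_integral ::
  "('a::topological_space set \<Rightarrow> real) \<Rightarrow> ('a \<Rightarrow> complex) \<Rightarrow> complex" where
  "signed_integral \<nu> f =
     integral\<^sup>L (upper_variation \<nu>) f - integral\<^sup>L (upper_variation (\<lambda>E. - \<nu> E)) f"


section \<open>Calderon-Zygmund kernels\<close>

text \<open>Kernels are total functions whose values on the diagonal are left unconstrained.\<close>

definition CZ_kernel :: "real \<Rightarrow> (complex \<Rightarrow> complex \<Rightarrow> complex) \<Rightarrow> bool" where
  "CZ_kernel \<epsilon> K \<longleftrightarrow>
     (\<forall>x y. x \<noteq> y \<longrightarrow> cmod (K x y) \<le> 1 / cmod (x - y)) \<and>
     (\<forall>x x' y. x \<noteq> y \<longrightarrow> cmod (x - x') \<le> cmod (x - y) / 2 \<longrightarrow>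
        cmod (K x y - K x' y) \<le> cmod (x - x') powr \<epsilon> / cmod (x - y) powr (1 + \<epsilon>) \<and>
        cmod (K y x - K y x') \<le> cmod (x - x') powr \<epsilon> / cmod (x - y) powr (1 + \<epsilon>))"


section \<open>Bounded operators on the space of square integrable functions\<close>

text \<open>
  Elements of \<open>L\<^sup>2(\<mu>)\<close> are represented by functions, and an operator acts on representatives,
  compatibly with almost everywhere equality.
\<close>

definition L2_functions :: "'a measure \<Rightarrow> ('a \<Rightarrow> complex) set" where
  "L2_functions \<mu> =
     {\<phi>. \<phi> \<in> borel_measurable \<mu> \<and> integrable \<mu> (\<lambda>x. (cmod (\<phi> x))\<^sup>2)}"

definition L2_norm :: "'a measure \<Rightarrow> ('a \<Rightarrow> complex) \<Rightarrow> real" where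
  "L2_norm \<mu> \<phi> = sqrt (\<integral>x. (cmod (\<phi> x))\<^sup>2 \<partial>\<mu>)"

definition L2_bounded_linear ::
  "'a measure \<Rightarrow> (('a \<Rightarrow> complex) \<Rightarrow> 'a \<Rightarrow> complex) \<Rightarrow> bool" where
  "L2_bounded_linear \<mu> T \<longleftrightarrow>
     (\<forall>\<phi>\<in>L2_functions \<mu>. T \<phi> \<in> L2_functions \<mu>) \<and>
     (\<forall>\<phi>\<in>L2_functions \<mu>. \<forall>\<psi>\<in>L2_functions \<mu>.
        (AE x in \<mu>. \<phi> x = \<psi> x) \<longrightarrow> (AE x in \<mu>. T \<phi> x = T \<psi> x)) \<and>
     (\<forall>\<phi>\<in>L2_functions \<mu>. \<forall>\<psi>\<in>L2_functions \<mu>.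
        AE x in \<mu>. T (\<lambda>y. \<phi> y + \<psi> y) x = T \<phi> x + T \<psi> x) \<and>
     (\<forall>c. \<forall>\<phi>\<in>L2_functions \<mu>. AE x in \<mu>. T (\<lambda>y. c * \<phi> y) x = c * T \<phi> x) \<and>
     (\<exists>C. \<forall>\<phi>\<in>L2_functions \<mu>. L2_norm \<mu> (T \<phi>) \<le> C * L2_norm \<mu> \<phi>)"

text \<open>As for \<^const>\<open>onorm\<close>, the convention \<open>0 / 0 = 0\<close> takes care of null functions.\<close>

definition L2_onorm :: "'a measure \<Rightarrow> (('a \<Rightarrow> complex) \<Rightarrow> 'a \<Rightarrow> complex) \<Rightarrow> real" where
  "L2_onorm \<mu> T = (SUP \<phi>\<in>L2_functions \<mu>. L2_norm \<mu> (T \<phi>) / L2_norm \<mu> \<phi>)"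

text \<open>
  The closed support of an \<open>L\<^sup>2\<close> class: the complement of the largest open set on which the
  function vanishes almost everywhere. It does not depend on the representative.
\<close>

definition closed_support :: "'a::topological_space measure \<Rightarrow> ('a \<Rightarrow> complex) \<Rightarrow> 'a set" where
  "closed_support \<mu> \<phi> = - \<Union>{U. open U \<and> (AE y in \<mu>. y \<in> U \<longrightarrow> \<phi> y = 0)}"

definition has_kernel ::
  "'a::topological_space measure \<Rightarrow> (('a \<Rightarrow> complex) \<Rightarrow> 'a \<Rightarrow> complex) \<Rightarrow> ('a \<Rightarrow> 'a \<Rightarrow> complex) \<Rightarrow> bool"
where
  "has_kernel \<mu> T K \<longleftrightarrow>
     (\<forall>\<phi>\<in>L2_functions \<mu>. AE x in \<mu>. x \<notin> closed_support \<mu> \<phi> \<longrightarrow>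
        has_bochner_integral \<mu> (\<lambda>y. K x y * \<phi> y) (T \<phi> x))"


section \<open>Truncations and the maximal singular operator\<close>

definition truncated_op ::
  "(complex \<Rightarrow> complex \<Rightarrow> complex) \<Rightarrow> real \<Rightarrow> (complex set \<Rightarrow> real) \<Rightarrow> complex \<Rightarrow> complex" where
  "truncated_op K r \<nu> x = signed_integral \<nu> (\<lambda>y. indicat_real (- ball x r) y *\<^sub>R K x y)"

text \<open>
  The supremum may be infinite. By left continuity in \<open>r\<close> it may be taken over rational \<open>r\<close>,
  so for a Calderon-Zygmund kernel and a finite signed measure its superlevel sets are Borel.
\<close>

definition maximal_op ::
  "(complex \<Rightarrow> complex \<Rightarrow> complex) \<Rightarrow> (complex set \<Rightarrow> real) \<Rightarrow> complex \<Rightarrow> ennreal" where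
  "maximal_op K \<nu> x = (SUP r\<in>{0<..}. ennreal (cmod (truncated_op K r \<nu> x)))"

end

theory Submission
  imports Defs
begin

text \<open>
  Replacing \<open>\<nu>\<close> by its upper variations and approximating by simple functions of the identity, it
  suffices to treat a finite sum of point masses \<open>\<alpha>\<^sub>p \<delta>\<^sub>p\<close>, for which every atom has a stopping radius
  \<open>\<rho>\<^sub>p\<close>: the density of \<open>\<nu>\<close> relative to \<open>\<mu>\<close> on concentric balls exceeds \<open>t\<close> at \<open>\<rho>\<^sub>p\<close> and is at most
  \<open>t\<close> from \<open>2\<rho>\<^sub>p\<close> on. The union of the balls of radius \<open>2\<rho>\<^sub>p\<close> is small by Vitali's lemma. Linear growth
  of \<open>\<mu>\<close> yields a doubling radius \<open>R\<^sub>p \<ge> 2\<rho>\<^sub>p\<close> such that \<open>1 / \<bar>x - p\<bar>\<close> has bounded \<open>\<mu>\<close>-integral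
  over the shell between the two radii. As in Tolsa's Calderon-Zygmund decomposition, each atom is
  spread over its doubling ball, smallest balls first, as a density \<open>f\<^sub>p\<close> with \<open>\<Sum>f\<^sub>p \<le> C t\<close>.

  The bounded function \<open>\<Sum>f\<^sub>p\<close> is handled by Cotlar's inequality, which bounds the maximal operator
  by the maximal function of \<open>T\<phi>\<close> plus \<open>C \<parallel>\<phi>\<parallel>\<^sub>\<infinity>\<close>; only \<open>T\<close> itself enters, not its adjoint. The
  differences \<open>\<alpha>\<^sub>p \<delta>\<^sub>p - f\<^sub>p \<mu>\<close> are integrated by cancellation far from \<open>p\<close> and by the shell estimate
  near \<open>p\<close>. A sharp truncation has no cancellation at the points \<open>p\<close> with \<open>\<bar>x - p\<bar>\<close> comparable to \<open>r\<close>;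
  these contribute at most \<open>C \<nu>(B(x, 2r)) / r\<close>, a maximal function of weak type because \<open>\<mu>\<close> has linear
  growth.

  All exceptional sets are enclosed in Borel sets, so that measurability of maximal functions is never
  needed.
\<close>

section \<open>Measures of linear growth\<close>

lemma sum_half_powers_le: "(\<Sum>i<k. (1/2::real)^(k-1-i)) \<le> 2"
proof -
  have "(\<Sum>i<k. (1/2::real)^(k-1-i)) = (\<Sum>i<k. (1/2)^i)"
    using sum.nat_diff_reindex[of "\<lambda>i. (1/2::real)^i" k] by simp
  also have "\<dots> \<le> (\<Sum>i. (1/2)^i)"
    by (intro sum_le_suminf) auto
  also have "\<dots> = 2" by (subst suminf_geometric) auto
  finally show ?thesis .
qed

lemma ennreal_le_suminf: "f i \<le> (\<Sum>i. f i)" for f :: "nat \<Rightarrow> ennreal"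
  using sum_le_suminf[OF summableI, of "{i}" f] by simp

text \<open>\<open>i\<close> is the least index with \<open>d < a^Suc i * \<rho>\<close>; its
  minimality gives the lower bound. This sorts points into geometric annuli around a centre.\<close>

lemma geometric_shell:
  fixes a d \<rho> :: real
  assumes "1 < a" "0 < \<rho>" "\<rho> \<le> d"
  obtains i where "a^i * \<rho> \<le> d" "d < a^Suc i * \<rho>"
proof -
  define i where "i = (LEAST i. d < a^Suc i * \<rho>)"
  obtain n where "d / \<rho> < a^n" using real_arch_pow[OF assms(1)] by blast
  also have "a^n \<le> a^Suc n" using assms by (intro power_increasing) auto
  finally have "d < a^Suc n * \<rho>" using assms(2) by (simp add: pos_divide_less_eq)
  then have lt: "d < a^Suc i * \<rho>" unfolding i_def by (rule LeastI)
  have "a^i * \<rho> \<le> d"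
  proof (cases i)
    case 0
    then show ?thesis using assms by simp
  next
    case (Suc i')
    then have "i' < (LEAST i. d < a^Suc i * \<rho>)" unfolding i_def by simp
    from not_less_Least[OF this] show ?thesis using Suc by simp
  qed
  with lt show ?thesis using that by blast
qed

locale linear_growth =
  fixes \<mu> :: "complex measure"
  assumes sets_mu [measurable_cong, simp]: "sets \<mu> = sets borel"
    and growth: "\<And>x r. 0 < r \<Longrightarrow> emeasure \<mu> (ball x r) \<le> ennreal r"
begin

lemma space_mu [simp]: "space \<mu> = UNIV"
  using sets_eq_imp_space_eq[OF sets_mu] by simp

lemma measurable_mu: "borel_measurable \<mu> = borel_measurable borel"
  by (rule measurable_cong_sets) auto

lemma ball_sets [measurable]: "ball x r \<in> sets \<mu>"
  by simp

abbreviation m :: "complex \<Rightarrow> real \<Rightarrow> real" where "m x r \<equiv> measure \<mu> (ball x r)"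

lemma emeasure_ball: "emeasure \<mu> (ball x r) = ennreal (m x r)"
proof (cases "0 < r")
  case True
  show ?thesis using growth[OF True, of x]
    by (intro emeasure_eq_ennreal_measure) (auto simp: top_unique)
next
  case False
  then have "ball x r = {}" by (simp add: not_less)
  then show ?thesis by (simp only: measure_empty emeasure_empty ennreal_0)
qed

lemma m_le:
  assumes "0 \<le> r"
  shows "m x r \<le> r"
proof (cases "r = 0")
  case False
  with assms have "ennreal (m x r) \<le> ennreal r" unfolding emeasure_ball[symmetric] by (intro growth) auto
  then show ?thesis using assms by (simp add: ennreal_le_iff)
qed simp

lemma m_mono: "r \<le> s \<Longrightarrow> m x r \<le> m x s"
proof -
  assume "r \<le> s"
  then have "emeasure \<mu> (ball x r) \<le> emeasure \<mu> (ball x s)"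
    by (intro emeasure_mono subset_ball) auto
  then show ?thesis unfolding emeasure_ball by simp
qed

text \<open>Continuity of the measure from below along balls of integer radius.\<close>

lemma m_tendsto_infinity:
  assumes "ennreal c < emeasure \<mu> UNIV"
  shows "\<exists>n::nat. c < m x (real n)"
proof -
  have "(SUP n::nat. emeasure \<mu> (ball x (real n))) = emeasure \<mu> (\<Union>n::nat. ball x (real n))"
    by (rule SUP_emeasure_incseq) (auto simp: incseq_def)
  also have "(\<Union>n::nat. ball x (real n)) = UNIV"
    using reals_Archimedean2 by auto
  finally have "ennreal c < (SUP n::nat. emeasure \<mu> (ball x (real n)))" using assms by simp
  then obtain n :: nat where "ennreal c < emeasure \<mu> (ball x (real n))"
    by (auto simp: less_SUP_iff)
  then have "c < m x (real n)" unfolding emeasure_ball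
    by (metis ennreal_leI linorder_not_less)
  then show ?thesis by blast
qed

section \<open>Doubling scales and integrals over annuli\<close>

text \<open>If doubling failed at every scale beyond one of positive mass, the masses would grow at
  least like \<open>40^j\<close> over radii growing like \<open>20^j\<close>, against linear growth.
  The first doubling scale is taken, so that every scale below it gains a factor 40, twice the ratio
  of the radii.\<close>

lemma doubling_scale_exists:
  assumes "emeasure \<mu> UNIV \<noteq> 0" "0 < r"
  shows "\<exists>k. 0 < m x (20^k * r) \<and> m x (20 * (20^k * r)) \<le> 40 * m x (20^k * r) \<and>
    (\<forall>i<k. 40 * m x (20^i * r) \<le> m x (20^Suc i * r))"
proof -
  define P where "P k \<longleftrightarrow> 0 < m x (20^k * r) \<and> m x (20 * (20^k * r)) \<le> 40 * m x (20^k * r)" for k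
  have "\<exists>k. P k"
  proof (rule ccontr)
    assume nP: "\<nexists>k. P k"
    obtain n :: nat where n: "0 < m x (real n)"
      using m_tendsto_infinity[of 0 x] assms by (auto simp: zero_less_iff_neq_zero)
    obtain k0 :: nat where "real n / r < 20^k0"
      using real_arch_pow[of 20 "real n / r"] by auto
    then have "real n \<le> 20^k0 * r" using assms by (simp add: field_simps)
    then have pos: "0 < m x (20^k0 * r)" using n m_mono less_le_trans by blast
    have step: "40^j * m x (20^k0 * r) \<le> m x (20^(k0+j) * r)" for j
    proof (induction j)
      case (Suc j)
      have "0 < 40^j * m x (20^k0 * r)" using pos by simp
      then have "0 < m x (20^(k0+j) * r)" using Suc by linarith
      with nP have "40 * m x (20^(k0+j) * r) < m x (20 * (20^(k0+j) * r))"
        unfolding P_def by (meson not_le)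
      moreover have "(20::real) * (20^(k0+j) * r) = 20^(k0 + Suc j) * r" by simp
      ultimately show ?case using Suc by simp
    qed simp
    have "40^j * m x (20^k0 * r) \<le> 20^(k0+j) * r" for j
      using order_trans[OF step m_le] assms(2) by simp
    \<comment> \<open>Cancelling \<open>20^j\<close> leaves \<open>2^j\<close> times a positive mass
      below a fixed bound, which fails for large \<open>j\<close>.\<close>
    then have b: "2^j * m x (20^k0 * r) \<le> 20^k0 * r" for j
    proof -
      have "(20::real)^j * (2^j * m x (20^k0 * r)) = 40^j * m x (20^k0 * r)"
        by (simp flip: power_mult_distrib mult.assoc)
      also have "\<dots> \<le> 20^j * (20^k0 * r)"
        using \<open>40^j * m x (20^k0 * r) \<le> 20^(k0+j) * r\<close> by (simp add: power_add mult_ac)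
      finally show ?thesis by simp
    qed
    obtain j :: nat where "20^k0 * r / m x (20^k0 * r) < 2^j"
      using real_arch_pow[of 2] by auto
    with b[of j] pos show False by (simp add: field_simps)
  qed
  then have Pk: "P (LEAST k. P k)" by (metis LeastI)
  have "40 * m x (20^i * r) \<le> m x (20^Suc i * r)" if "i < (LEAST k. P k)" for i
  proof -
    have "\<not> P i" using that not_less_Least by blast
    \<comment> \<open>A scale may also fail \<open>P\<close> by carrying no mass; then the growth
      inequality is trivial.\<close>
    then consider "m x (20^i*r) \<le> 0" | "40 * m x (20^i * r) < m x (20 * (20^i * r))"
      unfolding P_def by linarith
    then show ?thesis
    proof cases
      case 1
      then show ?thesis using measure_nonneg[of \<mu> "ball x (20^Suc i * r)"] by linarith
    qed (simp add: mult_ac)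
  qed
  with Pk show ?thesis unfolding P_def by blast
qed

text \<open>Below the first doubling scale the density \<open>m x s / s\<close> at least doubles
  from one scale to the next. Read downwards from \<open>R\<close>, the annuli therefore contribute
  a geometric series to the integral of \<open>1 / cmod (x - y)\<close>, and the bound does not
  depend on the number of scales.\<close>

lemma doubling_scale:
  assumes "emeasure \<mu> UNIV \<noteq> 0" "0 < r"
  obtains R where "r \<le> R" "0 < m x R" "m x (20 * R) \<le> 40 * m x R"
    "(\<integral>\<^sup>+y\<in>ball x (20 * R) - ball x r. ennreal (1 / cmod (x - y)) \<partial>\<mu>) \<le> 60"
proof -
  obtain k where k: "0 < m x (20^k * r)" "m x (20 * (20^k * r)) \<le> 40 * m x (20^k * r)"
    "\<And>i. i < k \<Longrightarrow> 40 * m x (20^i * r) \<le> m x (20^Suc i * r)"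
    using doubling_scale_exists[OF assms, of x] by blast
  define R where "R = 20^k * r"
  \<comment> \<open>Descending \<open>j\<close> scales from the doubling one divides the mass bound
    by \<open>40^j\<close>.\<close>
  have desc: "40^j * m x (20^(k-j) * r) \<le> 20^k * r" if "j \<le> k" for j
    using that
  proof (induction j)
    case 0
    then show ?case using m_le[of "20^k * r" x] assms by simp
  next
    case (Suc j)
    then have "40 * m x (20^(k - Suc j) * r) \<le> m x (20^(k-j) * r)"
      using k(3)[of "k - Suc j"] by (simp add: Suc_diff_Suc)
    then have "40^Suc j * m x (20^(k - Suc j) * r) \<le> 40^j * m x (20^(k-j) * r)"
      by (simp add: mult_ac)
    then show ?case using Suc by linarith
  qed
  \<comment> \<open>The mass of the ball enclosing the \<open>i\<close>-th annulus over the inner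
    radius of that annulus. Since \<open>40^j = 20^j * 2^j\<close>, a factor \<open>(1/2)^j\<close>
    remains after the radii cancel.\<close>
  have tm: "m x (20^Suc i * r) / (20^i * r) \<le> 20 * (1/2)^(k-1-i)" if "i < k" for i
  proof -
    define j where "j = k - 1 - i"
    have kj: "k = Suc i + j" using that j_def by simp
    have "40^j * m x (20^Suc i * r) \<le> 20^(Suc i + j) * r"
      using desc[of j] kj by simp
    moreover have "(40::real)^j = 20^j * 2^j" by (simp flip: power_mult_distrib)
    ultimately have "20^j * (2^j * m x (20^Suc i * r)) \<le> 20^j * (20^Suc i * r)"
      by (simp only: power_add mult_ac)
    then have "2^j * m x (20^Suc i * r) \<le> 20^Suc i * r"
      by (rule mult_left_le_imp_le) simp
    then show ?thesis unfolding j_def[symmetric] using assms(2)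
      by (simp add: field_simps)
  qed
  have pw: "ennreal (1 / cmod (x - y)) * indicator (ball x (20 * R) - ball x r) y
     \<le> (\<Sum>i<Suc k. ennreal (1 / (20^i * r)) * indicator (ball x (20^Suc i * r)) y)" for y
  proof (cases "y \<in> ball x (20 * R) - ball x r")
    case True
    then obtain i where ge: "20^i * r \<le> dist x y" and i: "dist x y < 20^Suc i * r"
      using geometric_shell[of 20 r "dist x y"] assms by auto
    have "20^i * r < 20^Suc k * r" using ge True by (simp add: R_def mult_ac)
    then have "(20::real)^i < 20^Suc k" using assms by simp
    then have ik: "i < Suc k" by (rule power_less_imp_less_exp[rotated]) simp
    have pos: "0 < 20^i * r" using assms by simp
    then have "0 < cmod (x - y)" using ge unfolding dist_norm by linarith
    have "ennreal (1 / cmod (x - y)) \<le> ennreal (1 / (20^i * r))"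
      using ge pos \<open>0 < cmod (x - y)\<close> assms(2)
      by (intro ennreal_leI divide_left_mono mult_pos_pos) (auto simp: dist_norm)
    also have "\<dots> = ennreal (1 / (20^i * r)) * indicator (ball x (20^Suc i * r)) y"
      using i by simp
    also have "\<dots> \<le> (\<Sum>i<Suc k. ennreal (1 / (20^i * r)) * indicator (ball x (20^Suc i * r)) y)"
      using ik by (intro member_le_sum) auto
    finally show ?thesis using True by simp
  qed simp
  have "(\<integral>\<^sup>+y\<in>ball x (20 * R) - ball x r. ennreal (1 / cmod (x - y)) \<partial>\<mu>)
     \<le> (\<integral>\<^sup>+y. (\<Sum>i<Suc k. ennreal (1 / (20^i * r)) * indicator (ball x (20^Suc i * r)) y) \<partial>\<mu>)"
    by (intro nn_integral_mono pw)
  also have "\<dots> = (\<Sum>i<Suc k. ennreal (1 / (20^i * r)) * emeasure \<mu> (ball x (20^Suc i * r)))"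
    by (subst nn_integral_sum) (auto intro!: sum.cong nn_integral_cmult_indicator simp del: sum.lessThan_Suc)
  also have "\<dots> = ennreal (\<Sum>i<Suc k. m x (20^Suc i * r) / (20^i * r))"
    unfolding emeasure_ball using assms
    by (subst sum_ennreal[symmetric]) (auto simp: ennreal_mult[symmetric] simp del: sum.lessThan_Suc intro!: sum.cong)
  also have "\<dots> \<le> ennreal 60"
  proof (intro ennreal_leI)
    \<comment> \<open>The outermost annulus costs 20 by linear growth alone; the inner ones together
      cost at most 40.\<close>
    have "m x (20^Suc k * r) / (20^k * r) \<le> (20^Suc k * r) / (20^k * r)"
      using m_le[of "20^Suc k * r" x] assms by (intro divide_right_mono) auto
    then have "m x (20^Suc k * r) / (20^k * r) \<le> 20" using assms by simp
    moreover have "(\<Sum>i<k. m x (20^Suc i * r) / (20^i * r)) \<le> (\<Sum>i<k. 20 * (1/2)^(k-1-i))"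
      using tm by (intro sum_mono) auto
    moreover have "\<dots> \<le> 40" using sum_half_powers_le[of k] by (simp flip: sum_distrib_left)
    ultimately show "(\<Sum>i<Suc k. m x (20^Suc i * r) / (20^i * r)) \<le> 60" by simp
  qed
  finally have "(\<integral>\<^sup>+y\<in>ball x (20 * R) - ball x r. ennreal (1 / cmod (x - y)) \<partial>\<mu>) \<le> 60" by simp
  moreover have "r \<le> R" using assms unfolding R_def by simp
  ultimately show ?thesis using k(1,2) that unfolding R_def by blast
qed

section \<open>Tail integrals of the smoothness bound\<close>

definition tail_const :: "real \<Rightarrow> real" where "tail_const \<epsilon> = 2 / (1 - 2 powr (-\<epsilon>))"

text \<open>Dyadic annuli: on the \<open>i\<close>-th one the integrand is at most its value at
  distance \<open>2^i * \<rho>\<close>, and linear growth bounds the mass by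
  \<open>2^Suc i * \<rho>\<close>. The products are \<open>2 * q^i\<close> with
  \<open>q = 2 powr (-\<epsilon>)\<close>, and the series sums to
  \<open>tail_const \<epsilon>\<close> whatever \<open>\<rho>\<close> is.\<close>

lemma nn_integral_tail:
  assumes "0 < \<epsilon>" "0 < \<rho>"
  shows "(\<integral>\<^sup>+y\<in>- ball x \<rho>. ennreal (\<rho> powr \<epsilon> / cmod (x - y) powr (1 + \<epsilon>)) \<partial>\<mu>)
     \<le> ennreal (tail_const \<epsilon>)"
proof -
  define q where "q = 2 powr (-\<epsilon>)"
  have q: "0 < q" "q < 1" using assms by (auto simp: q_def powr_less_one)
  have coef: "\<rho> powr \<epsilon> / (2^i * \<rho>) powr (1 + \<epsilon>) * (2^Suc i * \<rho>) = 2 * q^i" for i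
  proof -
    have "(2^i * \<rho>) powr (1 + \<epsilon>) = 2^i * \<rho> * (2^i) powr \<epsilon> * \<rho> powr \<epsilon>"
      using assms by (simp add: powr_add powr_mult mult_ac)
    moreover have "q^i * (2^i) powr \<epsilon> = 1"
    proof -
      have "(2^i) powr \<epsilon> = (2 powr \<epsilon>)^i" by (simp add: powr_powr flip: powr_realpow powr_power)
      then show ?thesis by (simp add: q_def flip: power_mult_distrib powr_add)
    qed
    then have "q^i = 1 / (2^i) powr \<epsilon>" by (simp add: field_simps)
    ultimately show ?thesis using assms by (simp add: field_simps)
  qed
  have pw: "ennreal (\<rho> powr \<epsilon> / cmod (x - y) powr (1 + \<epsilon>)) * indicator (- ball x \<rho>) y
     \<le> (\<Sum>i. ennreal (\<rho> powr \<epsilon> / (2^i * \<rho>) powr (1 + \<epsilon>)) * indicator (ball x (2^Suc i * \<rho>)) y)" for y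
  proof (cases "y \<in> - ball x \<rho>")
    case True
    then obtain i where ge: "2^i * \<rho> \<le> dist x y" and i: "dist x y < 2^Suc i * \<rho>"
      using geometric_shell[of 2 \<rho> "dist x y"] assms by auto
    have pos: "0 < 2^i * \<rho>" using assms by simp
    then have "0 < cmod (x - y)" using ge unfolding dist_norm by linarith
    have "ennreal (\<rho> powr \<epsilon> / cmod (x - y) powr (1 + \<epsilon>)) \<le> ennreal (\<rho> powr \<epsilon> / (2^i * \<rho>) powr (1 + \<epsilon>))"
      using ge assms pos \<open>0 < cmod (x - y)\<close>
      by (intro ennreal_leI divide_left_mono powr_mono2 mult_pos_pos) (auto simp: dist_norm)
    also have "\<dots> = ennreal (\<rho> powr \<epsilon> / (2^i * \<rho>) powr (1 + \<epsilon>)) * indicator (ball x (2^Suc i * \<rho>)) y"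
      using i by simp
    also have "\<dots> \<le> (\<Sum>i. ennreal (\<rho> powr \<epsilon> / (2^i * \<rho>) powr (1 + \<epsilon>)) * indicator (ball x (2^Suc i * \<rho>)) y)"
      by (rule ennreal_le_suminf)
    finally show ?thesis using True by simp
  qed simp
  have "(\<integral>\<^sup>+y\<in>- ball x \<rho>. ennreal (\<rho> powr \<epsilon> / cmod (x - y) powr (1 + \<epsilon>)) \<partial>\<mu>)
     \<le> (\<integral>\<^sup>+y. (\<Sum>i. ennreal (\<rho> powr \<epsilon> / (2^i * \<rho>) powr (1 + \<epsilon>)) * indicator (ball x (2^Suc i * \<rho>)) y) \<partial>\<mu>)"
    by (intro nn_integral_mono pw)
  also have "\<dots> = (\<Sum>i. ennreal (\<rho> powr \<epsilon> / (2^i * \<rho>) powr (1 + \<epsilon>)) * emeasure \<mu> (ball x (2^Suc i * \<rho>)))"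
    by (subst nn_integral_suminf) (auto intro!: suminf_cong nn_integral_cmult_indicator)
  also have "\<dots> \<le> (\<Sum>i. ennreal (2 * q^i))"
  proof (intro suminf_le summableI)
    fix i
    have "ennreal (\<rho> powr \<epsilon> / (2^i * \<rho>) powr (1 + \<epsilon>)) * emeasure \<mu> (ball x (2^Suc i * \<rho>))
      \<le> ennreal (\<rho> powr \<epsilon> / (2^i * \<rho>) powr (1 + \<epsilon>)) * ennreal (2^Suc i * \<rho>)"
      using assms by (intro mult_left_mono growth) auto
    also have "\<dots> = ennreal (2 * q^i)"
      using assms by (subst coef[symmetric], subst ennreal_mult[symmetric]) auto
    finally show "ennreal (\<rho> powr \<epsilon> / (2^i * \<rho>) powr (1 + \<epsilon>)) * emeasure \<mu> (ball x (2^Suc i * \<rho>)) \<le> ennreal (2 * q^i)" .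
  qed
  also have "\<dots> = ennreal (\<Sum>i. 2 * q^i)"
    using q by (intro suminf_ennreal2 summable_mult summable_geometric) auto
  also have "(\<Sum>i. 2 * q^i) = tail_const \<epsilon>"
    using q by (simp add: suminf_mult suminf_geometric tail_const_def flip: q_def)
  finally show ?thesis .
qed

section \<open>Covering by balls and stopping radii\<close>

text \<open>Vitali's lemma selects disjoint balls whose fivefold enlargements still cover the union.
  The hypothesis trades the \<open>\<mu>\<close>-mass of an enlargement for the
  \<open>\<kappa>\<close>-mass of the ball itself, and by disjointness the latter add up to at most
  the total mass. The Cotlar sets, the stopping balls and the maximal functions below are all
  estimated this way.\<close>

lemma Vitali_measure_bound:
  fixes \<kappa> :: "complex measure" and c :: ennreal
  assumes [measurable_cong]: "sets \<kappa> = sets borel"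
    and fam: "\<And>x R. (x, R) \<in> I \<Longrightarrow> 0 < R \<and> c * emeasure \<mu> (ball x (5 * R)) \<le> emeasure \<kappa> (ball x R)"
  shows "c * emeasure \<mu> (\<Union>(x, R)\<in>I. ball x R) \<le> emeasure \<kappa> UNIV"
proof -
  \<comment> \<open>The covering lemma needs bounded radii, so these are first capped at
    \<open>n\<close>; the sets \<open>U n\<close> increase to the whole union.\<close>
  define U where "U n = (\<Union>(x, R)\<in>{(x, R)\<in>I. R \<le> real n}. ball x R)" for n
  have openU: "open (U n)" for n unfolding U_def by auto
  then have [measurable]: "U n \<in> sets borel" for n by auto
  have bound: "c * emeasure \<mu> (U n) \<le> emeasure \<kappa> UNIV" for n
  proof -
    define J where "J = {i \<in> I. snd i \<le> real n}"
    have U_J: "U n = (\<Union>i\<in>J. ball (fst i) (snd i))" by (force simp: U_def J_def)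
    have J: "\<And>i. i \<in> J \<Longrightarrow> 0 < snd i \<and> snd i \<le> real n \<and> c * emeasure \<mu> (ball (fst i) (5 * snd i)) \<le> emeasure \<kappa> (ball (fst i) (snd i))"
      using fam by (force simp: J_def)
    obtain C where C: "countable C" "C \<subseteq> J"
      "pairwise (\<lambda>i j. disjnt (ball (fst i) (snd i)) (ball (fst j) (snd j))) C"
      "U n \<subseteq> (\<Union>i\<in>C. ball (fst i) (5 * snd i))"
      by (rule Vitali_covering_lemma_balls[where S = "U n" and K = J and a = fst and r = snd and B = "real n"]) (use J U_J in auto)
    \<comment> \<open>The countable selection, indexed by natural numbers and padded with empty
      sets. Here \<open>c\<close> is a dilation factor, used with the values 1 and 5, not the weight
      in the lemma.\<close>
    define B where "B c n = (if n \<in> to_nat_on C ` C then ball (fst (from_nat_into C n)) (c * snd (from_nat_into C n)) else {})"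
      for c :: real and n
    have B_meas [measurable]: "B c n \<in> sets borel" for c n unfolding B_def by auto
    have UN_B: "(\<Union>n. B c n) = (\<Union>i\<in>C. ball (fst i) (c * snd i))" for c
      using C(1) by (auto simp: B_def split: if_splits)
    have "disjoint_family (B 1)"
    proof (clarsimp simp: disjoint_family_on_def)
      fix a b :: nat assume "a \<noteq> b"
      show "B 1 a \<inter> B 1 b = {}"
      proof (cases "a \<in> to_nat_on C ` C \<and> b \<in> to_nat_on C ` C")
        case True
        then obtain i j where ij: "a = to_nat_on C i" "b = to_nat_on C j" "i \<in> C" "j \<in> C" by auto
        with \<open>a \<noteq> b\<close> have "i \<noteq> j" by auto
        then have "disjnt (ball (fst i) (snd i)) (ball (fst j) (snd j))"
          using C(3) ij by (auto simp: pairwise_def)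
        then show ?thesis using ij C(1) by (simp add: B_def disjnt_def)
      qed (auto simp: B_def)
    qed
    then have "(\<Sum>n. emeasure \<kappa> (B 1 n)) = emeasure \<kappa> (\<Union>n. B 1 n)"
      by (intro suminf_emeasure) (auto simp: assms(1))
    also have "\<dots> \<le> emeasure \<kappa> UNIV" by (intro emeasure_mono) (auto simp: assms(1))
    finally have le: "(\<Sum>n. emeasure \<kappa> (B 1 n)) \<le> emeasure \<kappa> UNIV" .
    have "c * emeasure \<mu> (U n) \<le> c * emeasure \<mu> (\<Union>n. B 5 n)"
      using C(4) unfolding UN_B[symmetric] by (intro mult_left_mono emeasure_mono) auto
    also have "\<dots> \<le> c * (\<Sum>n. emeasure \<mu> (B 5 n))"
      by (intro mult_left_mono emeasure_subadditive_countably) auto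
    also have "\<dots> = (\<Sum>n. c * emeasure \<mu> (B 5 n))"
      by simp
    also have "\<dots> \<le> (\<Sum>n. emeasure \<kappa> (B 1 n))"
    proof (intro suminf_le summableI)
      fix n
      show "c * emeasure \<mu> (B 5 n) \<le> emeasure \<kappa> (B 1 n)"
        using J C(1,2) by (cases "n \<in> to_nat_on C ` C") (auto simp: B_def)
    qed
    also note le
    finally show ?thesis .
  qed
  have "(\<Union>(x, R)\<in>I. ball x R) = (\<Union>n. U n)"
  proof (intro set_eqI iffI)
    fix z assume "z \<in> (\<Union>(x, R)\<in>I. ball x R)"
    then obtain x R where z: "(x, R) \<in> I" "z \<in> ball x R" by auto
    obtain n :: nat where "R \<le> real n" using real_arch_simple by blast
    with z have "z \<in> U n" unfolding U_def by auto
    then show "z \<in> (\<Union>n. U n)" by blast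
  next
    fix z assume "z \<in> (\<Union>n. U n)"
    then obtain x R where "(x, R) \<in> I" "z \<in> ball x R" unfolding U_def by auto
    then show "z \<in> (\<Union>(x, R)\<in>I. ball x R)" by blast
  qed
  moreover have "incseq U" unfolding incseq_def
  proof (intro allI impI)
    fix i j :: nat assume "i \<le> j"
    then have "{(x, R)\<in>I. R \<le> real i} \<subseteq> {(x, R)\<in>I. R \<le> real j}" by auto
    then show "U i \<subseteq> U j" unfolding U_def by (rule UN_mono) simp
  qed
  then have "emeasure \<mu> (\<Union>n. U n) = (SUP n. emeasure \<mu> (U n))"
    by (intro SUP_emeasure_incseq[symmetric]) auto
  ultimately have "c * emeasure \<mu> (\<Union>(x, R)\<in>I. ball x R) = (SUP n. c * emeasure \<mu> (U n))"
    by (simp add: SUP_mult_left_ennreal)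
  also have "\<dots> \<le> emeasure \<kappa> UNIV" by (intro SUP_least bound)
  finally show ?thesis .
qed

text \<open>The radii at which \<open>V\<close> is too dense against \<open>\<mu>\<close> form a set
  \<open>Q\<close> that is nonempty, since small balls have little \<open>\<mu>\<close>-mass but
  keep the atom \<open>\<alpha>\<close>, and bounded, since the \<open>\<mu>\<close>-mass of large
  balls exceeds \<open>a / t\<close>. A member beyond half of \<open>Sup Q\<close> is taken, so that
  everything from twice it on lies outside \<open>Q\<close>. The factor 10 matches the fivefold
  enlargement of balls of radius \<open>2 * \<rho>\<close>.\<close>

lemma stopping_radius_exists:
  fixes V :: "complex set \<Rightarrow> real"
  assumes "0 < \<alpha>" "0 < t" and V: "\<And>r. 0 < r \<Longrightarrow> \<alpha> \<le> V (ball p r)" "\<And>r. V (ball p r) \<le> a"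
    and big: "ennreal (a / t) < emeasure \<mu> UNIV"
  shows "\<exists>\<rho>>0. t * m p (10 * \<rho>) < V (ball p \<rho>) \<and> (\<forall>r\<ge>2 * \<rho>. V (ball p r) \<le> t * m p (10 * r))"
proof -
  define Q where "Q = {\<rho>. 0 < \<rho> \<and> t * m p (10 * \<rho>) < V (ball p \<rho>)}"
  \<comment> \<open>At this radius linear growth bounds the right side of the comparison by
    \<open>\<alpha> / 2\<close>.\<close>
  have "\<alpha> / (20 * t) \<in> Q"
  proof -
    have pos: "0 < \<alpha> / (20 * t)" using assms by simp
    then have "m p (10 * (\<alpha> / (20 * t))) \<le> 10 * (\<alpha> / (20 * t))" by (intro m_le) auto
    then have "t * m p (10 * (\<alpha> / (20 * t))) \<le> t * (10 * (\<alpha> / (20 * t)))"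
      using assms by (intro mult_left_mono) auto
    also have "\<dots> = \<alpha> / 2" using assms by simp
    also have "\<dots> < \<alpha>" using assms by simp
    also have "\<alpha> \<le> V (ball p (\<alpha> / (20 * t)))" using V(1) pos by simp
    finally show ?thesis unfolding Q_def using pos by simp
  qed
  obtain n :: nat where n: "a / t < m p (real n)" using m_tendsto_infinity[OF big] by blast
  have Q_le: "\<rho> \<le> real n" if "\<rho> \<in> Q" for \<rho>
  proof (rule ccontr)
    assume "\<not> \<rho> \<le> real n"
    then have "m p (real n) \<le> m p (10 * \<rho>)" by (intro m_mono) auto
    with n have "a / t < m p (10 * \<rho>)" by linarith
    then have "a < t * m p (10 * \<rho>)" using assms(2) by (simp add: pos_divide_less_eq mult.commute)
    with that V(2)[of \<rho>] show False unfolding Q_def by auto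
  qed
  then have bdd: "bdd_above Q" by (intro bdd_aboveI)
  have "0 < \<alpha> / (20 * t)" using assms by simp
  also have "\<dots> \<le> Sup Q" using \<open>\<alpha> / (20 * t) \<in> Q\<close> bdd by (rule cSup_upper)
  finally have "Sup Q / 2 < Sup Q" by simp
  then obtain \<rho> where \<rho>: "\<rho> \<in> Q" "Sup Q / 2 < \<rho>"
    using less_cSup_iff[OF _ bdd, of "Sup Q / 2"] \<open>\<alpha> / (20 * t) \<in> Q\<close> by auto
  have "V (ball p r) \<le> t * m p (10 * r)" if "2 * \<rho> \<le> r" for r
  proof (rule ccontr)
    assume neg: "\<not> V (ball p r) \<le> t * m p (10 * r)"
    have "0 < \<rho>" using \<rho> unfolding Q_def by auto
    then have "r \<in> Q" unfolding Q_def using that neg by auto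
    then have "r \<le> Sup Q" using bdd by (rule cSup_upper)
    with \<rho>(2) that show False by linarith
  qed
  with \<rho>(1) show ?thesis unfolding Q_def by blast
qed

end

section \<open>Bounded densities, discrete and signed measures\<close>

text \<open>A greedy choice in order of increasing \<open>R\<close>. The densities already placed
  have total mass at most \<open>c * measure M (D p)\<close> on \<open>D p\<close>, so by
  Chebyshev's inequality their sum exceeds \<open>2 * c\<close> on at most half of it. A constant on
  the remaining part, of value at most \<open>2 * c\<close>, can carry the new mass.\<close>

lemma bounded_packing:
  fixes M :: "'a measure" and D :: "'i \<Rightarrow> 'a set" and \<alpha> R :: "'i \<Rightarrow> real"
  assumes "finite J" "0 < c"
    and "\<And>j. j \<in> J \<Longrightarrow> D j \<in> sets M" "\<And>j. j \<in> J \<Longrightarrow> 0 < measure M (D j)"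
    and "\<And>j. j \<in> J \<Longrightarrow> 0 \<le> \<alpha> j"
    and "\<And>j. j \<in> J \<Longrightarrow> (\<Sum>k | k \<in> J \<and> R k \<le> R j \<and> D k \<inter> D j \<noteq> {}. \<alpha> k) \<le> c * measure M (D j)"
  shows "\<exists>f. (\<forall>j\<in>J. has_bochner_integral M (f j) (\<alpha> j) \<and> (\<forall>x. 0 \<le> f j x) \<and> (\<forall>x. x \<notin> D j \<longrightarrow> f j x = 0) \<and>
      (\<forall>x. f j x \<le> 2 * \<alpha> j / measure M (D j))) \<and> (\<forall>x. (\<Sum>j\<in>J. f j x) \<le> 4 * c)"
  using assms
proof (induction J rule: finite_ranking_induct[where f = R])
  case empty
  then show ?case by auto
next
  case (insert p S)
  have sub: "(\<Sum>k | k \<in> S \<and> R k \<le> R j \<and> D k \<inter> D j \<noteq> {}. \<alpha> k) \<le> c * measure M (D j)" if "j \<in> S" for j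
  proof -
    have "(\<Sum>k | k \<in> S \<and> R k \<le> R j \<and> D k \<inter> D j \<noteq> {}. \<alpha> k) \<le> (\<Sum>k | k \<in> insert p S \<and> R k \<le> R j \<and> D k \<inter> D j \<noteq> {}. \<alpha> k)"
      using insert.hyps(1) insert.prems(4) by (intro sum_mono2) auto
    also have "\<dots> \<le> c * measure M (D j)" using insert.prems(5)[of j] that by simp
    finally show ?thesis .
  qed
  have "\<exists>f. (\<forall>j\<in>S. has_bochner_integral M (f j) (\<alpha> j) \<and> (\<forall>x. 0 \<le> f j x) \<and> (\<forall>x. x \<notin> D j \<longrightarrow> f j x = 0) \<and>
      (\<forall>x. f j x \<le> 2 * \<alpha> j / measure M (D j))) \<and> (\<forall>x. (\<Sum>j\<in>S. f j x) \<le> 4 * c)"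
    using \<open>0 < c\<close> by (rule insert.IH) (use insert.prems sub in simp_all)
  then obtain f where f0: "\<forall>j\<in>S. has_bochner_integral M (f j) (\<alpha> j) \<and> (\<forall>x. 0 \<le> f j x) \<and> (\<forall>x. x \<notin> D j \<longrightarrow> f j x = 0) \<and>
      (\<forall>x. f j x \<le> 2 * \<alpha> j / measure M (D j))" and f_sum: "\<forall>x. (\<Sum>j\<in>S. f j x) \<le> 4 * c"
    by (elim exE conjE)
  have f: "\<And>j. j \<in> S \<Longrightarrow> has_bochner_integral M (f j) (\<alpha> j)" "\<And>j x. j \<in> S \<Longrightarrow> 0 \<le> f j x"
    "\<And>j x. j \<in> S \<Longrightarrow> x \<notin> D j \<Longrightarrow> f j x = 0" "\<And>j x. j \<in> S \<Longrightarrow> f j x \<le> 2 * \<alpha> j / measure M (D j)"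
    "\<And>x. (\<Sum>j\<in>S. f j x) \<le> 4 * c"
    using f0 f_sum by simp_all
  have f_int: "integrable M (f j)" if "j \<in> S" for j using f(1)[OF that] by (rule integrable.intros)
  \<comment> \<open>The density for \<open>p\<close> lives where the earlier ones add up to at most \<open>2 * c\<close>, at least half of \<open>D p\<close>.\<close>
  show ?case
  proof (cases "p \<in> S")
    \<comment> \<open>The induction rule inserts an element with the largest \<open>R\<close> so
      far, but leaves open whether it is new.\<close>
    case True
    then have "insert p S = S" by auto
    with f0 f_sum show ?thesis by (intro exI[of _ f]) simp
  next
    case pS: False
    define s where "s x = (\<Sum>j\<in>S. f j x)" for x
    have Dp: "D p \<in> sets M" "0 < measure M (D p)" using insert.prems by auto
    have fin: "emeasure M (D p) < \<infinity>" using Dp(2) 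
      by (metis enn2real_top infinity_ennreal_def less_irrefl less_top measure_def)
    have s_int: "integrable M s" unfolding s_def
      using f_int by (intro Bochner_Integration.integrable_sum) auto
    have [measurable]: "s \<in> borel_measurable M" using s_int by auto
    note [measurable] = Dp(1)
    define A where "A = {x \<in> D p. s x \<le> 2 * c}"
    define B where "B = {x \<in> D p. 2 * c < s x}"
    have AB: "A \<union> B = D p" "A \<inter> B = {}" unfolding A_def B_def by auto
    have "A = D p \<inter> {x \<in> space M. s x \<le> 2 * c}" "B = D p \<inter> {x \<in> space M. 2 * c < s x}"
      using sets.sets_into_space[OF Dp(1)] unfolding A_def B_def by auto
    moreover have "D p \<inter> {x \<in> space M. s x \<le> 2 * c} \<in> sets M" "D p \<inter> {x \<in> space M. 2 * c < s x} \<in> sets M"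
      by measurable
    ultimately have [measurable]: "A \<in> sets M" "B \<in> sets M" by auto
    have finAB: "emeasure M A < \<infinity>" "emeasure M B < \<infinity>"
      using AB fin emeasure_mono[of A "D p" M] emeasure_mono[of B "D p" M] Dp(1) by (auto intro: le_less_trans)
    have "measure M A + measure M B = measure M (D p)"
      using AB finAB by (metis \<open>A \<in> sets M\<close> \<open>B \<in> sets M\<close> measure_Union less_top infinity_ennreal_def less_irrefl)
    \<comment> \<open>\<open>B\<close> is where the earlier densities are already crowded:
      \<open>2 * c\<close> times its measure is at most their integral over
      \<open>D p\<close>.\<close>
    moreover have "2 * c * measure M B \<le> c * measure M (D p)"
    proof -
      have "2 * c * measure M B = (\<integral>x. 2 * c * indicat_real B x \<partial>M)" by simp
      also have "\<dots> \<le> (\<integral>x. (\<Sum>j\<in>S. indicat_real (D p) x *\<^sub>R f j x) \<partial>M)"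
      proof (intro integral_mono)
        show "integrable M (\<lambda>x. 2 * c * indicat_real B x)"
          using finAB by (intro integrable_mult_right integrable_real_indicator) auto
        show "integrable M (\<lambda>x. \<Sum>j\<in>S. indicat_real (D p) x *\<^sub>R f j x)"
          using f_int by (intro Bochner_Integration.integrable_sum integrable_mult_indicator) auto
        show "2 * c * indicat_real B x \<le> (\<Sum>j\<in>S. indicat_real (D p) x *\<^sub>R f j x)" for x
          using f(2) by (auto simp: B_def s_def indicator_def intro!: sum_nonneg)
      qed
      also have "\<dots> = (\<Sum>j\<in>S. \<integral>x. indicat_real (D p) x *\<^sub>R f j x \<partial>M)"
        using f_int by (intro Bochner_Integration.integral_sum integrable_mult_indicator) auto
      \<comment> \<open>An earlier density contributes only if its set meets \<open>D p\<close>, and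
        then at most its total mass.\<close>
      also have "\<dots> \<le> (\<Sum>j\<in>S. if D j \<inter> D p \<noteq> {} then \<alpha> j else 0)"
      proof (intro sum_mono)
        fix j assume j: "j \<in> S"
        show "(\<integral>x. indicat_real (D p) x *\<^sub>R f j x \<partial>M) \<le> (if D j \<inter> D p \<noteq> {} then \<alpha> j else 0)"
        proof (cases "D j \<inter> D p = {}")
          case True
          have eq: "(\<lambda>x. indicat_real (D p) x *\<^sub>R f j x) = (\<lambda>_. 0)"
            using f(3)[OF j] True by (auto simp: indicator_def fun_eq_iff)
          show ?thesis unfolding eq using True by simp
        next
          case False
          have "(\<integral>x. indicat_real (D p) x *\<^sub>R f j x \<partial>M) \<le> (\<integral>x. f j x \<partial>M)"
            using f_int[OF j] f(2)[OF j] by (intro integral_mono integrable_mult_indicator)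
              (auto simp: indicator_def)
          also have "\<dots> = \<alpha> j" using f(1)[OF j] by (rule has_bochner_integral_integral_eq)
          finally show ?thesis using False by simp
        qed
      qed
      also have "\<dots> = (\<Sum>k | k \<in> S \<and> D k \<inter> D p \<noteq> {}. \<alpha> k)"
        using insert.hyps(1) by (simp add: sum.inter_filter)
      \<comment> \<open>All earlier \<open>k\<close> satisfy \<open>R k \<le> R p\<close>, so they
        are counted in the hypothesis for \<open>p\<close>.\<close>
      also have "\<dots> \<le> (\<Sum>k | k \<in> insert p S \<and> R k \<le> R p \<and> D k \<inter> D p \<noteq> {}. \<alpha> k)"
        using insert.hyps insert.prems(4) by (intro sum_mono2) auto
      also have "\<dots> \<le> c * measure M (D p)" using insert.prems(5)[of p] by simp
      finally show ?thesis .
    qed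
    ultimately have half: "measure M (D p) \<le> 2 * measure M A" using \<open>0 < c\<close>
    proof -
      assume 1: "measure M A + measure M B = measure M (D p)" and 2: "2 * c * measure M B \<le> c * measure M (D p)"
      from 2 have "c * (2 * measure M B) \<le> c * measure M (D p)" by simp
      then have "2 * measure M B \<le> measure M (D p)" using \<open>0 < c\<close> by simp
      with 1 show ?thesis by linarith
    qed
    then have Apos: "0 < measure M A" using Dp(2) by linarith
    have \<alpha>p: "0 \<le> \<alpha> p" "\<alpha> p \<le> c * measure M (D p)"
    proof -
      show "0 \<le> \<alpha> p" using insert.prems by simp
      have "D p \<noteq> {}" using Dp(2) by auto
      \<comment> \<open>The sum in the hypothesis for \<open>p\<close> contains the term of
        \<open>p\<close> itself, because \<open>D p\<close> is nonempty.\<close>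
      then have "(\<Sum>k\<in>{p}. \<alpha> k) \<le> (\<Sum>k | k \<in> insert p S \<and> R k \<le> R p \<and> D k \<inter> D p \<noteq> {}. \<alpha> k)"
        using insert.hyps(1) insert.prems(4) by (intro sum_mono2) auto
      then show "\<alpha> p \<le> c * measure M (D p)" using insert.prems(5)[of p] by simp
    qed
    define g where "g x = \<alpha> p / measure M A * indicat_real A x" for x
    have hb: "has_bochner_integral M g (\<alpha> p)"
    proof -
      have "has_bochner_integral M (\<lambda>x. \<alpha> p / measure M A * indicat_real A x) (\<alpha> p / measure M A * measure M A)"
        using finAB by (intro has_bochner_integral_mult_right has_bochner_integral_real_indicator) auto
      then show ?thesis using Apos unfolding g_def by simp
    qed
    have gle: "\<alpha> p / measure M A \<le> 2 * \<alpha> p / measure M (D p)"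
      using half Apos Dp(2) \<alpha>p(1) mult_left_mono[OF half, of "\<alpha> p"] by (simp add: field_simps)
    have gle2: "2 * \<alpha> p / measure M (D p) \<le> 2 * c"
      using \<alpha>p Dp(2) by (simp add: pos_divide_le_eq)
    define f' where "f' = f(p := g)"
    have f'S: "f' j = f j" if "j \<in> S" for j using that pS unfolding f'_def by auto
    have f'p: "f' p = g" unfolding f'_def by simp
    have "\<forall>j\<in>insert p S. has_bochner_integral M (f' j) (\<alpha> j) \<and> (\<forall>x. 0 \<le> f' j x) \<and> (\<forall>x. x \<notin> D j \<longrightarrow> f' j x = 0) \<and>
        (\<forall>x. f' j x \<le> 2 * \<alpha> j / measure M (D j))"
    proof
      fix j assume "j \<in> insert p S"
      then consider "j \<in> S" | "j = p" by auto
      then show "has_bochner_integral M (f' j) (\<alpha> j) \<and> (\<forall>x. 0 \<le> f' j x) \<and> (\<forall>x. x \<notin> D j \<longrightarrow> f' j x = 0) \<and>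
        (\<forall>x. f' j x \<le> 2 * \<alpha> j / measure M (D j))"
      proof cases
        case 1
        then show ?thesis using f by (simp add: f'S)
      next
        case 2
        show ?thesis unfolding 2 f'p using hb \<alpha>p Apos gle Dp(2) AB(1)
          by (auto simp: g_def indicator_def)
      qed
    qed
    moreover have "(\<Sum>j\<in>insert p S. f' j x) \<le> 4 * c" for x
    proof -
      have "(\<Sum>j\<in>insert p S. f' j x) = g x + s x"
        using pS insert.hyps(1) unfolding s_def by (simp add: f'p f'S)
      also have "\<dots> \<le> 4 * c"
      proof (cases "x \<in> A")
        case True
        then have "s x \<le> 2 * c" "g x \<le> 2 * c" using gle gle2 by (auto simp: A_def g_def)
        then show ?thesis by simp
      next
        case False
        then show ?thesis using f(5)[of x] by (simp add: g_def s_def)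
      qed
      finally show ?thesis .
    qed
    ultimately show ?thesis by blast
  qed
qed

section \<open>Point masses and simple functions\<close>

text \<open>Pushing the point measure forward along the inclusion moves it from the power set of
  \<open>P\<close> to the Borel sets, where \<open>Vitali_measure_bound\<close> applies.\<close>

lemma discrete_measure_exists:
  fixes P :: "'a::t1_space set" and \<alpha> :: "'a \<Rightarrow> real"
  assumes "finite P" "\<And>p. p \<in> P \<Longrightarrow> 0 \<le> \<alpha> p"
  shows "\<exists>\<kappa>. sets \<kappa> = sets borel \<and> (\<forall>B\<in>sets borel. emeasure \<kappa> B = ennreal (\<Sum>p\<in>P \<inter> B. \<alpha> p))"
proof (intro exI conjI ballI)
  let ?\<kappa> = "distr (point_measure P (\<lambda>p. ennreal (\<alpha> p))) borel (\<lambda>x. x)"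
  show "sets ?\<kappa> = sets borel" by simp
  fix B :: "'a set" assume B: "B \<in> sets borel"
  have "emeasure ?\<kappa> B = emeasure (point_measure P (\<lambda>p. ennreal (\<alpha> p))) (P \<inter> B)"
    using B by (subst emeasure_distr) (auto simp: measurable_point_measure_eq1 space_point_measure Int_commute)
  also have "\<dots> = (\<Sum>p\<in>P \<inter> B. ennreal (\<alpha> p))"
    using assms(1) by (intro emeasure_point_measure_finite) auto
  also have "\<dots> = ennreal (\<Sum>p\<in>P \<inter> B. \<alpha> p)" using assms(2) by (intro sum_ennreal) auto
  finally show "emeasure ?\<kappa> B = ennreal (\<Sum>p\<in>P \<inter> B. \<alpha> p)" .
qed

text \<open>The image of \<open>\<kappa>\<close> under a simple function is a finite sum of point
  masses. Values with null preimage are discarded so that all weights are positive, as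
  \<open>weak_type_discrete\<close> requires.\<close>

lemma integral_simple_composition:
  fixes g :: "complex \<Rightarrow> complex"
  assumes "finite_measure \<kappa>" "simple_function \<kappa> F"
  defines "P \<equiv> {p \<in> F ` space \<kappa>. 0 < measure \<kappa> (F -` {p} \<inter> space \<kappa>)}"
  shows "(\<integral>y. g (F y) \<partial>\<kappa>) = (\<Sum>p\<in>P. measure \<kappa> (F -` {p} \<inter> space \<kappa>) *\<^sub>R g p)"
    and "(\<Sum>p\<in>P. measure \<kappa> (F -` {p} \<inter> space \<kappa>)) \<le> measure \<kappa> (space \<kappa>)"
    and "finite P"
proof -
  interpret finite_measure \<kappa> by fact
  let ?I = "\<lambda>p. F -` {p} \<inter> space \<kappa>"
  have fin: "finite (F ` space \<kappa>)" and I: "\<And>p. ?I p \<in> sets \<kappa>"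
    using simple_functionD[OF assms(2)] by auto
  show "finite P" unfolding P_def using fin by simp
  have "(\<integral>y. g (F y) \<partial>\<kappa>) = (\<integral>y. (\<Sum>p\<in>F ` space \<kappa>. indicat_real (?I p) y *\<^sub>R g p) \<partial>\<kappa>)"
  proof (rule Bochner_Integration.integral_cong[OF refl])
    fix y assume y: "y \<in> space \<kappa>"
    have "(\<Sum>p\<in>F ` space \<kappa>. indicat_real (?I p) y *\<^sub>R g p) = (\<Sum>p\<in>F ` space \<kappa>. if p = F y then g p else 0)"
      using y by (intro sum.cong) (auto simp: indicator_def)
    also have "\<dots> = g (F y)" using fin y by (simp add: sum.delta)
    finally show "g (F y) = (\<Sum>p\<in>F ` space \<kappa>. indicat_real (?I p) y *\<^sub>R g p)" by simp
  qed
  also have "\<dots> = (\<Sum>p\<in>F ` space \<kappa>. measure \<kappa> (?I p) *\<^sub>R g p)"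
    using I by (subst Bochner_Integration.integral_sum) (auto simp: less_top[symmetric] intro!: sum.cong)
  also have "\<dots> = (\<Sum>p\<in>P. measure \<kappa> (?I p) *\<^sub>R g p)"
    unfolding P_def using fin by (intro sum.mono_neutral_right) (auto simp: zero_less_measure_iff)
  finally show "(\<integral>y. g (F y) \<partial>\<kappa>) = (\<Sum>p\<in>P. measure \<kappa> (?I p) *\<^sub>R g p)" .
  have "(\<Sum>p\<in>P. measure \<kappa> (?I p)) = measure \<kappa> (\<Union>p\<in>P. ?I p)"
    using I \<open>finite P\<close> by (intro finite_measure_finite_Union[symmetric]) (auto simp: disjoint_family_on_def)
  also have "\<dots> \<le> measure \<kappa> (space \<kappa>)" using I \<open>finite P\<close> by (intro finite_measure_mono) auto
  finally show "(\<Sum>p\<in>P. measure \<kappa> (?I p)) \<le> measure \<kappa> (space \<kappa>)" .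
qed

section \<open>Signed measures and their upper variations\<close>

lemma finite_signed_borel_measure_Un:
  assumes \<nu>: "finite_signed_borel_measure \<nu>" and AB: "A \<in> sets borel" "B \<in> sets borel" "A \<inter> B = {}"
  shows "\<nu> (A \<union> B) = \<nu> A + \<nu> B"
proof -
  have "disjoint_family (binaryset A B)"
    using AB by (auto simp: disjoint_family_on_def binaryset_def)
  moreover have "range (binaryset A B) \<subseteq> sets borel" using AB by (simp add: range_binaryset_eq)
  ultimately have "(\<lambda>i. \<nu> (binaryset A B i)) sums \<nu> (A \<union> B)"
    using \<nu> unfolding finite_signed_borel_measure_def UN_binaryset_eq[symmetric] by blast
  moreover have "(\<lambda>i. \<nu> (binaryset A B i)) sums (\<nu> A + \<nu> B)"
    using \<nu> by (intro binaryset_sums) (simp add: finite_signed_borel_measure_def)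
  ultimately show ?thesis by (rule sums_unique2)
qed

lemma finite_signed_borel_measure_uminus:
  "finite_signed_borel_measure \<nu> \<Longrightarrow> finite_signed_borel_measure (\<lambda>E. - \<nu> E)"
  by (auto simp: finite_signed_borel_measure_def intro!: sums_minus)

lemma total_variation_uminus: "total_variation (\<lambda>E. - \<nu> E) = total_variation \<nu>"
  by (simp add: total_variation_def)

lemma abs_le_total_variation:
  assumes "F \<in> sets borel"
  shows "ennreal \<bar>\<nu> F\<bar> \<le> total_variation \<nu>"
proof -
  have "ennreal \<bar>\<nu> F\<bar> \<le> (\<Sum>E\<in>{F, - F}. ennreal \<bar>\<nu> E\<bar>)" by (intro member_le_sum) auto
  also have "\<dots> \<le> total_variation \<nu>" unfolding total_variation_def
    using assms by (intro SUP_upper) (auto simp: disjoint_def)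
  finally show ?thesis .
qed

text \<open>\<open>ennreal\<close> sends negative terms to 0, which can only enlarge the partial
  sums.\<close>

lemma ennreal_sums_le:
  assumes "f sums s"
  shows "ennreal s \<le> (\<Sum>i. ennreal (f i))"
proof (rule LIMSEQ_le_const2)
  show "(\<lambda>n. ennreal (\<Sum>i<n. f i)) \<longlonglongrightarrow> ennreal s"
    using assms unfolding sums_def by (intro tendsto_ennrealI)
  have "ennreal (\<Sum>i<n. f i) \<le> (\<Sum>i. ennreal (f i))" for n
  proof -
    have "ennreal (\<Sum>i<n. f i) \<le> ennreal (\<Sum>i<n. max 0 (f i))" by (intro ennreal_leI sum_mono) auto
    also have "\<dots> = (\<Sum>i<n. ennreal (max 0 (f i)))" by (rule sum_ennreal[symmetric]) auto
    also have "\<dots> = (\<Sum>i<n. ennreal (f i))" by (intro sum.cong) (auto simp: max_def ennreal_neg)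
    also have "\<dots> \<le> (\<Sum>i. ennreal (f i))" by (intro sum_le_suminf) auto
    finally show ?thesis .
  qed
  then show "\<exists>k. \<forall>n\<ge>k. ennreal (\<Sum>i<n. f i) \<le> (\<Sum>i. ennreal (f i))" by blast
qed

text \<open>\<open>measure_of\<close> keeps the set function only if it is countably additive.
  Superadditivity comes from joining subsets of disjoint sets; the converse comes from cutting a
  subset \<open>F\<close> of the union into the pieces \<open>F \<inter> A i\<close>.\<close>

lemma upper_variation_emeasure:
  assumes \<nu>: "finite_signed_borel_measure \<nu>" and E: "E \<in> sets borel"
  shows "emeasure (upper_variation \<nu>) E = (SUP F \<in> {F \<in> sets borel. F \<subseteq> E}. ennreal (\<nu> F))"
proof -
  define u where "u E = (SUP F \<in> {F \<in> sets borel. F \<subseteq> E}. ennreal (\<nu> F))" for E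
  have \<nu>0: "\<nu> {} = 0" using \<nu> by (simp add: finite_signed_borel_measure_def)
  have u_ge: "ennreal (\<nu> F) \<le> u E" if "F \<in> sets borel" "F \<subseteq> E" for E F
    unfolding u_def using that by (intro SUP_upper) auto
  have u_mono: "u E \<le> u F" if "E \<subseteq> F" for E F
    unfolding u_def using that by (intro SUP_subset_mono) auto
  have u0: "u {} = 0"
  proof -
    have "{F \<in> sets borel. F \<subseteq> {}} = {{} :: 'a set}" by auto
    then show ?thesis unfolding u_def by (simp add: \<nu>0)
  qed
  have super: "u E + u F \<le> u (E \<union> F)" if "E \<inter> F = {}" for E F
  proof -
    let ?S = "\<lambda>E :: 'a set. {F \<in> sets borel. F \<subseteq> E}"
    have ne: "?S E \<noteq> {}" for E by auto
    have "ennreal (\<nu> G) + ennreal (\<nu> H) \<le> u (E \<union> F)" if G: "G \<in> ?S E" and H: "H \<in> ?S F" for G H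
    proof -
      \<comment> \<open>A piece of negative value counts as 0 and is dropped; otherwise the two
        pieces are joined.\<close>
      consider "\<nu> G < 0" | "\<nu> H < 0" | "0 \<le> \<nu> G" "0 \<le> \<nu> H" by linarith
      then show ?thesis
      proof cases
        case 1
        then show ?thesis using H u_ge[of H "E \<union> F"] by (auto simp: ennreal_neg)
      next
        case 2
        then show ?thesis using G u_ge[of G "E \<union> F"] by (auto simp: ennreal_neg)
      next
        case 3
        have "\<nu> (G \<union> H) = \<nu> G + \<nu> H" using \<nu> G H \<open>E \<inter> F = {}\<close> by (intro finite_signed_borel_measure_Un) auto
        then have "ennreal (\<nu> G) + ennreal (\<nu> H) = ennreal (\<nu> (G \<union> H))" using 3 by simp
        also have "\<dots> \<le> u (E \<union> F)" using G H by (intro u_ge) auto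
        finally show ?thesis .
      qed
    qed
    then have "ennreal (\<nu> G) + u F \<le> u (E \<union> F)" if "G \<in> ?S E" for G
      using that unfolding u_def[of F] ennreal_SUP_add_right[OF ne[of F]] by (intro SUP_least)
    then have "u F + ennreal (\<nu> G) \<le> u (E \<union> F)" if "G \<in> ?S E" for G using that by (simp add: add.commute)
    then have "u F + u E \<le> u (E \<union> F)"
      unfolding u_def[of E] ennreal_SUP_add_right[OF ne[of E]] by (intro SUP_least)
    then show ?thesis by (simp add: add.commute)
  qed
  have "countably_additive (sets borel) u"
    unfolding countably_additive_def
  proof (intro allI impI)
    fix A :: "nat \<Rightarrow> 'a set"
    assume A: "range A \<subseteq> sets borel" "disjoint_family A" "(\<Union>i. A i) \<in> sets borel"
    have "(\<Sum>i<n. u (A i)) \<le> u (\<Union>i<n. A i)" for n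
    proof (induction n)
      case 0
      then show ?case by simp
    next
      case (Suc n)
      have "(\<Sum>i<Suc n. u (A i)) \<le> u (\<Union>i<n. A i) + u (A n)" using Suc by (simp add: add_right_mono)
      also have "\<dots> \<le> u ((\<Union>i<n. A i) \<union> A n)"
      proof (rule super)
        have "A i \<inter> A n = {}" if "i < n" for i
          using A(2) that unfolding disjoint_family_on_def by (metis UNIV_I less_irrefl)
        then show "(\<Union>i<n. A i) \<inter> A n = {}" by blast
      qed
      also have "(\<Union>i<n. A i) \<union> A n = (\<Union>i<Suc n. A i)" by (auto simp: less_Suc_eq)
      finally show ?case .
    qed
    then have "(\<Sum>i<n. u (A i)) \<le> u (\<Union>i. A i)" for n
      using u_mono[of "\<Union>i<n. A i" "\<Union>i. A i"] by (meson UN_mono order_trans subset_UNIV subset_refl)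
    then have le: "(\<Sum>i. u (A i)) \<le> u (\<Union>i. A i)" by (intro suminf_le_const summableI)
    have "ennreal (\<nu> F) \<le> (\<Sum>i. u (A i))" if F: "F \<in> sets borel" "F \<subseteq> (\<Union>i. A i)" for F
    proof -
      have "range (\<lambda>i. F \<inter> A i) \<subseteq> sets borel" using A F by auto
      moreover have "disjoint_family (\<lambda>i. F \<inter> A i)" using A(2) by (auto simp: disjoint_family_on_def)
      ultimately have "(\<lambda>i. \<nu> (F \<inter> A i)) sums \<nu> (\<Union>i. F \<inter> A i)"
        using \<nu> unfolding finite_signed_borel_measure_def by blast
      moreover have "(\<Union>i. F \<inter> A i) = F" using F by auto
      ultimately have "ennreal (\<nu> F) \<le> (\<Sum>i. ennreal (\<nu> (F \<inter> A i)))" using ennreal_sums_le by metis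
      also have "\<dots> \<le> (\<Sum>i. u (A i))" using A F by (intro suminf_le summableI u_ge) auto
      finally show ?thesis .
    qed
    then have "u (\<Union>i. A i) \<le> (\<Sum>i. u (A i))" unfolding u_def[of "\<Union>i. A i"] by (intro SUP_least) auto
    with le show "(\<Sum>i. u (A i)) = u (\<Union>i. A i)" by (rule antisym)
  qed
  moreover have "positive (sets borel) u" by (simp add: positive_def u0)
  moreover have "sigma_algebra UNIV (sets (borel :: 'a measure))" using sets.sigma_algebra_axioms[of "borel :: 'a measure"] by simp
  ultimately show ?thesis
    unfolding upper_variation_def u_def[symmetric] using E by (intro emeasure_measure_of_sigma)
qed

lemma sets_upper_variation: "sets (upper_variation \<nu>) = sets borel"
  unfolding upper_variation_def
  using sets.sigma_sets_eq[of "borel :: 'a measure"] by (simp add: sets_measure_of_conv)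

lemma upper_variation_le:
  assumes "finite_signed_borel_measure \<nu>"
  shows "emeasure (upper_variation \<nu>) UNIV \<le> total_variation \<nu>"
proof -
  have "ennreal (\<nu> F) \<le> total_variation \<nu>" if "F \<in> sets borel" for F
    using abs_le_total_variation[OF that, of \<nu>] by (rule order_trans[rotated]) (intro ennreal_leI, simp)
  then show ?thesis by (auto simp: upper_variation_emeasure[OF assms] intro: SUP_least)
qed

section \<open>Cotlar's inequality\<close>

lemma CZ_kernel_le: "CZ_kernel \<epsilon> K \<Longrightarrow> x \<noteq> y \<Longrightarrow> cmod (K x y) \<le> 1 / cmod (x - y)"
  by (simp add: CZ_kernel_def)

lemma CZ_kernel_smooth:
  assumes "CZ_kernel \<epsilon> K" "x \<noteq> y" "cmod (x - x') \<le> cmod (x - y) / 2"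
  shows "cmod (K x y - K x' y) \<le> cmod (x - x') powr \<epsilon> / cmod (x - y) powr (1 + \<epsilon>)"
    and "cmod (K y x - K y x') \<le> cmod (x - x') powr \<epsilon> / cmod (x - y) powr (1 + \<epsilon>)"
  using assms by (auto simp: CZ_kernel_def)

text \<open>\<open>CZ_kernel\<close> has no measurability clause; smoothness in the second variable
  gives continuity off the diagonal, and with it the measurability of truncated kernels.\<close>

lemma CZ_kernel_isCont:
  assumes "CZ_kernel \<epsilon> K" "0 < \<epsilon>" "y \<noteq> x"
  shows "isCont (K x) y"
proof -
  define c where "c = cmod (y - x) powr (1 + \<epsilon>)"
  have "\<forall>\<^sub>F z in at y. dist z y < cmod (y - x) / 2"
    unfolding eventually_at using assms(3) by (intro exI[of _ "cmod (y - x) / 2"]) auto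
  have ev: "\<forall>\<^sub>F z in at y. norm (K x z - K x y) \<le> cmod (z - y) powr \<epsilon> / c"
    using \<open>\<forall>\<^sub>F z in at y. dist z y < cmod (y - x) / 2\<close>
  proof eventually_elim
    case (elim z)
    have "cmod (K x y - K x z) \<le> cmod (y - z) powr \<epsilon> / c"
      unfolding c_def using elim assms
      by (intro CZ_kernel_smooth(2)) (auto simp: dist_norm norm_minus_commute)
    then show ?case by (simp add: norm_minus_commute)
  qed
  have "((\<lambda>z. cmod (z - y)) \<longlongrightarrow> 0) (at y)"
    by (rule tendsto_eq_intros refl | simp)+
  then have "((\<lambda>z. cmod (z - y) powr \<epsilon>) \<longlongrightarrow> 0) (at y)"
    using assms(2) by (intro tendsto_zero_powrI[OF _ tendsto_const]) auto
  then have "((\<lambda>z. cmod (z - y) powr \<epsilon> / c) \<longlongrightarrow> 0) (at y)"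
    by (rule tendsto_divide_zero)
  then have "((\<lambda>z. K x z - K x y) \<longlongrightarrow> 0) (at y)"
    by (rule Lim_null_comparison[OF ev])
  then show ?thesis unfolding isCont_def by (rule LIM_zero_cancel)
qed

lemma CZ_kernel_trunc_measurable:
  assumes "CZ_kernel \<epsilon> K" "0 < \<epsilon>" "0 < r"
  shows "(\<lambda>y. indicat_real (- ball x r) y *\<^sub>R K x y) \<in> borel_measurable borel"
proof (rule borel_measurable_continuous_on_indicator)
  show "continuous_on (- ball x r) (K x)"
    using assms by (intro continuous_at_imp_continuous_on ballI CZ_kernel_isCont[OF assms(1,2)]) auto
qed auto

lemma CZ_kernel_trunc_le:
  assumes "CZ_kernel \<epsilon> K" "0 < r"
  shows "cmod (indicat_real (- ball x r) y *\<^sub>R K x y) \<le> 1 / r"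
proof (cases "y \<in> ball x r")
  case False
  then have "r \<le> cmod (x - y)" by (auto simp: dist_norm)
  moreover from this assms have "x \<noteq> y" by auto
  ultimately have "cmod (K x y) \<le> 1 / cmod (x - y)" "1 / cmod (x - y) \<le> 1 / r"
    using CZ_kernel_le[OF assms(1)] assms(2) by (auto intro!: divide_left_mono)
  with False show ?thesis by simp
qed (use assms in simp)

section \<open>The operator and the truncations of functions\<close>

locale CZ_operator = linear_growth \<mu> for \<mu> :: "complex measure" +
  fixes \<epsilon> N :: real and K :: "complex \<Rightarrow> complex \<Rightarrow> complex"
    and T :: "(complex \<Rightarrow> complex) \<Rightarrow> complex \<Rightarrow> complex"
  assumes eps: "0 < \<epsilon>" and N: "0 \<le> N"
    and CZ: "CZ_kernel \<epsilon> K"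
    and T_bdd: "L2_bounded_linear \<mu> T"
    and T_kernel: "has_kernel \<mu> T K"
    and T_norm: "L2_onorm \<mu> T \<le> N"
begin

lemma T_L2:
  assumes "\<phi> \<in> L2_functions \<mu>"
  shows "T \<phi> \<in> borel_measurable \<mu>" "integrable \<mu> (\<lambda>x. (cmod (T \<phi> x))\<^sup>2)"
  using T_bdd assms unfolding L2_bounded_linear_def L2_functions_def by auto

text \<open>\<open>L2_onorm\<close> is a supremum of reals, so it dominates the quotients only once
  they are known to be bounded above; the qualitative constant \<open>C\<close> provides this. It
  also settles \<open>\<phi>\<close> of norm 0, where the quotient carries no information.\<close>

lemma T_norm_le:
  assumes "\<phi> \<in> L2_functions \<mu>"
  shows "(\<integral>x. (cmod (T \<phi> x))\<^sup>2 \<partial>\<mu>) \<le> N\<^sup>2 * (\<integral>x. (cmod (\<phi> x))\<^sup>2 \<partial>\<mu>)"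
proof -
  obtain C where C: "\<And>\<psi>. \<psi> \<in> L2_functions \<mu> \<Longrightarrow> L2_norm \<mu> (T \<psi>) \<le> C * L2_norm \<mu> \<psi>"
    using T_bdd unfolding L2_bounded_linear_def by blast
  have nn: "0 \<le> L2_norm \<mu> \<psi>" for \<psi> unfolding L2_norm_def by simp
  have "L2_norm \<mu> (T \<psi>) / L2_norm \<mu> \<psi> \<le> max C 0" if "\<psi> \<in> L2_functions \<mu>" for \<psi>
  proof (cases "L2_norm \<mu> \<psi> = 0")
    case False
    then have "0 < L2_norm \<mu> \<psi>" using nn[of \<psi>] by simp
    then have "L2_norm \<mu> (T \<psi>) / L2_norm \<mu> \<psi> \<le> C" using C[OF that] by (simp add: pos_divide_le_eq)
    then show ?thesis by simp
  qed simp
  then have "bdd_above ((\<lambda>\<psi>. L2_norm \<mu> (T \<psi>) / L2_norm \<mu> \<psi>) ` L2_functions \<mu>)"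
    by (intro bdd_aboveI2)
  then have "L2_norm \<mu> (T \<phi>) / L2_norm \<mu> \<phi> \<le> L2_onorm \<mu> T"
    unfolding L2_onorm_def using assms by (intro cSUP_upper)
  then have le: "L2_norm \<mu> (T \<phi>) / L2_norm \<mu> \<phi> \<le> N" using T_norm by linarith
  have "L2_norm \<mu> (T \<phi>) \<le> N * L2_norm \<mu> \<phi>"
  proof (cases "L2_norm \<mu> \<phi> = 0")
    case True
    then show ?thesis using C[OF assms] by simp
  next
    case False
    then have "0 < L2_norm \<mu> \<phi>" using nn[of \<phi>] by simp
    then show ?thesis using le by (simp add: pos_divide_le_eq)
  qed
  then have "(L2_norm \<mu> (T \<phi>))\<^sup>2 \<le> (N * L2_norm \<mu> \<phi>)\<^sup>2" using nn by (intro power_mono)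
  then show ?thesis by (simp add: L2_norm_def power_mult_distrib)
qed

definition trunc_fun :: "real \<Rightarrow> (complex \<Rightarrow> complex) \<Rightarrow> complex \<Rightarrow> complex" where
  "trunc_fun r \<phi> x = (\<integral>y. indicat_real (- ball x r) y *\<^sub>R (K x y * \<phi> y) \<partial>\<mu>)"

lemma integrable_trunc_fun:
  assumes "integrable \<mu> \<phi>" "0 < r"
  shows "integrable \<mu> (\<lambda>y. indicat_real (- ball x r) y *\<^sub>R (K x y * \<phi> y))"
proof (rule Bochner_Integration.integrable_bound)
  show "integrable \<mu> (\<lambda>y. (1 / r) *\<^sub>R \<phi> y)" using assms by simp
  have [measurable]: "\<phi> \<in> borel_measurable borel" using assms(1) measurable_mu by auto
  have [measurable]: "(\<lambda>y. indicat_real (- ball x r) y *\<^sub>R K x y) \<in> borel_measurable borel"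
    using CZ_kernel_trunc_measurable[OF CZ eps assms(2)] .
  have "(\<lambda>y. (indicat_real (- ball x r) y *\<^sub>R K x y) * \<phi> y) \<in> borel_measurable borel" by measurable
  then show "(\<lambda>y. indicat_real (- ball x r) y *\<^sub>R (K x y * \<phi> y)) \<in> borel_measurable \<mu>"
    by (simp add: measurable_mu)
  show "AE y in \<mu>. norm (indicat_real (- ball x r) y *\<^sub>R (K x y * \<phi> y)) \<le> norm ((1 / r) *\<^sub>R \<phi> y)"
  proof (intro AE_I2)
    fix y
    have "norm (indicat_real (- ball x r) y *\<^sub>R (K x y * \<phi> y))
        = norm (indicat_real (- ball x r) y *\<^sub>R K x y) * norm (\<phi> y)"
      by (simp add: norm_mult)
    also have "\<dots> \<le> (1 / r) * norm (\<phi> y)"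
      by (intro mult_right_mono CZ_kernel_trunc_le[OF CZ assms(2)]) auto
    finally show "norm (indicat_real (- ball x r) y *\<^sub>R (K x y * \<phi> y)) \<le> norm ((1 / r) *\<^sub>R \<phi> y)"
      using assms(2) by simp
  qed
qed

lemma L2I:
  assumes "integrable \<mu> \<phi>" "\<And>y. cmod (\<phi> y) \<le> A"
  shows "\<phi> \<in> L2_functions \<mu>"
proof -
  have [measurable]: "\<phi> \<in> borel_measurable \<mu>" using assms by auto
  have "integrable \<mu> (\<lambda>x. (cmod (\<phi> x))\<^sup>2)"
  proof (rule Bochner_Integration.integrable_bound)
    show "integrable \<mu> (\<lambda>x. A * cmod (\<phi> x))" using assms by auto
    show "AE y in \<mu>. norm ((cmod (\<phi> y))\<^sup>2) \<le> norm (A * cmod (\<phi> y))"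
      using assms(2) by (intro AE_I2) (auto simp: power2_eq_square abs_mult intro!: mult_right_mono order_trans[OF _ abs_ge_self])
  qed measurable
  then show ?thesis by (simp add: L2_functions_def)
qed

text \<open>60 pays for the shell between \<open>r\<close> and \<open>2 * R\<close>,
  \<open>tail_const \<epsilon>\<close> for moving the centre inside \<open>ball x R\<close>, and
  \<open>9 * N\<close> for the part of the function near \<open>x\<close>: its square 81 exceeds 80
  = 2 * 40, the loss from splitting a square and from doubling.\<close>

definition cotlar_const :: real where "cotlar_const = 60 + tail_const \<epsilon> + 9 * N"

lemma tail_const_pos: "0 < tail_const \<epsilon>"
proof -
  have "2 powr (-\<epsilon>) < (1::real)" using eps by (simp add: powr_less_one)
  then show ?thesis by (simp add: tail_const_def)
qed

text \<open>The two truncations differ by an integral over the shell, where the size bound on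
  \<open>K\<close> is enough.\<close>

lemma trunc_fun_shell:
  assumes "integrable \<mu> \<phi>" "\<And>y. cmod (\<phi> y) \<le> A" "0 < r" "r \<le> s"
    and shell: "(\<integral>\<^sup>+y\<in>ball x s - ball x r. ennreal (1 / cmod (x - y)) \<partial>\<mu>) \<le> ennreal c" and "0 \<le> c"
  shows "cmod (trunc_fun r \<phi> x - trunc_fun s \<phi> x) \<le> A * c"
proof -
  have A: "0 \<le> A" using assms(2)[of 0] norm_ge_zero order_trans by blast
  let ?f = "\<lambda>y. indicat_real (- ball x r) y *\<^sub>R (K x y * \<phi> y) - indicat_real (- ball x s) y *\<^sub>R (K x y * \<phi> y)"
  have int: "integrable \<mu> ?f"
    using assms by (intro Bochner_Integration.integrable_diff integrable_trunc_fun) auto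
  have [measurable]: "(\<lambda>y. ennreal (1 / cmod (x - y))) \<in> borel_measurable \<mu>"
    unfolding measurable_mu by measurable
  have "trunc_fun r \<phi> x - trunc_fun s \<phi> x = integral\<^sup>L \<mu> ?f"
    unfolding trunc_fun_def using assms
    by (intro Bochner_Integration.integral_diff[symmetric] integrable_trunc_fun) auto
  then have "ennreal (cmod (trunc_fun r \<phi> x - trunc_fun s \<phi> x)) \<le> (\<integral>\<^sup>+y. norm (?f y) \<partial>\<mu>)"
    using integral_norm_bound_ennreal[OF int] by simp
  also have "\<dots> \<le> (\<integral>\<^sup>+y. ennreal A * (ennreal (1 / cmod (x - y)) * indicator (ball x s - ball x r) y) \<partial>\<mu>)"
  proof (intro nn_integral_mono)
    fix y
    show "ennreal (norm (?f y)) \<le> ennreal A * (ennreal (1 / cmod (x - y)) * indicator (ball x s - ball x r) y)"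
    proof (cases "y \<in> ball x s - ball x r")
      case True
      then have "x \<noteq> y" using assms by auto
      have "norm (?f y) = cmod (\<phi> y) * cmod (K x y)" using True by (simp add: norm_mult mult.commute)
      also have "\<dots> \<le> A * (1 / cmod (x - y))"
        using assms(2) A by (intro mult_mono CZ_kernel_le[OF CZ \<open>x \<noteq> y\<close>]) auto
      finally have le: "ennreal (norm (?f y)) \<le> ennreal (A * (1 / cmod (x - y)))" by (rule ennreal_leI)
      have "ennreal (A * (1 / cmod (x - y))) = ennreal A * (ennreal (1 / cmod (x - y)) * indicator (ball x s - ball x r) y)"
        using True A by (subst ennreal_mult) auto
      with le show ?thesis by (simp only:)
    next
      case False
      then have "?f y = 0" using assms(4) by (auto simp: indicator_def)
      then show ?thesis by (simp only: norm_zero ennreal_0 zero_le)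
    qed
  qed
  also have "\<dots> = ennreal A * (\<integral>\<^sup>+y\<in>ball x s - ball x r. ennreal (1 / cmod (x - y)) \<partial>\<mu>)"
    by (intro nn_integral_cmult) auto
  also have "\<dots> \<le> ennreal A * ennreal c" by (intro mult_left_mono shell) auto
  also have "\<dots> = ennreal (A * c)" using A assms by (simp add: ennreal_mult)
  finally show ?thesis using A assms by (simp add: ennreal_le_iff)
qed

text \<open>Points outside \<open>ball x (2 * R)\<close> are at least twice as far from
  \<open>x\<close> as \<open>x'\<close> is, so smoothness in the first variable applies and
  \<open>nn_integral_tail\<close> sums it. For almost every \<open>x'\<close> in the ball the
  integral will be the value at \<open>x'\<close> of \<open>T\<close> applied to the far part of
  \<open>\<phi>\<close>.\<close>

lemma trunc_fun_near:
  assumes "integrable \<mu> \<phi>" "\<And>y. cmod (\<phi> y) \<le> A" "0 < R" "x' \<in> ball x R"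
    and int: "integrable \<mu> (\<lambda>y. K x' y * (indicat_real (- ball x (2 * R)) y *\<^sub>R \<phi> y))"
  shows "cmod (trunc_fun (2 * R) \<phi> x - (\<integral>y. K x' y * (indicat_real (- ball x (2 * R)) y *\<^sub>R \<phi> y) \<partial>\<mu>))
    \<le> A * tail_const \<epsilon>"
proof -
  have A: "0 \<le> A" using assms(2)[of 0] norm_ge_zero order_trans by blast
  let ?f = "\<lambda>y. indicat_real (- ball x (2*R)) y *\<^sub>R (K x y * \<phi> y) - K x' y * (indicat_real (- ball x (2 * R)) y *\<^sub>R \<phi> y)"
  have int': "integrable \<mu> ?f"
    using assms by (intro Bochner_Integration.integrable_diff integrable_trunc_fun) auto
  have [measurable]: "(\<lambda>y. ennreal ((2*R) powr \<epsilon> / cmod (x - y) powr (1 + \<epsilon>))) \<in> borel_measurable \<mu>"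
    unfolding measurable_mu by measurable
  have "trunc_fun (2 * R) \<phi> x - (\<integral>y. K x' y * (indicat_real (- ball x (2 * R)) y *\<^sub>R \<phi> y) \<partial>\<mu>) = integral\<^sup>L \<mu> ?f"
    unfolding trunc_fun_def using assms
    by (intro Bochner_Integration.integral_diff[symmetric] integrable_trunc_fun) auto
  then have "ennreal (cmod (trunc_fun (2 * R) \<phi> x - (\<integral>y. K x' y * (indicat_real (- ball x (2 * R)) y *\<^sub>R \<phi> y) \<partial>\<mu>)))
     \<le> (\<integral>\<^sup>+y. norm (?f y) \<partial>\<mu>)"
    using integral_norm_bound_ennreal[OF int'] by simp
  also have "\<dots> \<le> (\<integral>\<^sup>+y. ennreal A * (ennreal ((2*R) powr \<epsilon> / cmod (x - y) powr (1 + \<epsilon>)) * indicator (- ball x (2*R)) y) \<partial>\<mu>)"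
  proof (intro nn_integral_mono)
    fix y
    show "ennreal (norm (?f y)) \<le> ennreal A * (ennreal ((2*R) powr \<epsilon> / cmod (x - y) powr (1 + \<epsilon>)) * indicator (- ball x (2*R)) y)"
    proof (cases "y \<in> - ball x (2*R)")
      case True
      then have d: "2 * R \<le> cmod (x - y)" by (simp add: dist_norm)
      then have "x \<noteq> y" using assms by auto
      have xx': "cmod (x - x') < R" using assms(4) by (simp add: dist_norm)
      have "norm (?f y) = cmod (\<phi> y) * cmod (K x y - K x' y)"
        using True by (simp add: algebra_simps flip: norm_mult)
      also have "\<dots> \<le> A * (cmod (x - x') powr \<epsilon> / cmod (x - y) powr (1 + \<epsilon>))"
        using assms(2) A d xx' by (intro mult_mono CZ_kernel_smooth(1)[OF CZ \<open>x \<noteq> y\<close>]) auto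
      also have "\<dots> \<le> A * ((2*R) powr \<epsilon> / cmod (x - y) powr (1 + \<epsilon>))"
        using A xx' eps assms(3) by (intro mult_left_mono divide_right_mono powr_mono2) auto
      finally have le: "ennreal (norm (?f y)) \<le> ennreal (A * ((2*R) powr \<epsilon> / cmod (x - y) powr (1 + \<epsilon>)))" by (rule ennreal_leI)
      have "ennreal (A * ((2*R) powr \<epsilon> / cmod (x - y) powr (1 + \<epsilon>))) = ennreal A * (ennreal ((2*R) powr \<epsilon> / cmod (x - y) powr (1 + \<epsilon>)) * indicator (- ball x (2*R)) y)"
        using True A by (subst ennreal_mult) auto
      with le show ?thesis by (simp only:)
    qed simp
  qed
  also have "\<dots> = ennreal A * (\<integral>\<^sup>+y\<in>- ball x (2*R). ennreal ((2*R) powr \<epsilon> / cmod (x - y) powr (1 + \<epsilon>)) \<partial>\<mu>)"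
    by (intro nn_integral_cmult) auto
  also have "\<dots> \<le> ennreal A * ennreal (tail_const \<epsilon>)"
    using assms by (intro mult_left_mono nn_integral_tail eps) auto
  also have "\<dots> = ennreal (A * tail_const \<epsilon>)" using A tail_const_pos by (simp add: ennreal_mult)
  finally show ?thesis using A tail_const_pos by (simp add: ennreal_le_iff)
qed

section \<open>Maximal truncations of bounded functions\<close>

text \<open>A large truncation at \<open>x\<close> forces \<open>T \<phi>\<close> to be large in
  mean square on a ball around \<open>x\<close>. With \<open>R\<close> a doubling radius above
  \<open>r\<close>, the truncation differs by a bounded amount from
  \<open>T \<phi>2 = T \<phi> - T \<phi>1\<close> almost everywhere on \<open>ball x R\<close>, and
  \<open>T \<phi>1\<close> is controlled by the norm of \<open>T\<close>. Doubling brings in the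
  radius \<open>5 * R\<close> demanded by Vitali's lemma.\<close>

lemma cotlar_pointwise:
  assumes \<phi>: "integrable \<mu> \<phi>" "\<And>y. cmod (\<phi> y) \<le> A" and "0 < r" "0 < l"
    and nz: "emeasure \<mu> UNIV \<noteq> 0"
    and large: "cotlar_const * A + l < cmod (trunc_fun r \<phi> x)"
  obtains R where "0 < R"
    "ennreal (l\<^sup>2 / 80) * emeasure \<mu> (ball x (5 * R)) \<le> (\<integral>\<^sup>+y\<in>ball x R. ennreal ((cmod (T \<phi> y))\<^sup>2) \<partial>\<mu>)"
proof -
  have A: "0 \<le> A" using assms(2)[of 0] norm_ge_zero order_trans by blast
  obtain R where R: "r \<le> R" "0 < m x R" "m x (20 * R) \<le> 40 * m x R"
    "(\<integral>\<^sup>+y\<in>ball x (20 * R) - ball x r. ennreal (1 / cmod (x - y)) \<partial>\<mu>) \<le> 60"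
    using doubling_scale[OF nz \<open>0 < r\<close>] by blast
  have "0 < R" using R assms by simp
  have \<phi>_meas: "\<phi> \<in> borel_measurable \<mu>" using \<phi> by auto
  then have [measurable]: "\<phi> \<in> borel_measurable borel" by (simp add: measurable_mu)
  \<comment> \<open>The cut at \<open>2 * R\<close> keeps \<open>ball x R\<close> off the closed
    support of \<open>\<phi>2\<close>, so that the kernel formula for \<open>T \<phi>2\<close> is
    available there.\<close>
  define \<phi>1 where "\<phi>1 y = indicat_real (ball x (2*R)) y *\<^sub>R \<phi> y" for y
  define \<phi>2 where "\<phi>2 y = indicat_real (- ball x (2*R)) y *\<^sub>R \<phi> y" for y
  have i1: "integrable \<mu> \<phi>1" unfolding \<phi>1_def by (intro integrable_mult_indicator \<phi>) auto
  have i2: "integrable \<mu> \<phi>2" unfolding \<phi>2_def by (intro integrable_mult_indicator \<phi>) auto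
  have b1: "cmod (\<phi>1 y) \<le> A" and b2: "cmod (\<phi>2 y) \<le> A" for y
    using \<phi>(2)[of y] A by (auto simp: \<phi>1_def \<phi>2_def indicator_def)
  have L: "\<phi> \<in> L2_functions \<mu>" "\<phi>1 \<in> L2_functions \<mu>" "\<phi>2 \<in> L2_functions \<mu>"
    using L2I \<phi> i1 i2 b1 b2 by blast+
  have \<phi>_eq: "\<phi> = (\<lambda>y. \<phi>1 y + \<phi>2 y)" by (auto simp: \<phi>1_def \<phi>2_def indicator_def)
  have "AE y in \<mu>. T (\<lambda>y. \<phi>1 y + \<phi>2 y) y = T \<phi>1 y + T \<phi>2 y"
    using T_bdd L unfolding L2_bounded_linear_def by blast
  then have split: "AE y in \<mu>. T \<phi> y = T \<phi>1 y + T \<phi>2 y" unfolding \<phi>_eq[symmetric] .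
  have supp: "y \<notin> closed_support \<mu> \<phi>2" if "y \<in> ball x R" for y
  proof -
    have "ball x (2*R) \<in> {U. open U \<and> (AE z in \<mu>. z \<in> U \<longrightarrow> \<phi>2 z = 0)}"
      by (auto simp: \<phi>2_def)
    moreover have "y \<in> ball x (2*R)" using that \<open>0 < R\<close> by auto
    ultimately show ?thesis unfolding closed_support_def by blast
  qed
  have ker: "AE y in \<mu>. y \<notin> closed_support \<mu> \<phi>2 \<longrightarrow> has_bochner_integral \<mu> (\<lambda>z. K y z * \<phi>2 z) (T \<phi>2 y)"
    using T_kernel L unfolding has_kernel_def by blast
  \<comment> \<open>The lower bound left for \<open>T \<phi>2\<close> on \<open>ball x R\<close>
    after the shell and the tail have been paid.\<close>
  define D where "D = cmod (trunc_fun r \<phi> x) - A * 60 - A * tail_const \<epsilon>"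
  have shell: "cmod (trunc_fun r \<phi> x - trunc_fun (2*R) \<phi> x) \<le> A * 60"
  proof (rule trunc_fun_shell[OF \<phi> \<open>0 < r\<close>])
    have "(\<integral>\<^sup>+y\<in>ball x (2 * R) - ball x r. ennreal (1 / cmod (x - y)) \<partial>\<mu>)
      \<le> (\<integral>\<^sup>+y\<in>ball x (20 * R) - ball x r. ennreal (1 / cmod (x - y)) \<partial>\<mu>)"
      using \<open>0 < R\<close> by (intro nn_integral_mono mult_left_mono) (auto simp: indicator_def)
    also note R(4)
    finally show "(\<integral>\<^sup>+y\<in>ball x (2 * R) - ball x r. ennreal (1 / cmod (x - y)) \<partial>\<mu>) \<le> ennreal 60" by simp
  qed (use R \<open>0 < R\<close> in auto)
  have pt: "AE y in \<mu>. y \<in> ball x R \<longrightarrow> D \<le> cmod (T \<phi> y) + cmod (T \<phi>1 y)"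
    using split ker
  proof eventually_elim
    case (elim y)
    show ?case
    proof
      assume y: "y \<in> ball x R"
      then have bi: "has_bochner_integral \<mu> (\<lambda>z. K y z * \<phi>2 z) (T \<phi>2 y)" using elim supp by blast
      then have "cmod (trunc_fun (2 * R) \<phi> x - T \<phi>2 y) \<le> A * tail_const \<epsilon>"
        using trunc_fun_near[OF \<phi> \<open>0 < R\<close> y] unfolding \<phi>2_def
        by (simp add: has_bochner_integral_iff)
      moreover have "T \<phi>2 y = T \<phi> y - T \<phi>1 y" using elim by simp
      then have "cmod (T \<phi>2 y) \<le> cmod (T \<phi> y) + cmod (T \<phi>1 y)" by (simp only: norm_triangle_ineq4)
      moreover have "cmod (trunc_fun r \<phi> x) \<le> cmod (trunc_fun r \<phi> x - trunc_fun (2*R) \<phi> x)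
          + cmod (trunc_fun (2 * R) \<phi> x - T \<phi>2 y) + cmod (T \<phi>2 y)"
        by (smt (verit) norm_triangle_sub)
      ultimately show "D \<le> cmod (T \<phi> y) + cmod (T \<phi>1 y)" using shell unfolding D_def by linarith
    qed
  qed
  have D: "l + 9 * N * A < D" using large unfolding D_def cotlar_const_def by (simp add: algebra_simps)
  have "0 \<le> 9 * N * A" using N A by simp
  have D2: "l\<^sup>2 + 81 * (N * A)\<^sup>2 \<le> D\<^sup>2"
  proof -
    have "(l + 9 * N * A)\<^sup>2 \<le> D\<^sup>2" using D \<open>0 < l\<close> \<open>0 \<le> 9 * N * A\<close> by (intro power_mono) auto
    moreover have "(l + 9 * N * A)\<^sup>2 = l\<^sup>2 + 81 * (N * A)\<^sup>2 + 2 * (l * (9 * N * A))"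
      by (simp add: power2_eq_square algebra_simps)
    moreover have "0 \<le> l * (9 * N * A)" using less_imp_le[OF \<open>0 < l\<close>] \<open>0 \<le> 9 * N * A\<close> by (rule mult_nonneg_nonneg)
    ultimately show ?thesis by linarith
  qed
  have "D \<ge> 0" using D \<open>0 < l\<close> \<open>0 \<le> 9 * N * A\<close> by linarith
  have Tm: "T \<phi> \<in> borel_measurable \<mu>" "T \<phi>1 \<in> borel_measurable \<mu>" using T_L2 L by auto
  \<comment> \<open>\<open>J\<close> is finite because \<open>T \<phi>\<close> is square integrable;
    the absorption below can thus be done in real numbers.\<close>
  define J where "J = (\<integral>\<^sup>+y\<in>ball x R. ennreal ((cmod (T \<phi> y))\<^sup>2) \<partial>\<mu>)"
  have "J \<le> (\<integral>\<^sup>+y. ennreal ((cmod (T \<phi> y))\<^sup>2) \<partial>\<mu>)" unfolding J_def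
    by (intro nn_integral_mono) (auto simp: indicator_def)
  also have "\<dots> = ennreal (\<integral>y. (cmod (T \<phi> y))\<^sup>2 \<partial>\<mu>)"
    using T_L2 L by (intro nn_integral_eq_integral) auto
  finally have "J < top" by (rule le_less_trans) simp
  then obtain j where j: "0 \<le> j" "J = ennreal j" by (cases J) auto
  have T1: "(\<integral>\<^sup>+y. ennreal ((cmod (T \<phi>1 y))\<^sup>2) \<partial>\<mu>) \<le> ennreal (N\<^sup>2 * (A\<^sup>2 * m x (2*R)))"
  proof -
    have "(\<integral>\<^sup>+y. ennreal ((cmod (T \<phi>1 y))\<^sup>2) \<partial>\<mu>) = ennreal (\<integral>y. (cmod (T \<phi>1 y))\<^sup>2 \<partial>\<mu>)"
      using T_L2 L by (intro nn_integral_eq_integral) auto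
    also have "\<dots> \<le> ennreal (N\<^sup>2 * (\<integral>y. (cmod (\<phi>1 y))\<^sup>2 \<partial>\<mu>))"
      using T_norm_le L by (intro ennreal_leI) auto
    also have "\<dots> \<le> ennreal (N\<^sup>2 * (\<integral>y. A\<^sup>2 * indicat_real (ball x (2*R)) y \<partial>\<mu>))"
    proof (intro ennreal_leI mult_left_mono integral_mono)
      show "integrable \<mu> (\<lambda>y. (cmod (\<phi>1 y))\<^sup>2)" using L unfolding L2_functions_def by auto
      show "integrable \<mu> (\<lambda>y. A\<^sup>2 * indicat_real (ball x (2*R)) y)"
        by (intro integrable_mult_right integrable_real_indicator) (auto simp: emeasure_ball)
      show "(cmod (\<phi>1 y))\<^sup>2 \<le> A\<^sup>2 * indicat_real (ball x (2*R)) y" for y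
        using \<phi>(2)[of y] by (auto simp: \<phi>1_def indicator_def power_mono)
    qed auto
    finally show ?thesis by simp
  qed
  have "ennreal (D\<^sup>2) * emeasure \<mu> (ball x R) = (\<integral>\<^sup>+y. ennreal (D\<^sup>2) * indicator (ball x R) y \<partial>\<mu>)"
    by (simp add: nn_integral_cmult_indicator)
  also have "\<dots> \<le> (\<integral>\<^sup>+y. 2 * (ennreal ((cmod (T \<phi> y))\<^sup>2) * indicator (ball x R) y) + 2 * ennreal ((cmod (T \<phi>1 y))\<^sup>2) \<partial>\<mu>)"
  proof (intro nn_integral_mono_AE)
    show "AE y in \<mu>. ennreal (D\<^sup>2) * indicator (ball x R) y \<le> 2 * (ennreal ((cmod (T \<phi> y))\<^sup>2) * indicator (ball x R) y) + 2 * ennreal ((cmod (T \<phi>1 y))\<^sup>2)"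
      using pt
    proof eventually_elim
      case (elim y)
      show ?case
      proof (cases "y \<in> ball x R")
        case True
        then have "D\<^sup>2 \<le> (cmod (T \<phi> y) + cmod (T \<phi>1 y))\<^sup>2" using elim \<open>0 \<le> D\<close> by (intro power_mono) auto
        also have "\<dots> \<le> 2 * (cmod (T \<phi> y))\<^sup>2 + 2 * (cmod (T \<phi>1 y))\<^sup>2"
          using sum_squares_ge_zero[of "cmod (T \<phi> y) - cmod (T \<phi>1 y)" 0] by (simp add: power2_eq_square algebra_simps)
        finally have "ennreal (D\<^sup>2) \<le> ennreal (2 * (cmod (T \<phi> y))\<^sup>2 + 2 * (cmod (T \<phi>1 y))\<^sup>2)" by (rule ennreal_leI)
        then show ?thesis using True by (simp add: ennreal_plus ennreal_mult)
      qed simp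
    qed
  qed
  also have "\<dots> = 2 * J + 2 * (\<integral>\<^sup>+y. ennreal ((cmod (T \<phi>1 y))\<^sup>2) \<partial>\<mu>)"
    unfolding J_def using Tm by (subst nn_integral_add) (auto simp: nn_integral_cmult)
  also have "\<dots> \<le> 2 * ennreal j + 2 * ennreal (N\<^sup>2 * (A\<^sup>2 * m x (2*R)))"
    unfolding j by (intro add_left_mono mult_left_mono T1) auto
  also have "\<dots> = ennreal (2 * j + 2 * (N\<^sup>2 * (A\<^sup>2 * m x (2*R))))"
    using j by (simp add: ennreal_plus ennreal_mult)
  finally have "ennreal (D\<^sup>2 * m x R) \<le> ennreal (2 * j + 2 * (N\<^sup>2 * (A\<^sup>2 * m x (2*R))))"
    by (simp add: emeasure_ball ennreal_mult)
  then have "D\<^sup>2 * m x R \<le> 2 * j + 2 * (N\<^sup>2 * (A\<^sup>2 * m x (2*R)))"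
    using j by (subst (asm) ennreal_le_iff) auto
  also have "\<dots> \<le> 2 * j + 2 * (N\<^sup>2 * (A\<^sup>2 * (40 * m x R)))"
    using R(3) m_mono[of "2*R" "20*R" x] \<open>0 < R\<close>
    by (intro add_left_mono mult_left_mono) auto
  finally have "D\<^sup>2 * m x R \<le> 2 * j + 80 * (N * A)\<^sup>2 * m x R" by (simp add: power_mult_distrib mult_ac)
  \<comment> \<open>81 against 80: the contribution of \<open>\<phi>1\<close> is absorbed and
    \<open>l\<^sup>2 * m x R\<close> survives.\<close>
  moreover have "(l\<^sup>2 + 81 * (N * A)\<^sup>2) * m x R \<le> D\<^sup>2 * m x R" using D2 R(2) by (intro mult_right_mono) auto
  moreover have "0 \<le> (N * A)\<^sup>2 * m x R" by simp
  ultimately have "l\<^sup>2 * m x R \<le> 2 * j"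
    unfolding distrib_right mult.assoc by linarith
  moreover have "m x (5 * R) \<le> 40 * m x R" using R(3) m_mono[of "5*R" "20*R" x] \<open>0 < R\<close> by linarith
  then have "l\<^sup>2 * m x (5 * R) \<le> l\<^sup>2 * (40 * m x R)" by (intro mult_left_mono) auto
  ultimately have "l\<^sup>2 / 80 * m x (5 * R) \<le> j" by simp
  then have "ennreal (l\<^sup>2 / 80) * emeasure \<mu> (ball x (5 * R)) \<le> J"
    unfolding emeasure_ball j(2) by (subst ennreal_mult[symmetric]) (auto intro: ennreal_leI)
  then show ?thesis using that[OF \<open>0 < R\<close>] unfolding J_def by blast
qed

text \<open>\<open>U\<close> is the union of all balls satisfying the lower bound of
  \<open>cotlar_pointwise\<close>, hence open, unlike the superlevel set it encloses. Vitali's lemma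
  against the measure with density \<open>(cmod (T \<phi> y))\<^sup>2\<close>, together with the
  norm of \<open>T\<close>, gives the estimate.\<close>

lemma cotlar_weak:
  assumes \<phi>: "integrable \<mu> \<phi>" "\<And>y. cmod (\<phi> y) \<le> A" and "0 < l"
  obtains U where "U \<in> sets borel"
    "\<And>x r. 0 < r \<Longrightarrow> cotlar_const * A + l < cmod (trunc_fun r \<phi> x) \<Longrightarrow> x \<in> U"
    "emeasure \<mu> U \<le> ennreal (80 * N\<^sup>2 * (\<integral>y. (cmod (\<phi> y))\<^sup>2 \<partial>\<mu>) / l\<^sup>2)"
proof (cases "emeasure \<mu> UNIV = 0")
  case True
  then show ?thesis using that[of UNIV] by simp
next
  case nz: False
  have L: "\<phi> \<in> L2_functions \<mu>" using L2I[OF \<phi>] .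
  have [measurable]: "T \<phi> \<in> borel_measurable \<mu>" using T_L2 L by auto
  define \<kappa> where "\<kappa> = density \<mu> (\<lambda>y. ennreal ((cmod (T \<phi> y))\<^sup>2))"
  have sk: "sets \<kappa> = sets borel" unfolding \<kappa>_def by simp
  have em: "emeasure \<kappa> B = (\<integral>\<^sup>+y\<in>B. ennreal ((cmod (T \<phi> y))\<^sup>2) \<partial>\<mu>)" if "B \<in> sets borel" for B
    unfolding \<kappa>_def using that by (intro emeasure_density) auto
  define I where "I = {(x, R). 0 < R \<and> ennreal (l\<^sup>2 / 80) * emeasure \<mu> (ball x (5 * R)) \<le> emeasure \<kappa> (ball x R)}"
  define U where "U = (\<Union>(x, R)\<in>I. ball x R)"
  have "open U" unfolding U_def by auto
  have "ennreal (l\<^sup>2 / 80) * emeasure \<mu> U \<le> emeasure \<kappa> UNIV"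
    unfolding U_def using sk by (rule Vitali_measure_bound) (auto simp: I_def)
  also have "\<dots> = ennreal (\<integral>y. (cmod (T \<phi> y))\<^sup>2 \<partial>\<mu>)"
    using T_L2[OF L] by (simp add: em nn_integral_eq_integral)
  also have "\<dots> \<le> ennreal (N\<^sup>2 * (\<integral>y. (cmod (\<phi> y))\<^sup>2 \<partial>\<mu>))" by (intro ennreal_leI T_norm_le L)
  finally have *: "ennreal (l\<^sup>2 / 80) * emeasure \<mu> U \<le> ennreal (N\<^sup>2 * (\<integral>y. (cmod (\<phi> y))\<^sup>2 \<partial>\<mu>))" .
  have "emeasure \<mu> U = ennreal (80 / l\<^sup>2) * (ennreal (l\<^sup>2 / 80) * emeasure \<mu> U)"
    using \<open>0 < l\<close> by (simp add: mult.assoc[symmetric] ennreal_mult[symmetric])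
  also have "\<dots> \<le> ennreal (80 / l\<^sup>2) * ennreal (N\<^sup>2 * (\<integral>y. (cmod (\<phi> y))\<^sup>2 \<partial>\<mu>))"
    by (intro mult_left_mono *) auto
  also have "\<dots> = ennreal (80 * N\<^sup>2 * (\<integral>y. (cmod (\<phi> y))\<^sup>2 \<partial>\<mu>) / l\<^sup>2)"
    by (subst ennreal_mult[symmetric]) (auto simp: mult_ac)
  finally have "emeasure \<mu> U \<le> ennreal (80 * N\<^sup>2 * (\<integral>y. (cmod (\<phi> y))\<^sup>2 \<partial>\<mu>) / l\<^sup>2)" .
  moreover have "x \<in> U" if rx: "0 < r" "cotlar_const * A + l < cmod (trunc_fun r \<phi> x)" for x r
  proof -
    obtain R where R: "0 < R"
      "ennreal (l\<^sup>2 / 80) * emeasure \<mu> (ball x (5 * R)) \<le> (\<integral>\<^sup>+y\<in>ball x R. ennreal ((cmod (T \<phi> y))\<^sup>2) \<partial>\<mu>)"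
      using cotlar_pointwise[OF \<phi> rx(1) \<open>0 < l\<close> nz rx(2)] by blast
    then have "(x, R) \<in> I" unfolding I_def by (simp add: em)
    moreover have "x \<in> ball x R" using R by simp
    ultimately show ?thesis unfolding U_def by blast
  qed
  ultimately show ?thesis using that[of U] \<open>open U\<close> by auto
qed

text \<open>The weak bound decays like the inverse square of the level, so it can be integrated over
  the levels above \<open>A\<close>; below them the measure of \<open>B\<close> is enough. The
  majorant \<open>h\<close> serves all radii \<open>r\<close> at once.\<close>

lemma cotlar_majorant:
  assumes \<phi>: "integrable \<mu> \<phi>" "\<And>y. cmod (\<phi> y) \<le> A" and "0 < A"
  obtains h where "h \<in> borel_measurable borel"
    "\<And>x r. 0 < r \<Longrightarrow> ennreal (cmod (trunc_fun r \<phi> x)) \<le> h x"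
    "\<And>B. B \<in> sets borel \<Longrightarrow> (\<integral>\<^sup>+x\<in>B. h x \<partial>\<mu>) \<le>
       ennreal ((cotlar_const + 1) * A) * emeasure \<mu> B + ennreal (320 * N\<^sup>2 * (\<integral>y. (cmod (\<phi> y))\<^sup>2 \<partial>\<mu>) / A)"
proof -
  define S where "S = (\<integral>y. (cmod (\<phi> y))\<^sup>2 \<partial>\<mu>)"
  have "0 \<le> S" unfolding S_def by simp
  have c0: "0 < cotlar_const" unfolding cotlar_const_def using tail_const_pos N by linarith
  have "\<exists>U. U \<in> sets borel \<and> (\<forall>x r. 0 < r \<longrightarrow> cotlar_const * A + 2^i * A < cmod (trunc_fun r \<phi> x) \<longrightarrow> x \<in> U) \<and>
    emeasure \<mu> U \<le> ennreal (80 * N\<^sup>2 * S / (2^i * A)\<^sup>2)" for i :: nat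
    using cotlar_weak[OF \<phi>, of "2^i * A"] \<open>0 < A\<close> unfolding S_def by (metis mult_pos_pos zero_less_numeral zero_less_power)
  then obtain U where U: "\<And>i::nat. U i \<in> sets borel"
    "\<And>i x r. 0 < r \<Longrightarrow> cotlar_const * A + 2^i * A < cmod (trunc_fun r \<phi> x) \<Longrightarrow> x \<in> U i"
    "\<And>i. emeasure \<mu> (U i) \<le> ennreal (80 * N\<^sup>2 * S / (2^i * A)\<^sup>2)" by metis
  note [measurable] = U(1)
  \<comment> \<open>A layer-cake majorant along the levels \<open>2^i * A\<close>.\<close>
  define h where "h x = ennreal ((cotlar_const + 1) * A) + (\<Sum>i. ennreal (2^Suc i * A) * indicator (U i) x)" for x
  have hm [measurable]: "h \<in> borel_measurable borel" unfolding h_def by measurable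
  have h_ge: "ennreal (cmod (trunc_fun r \<phi> x)) \<le> h x" if "0 < r" for x r
  proof (cases "\<exists>i. cmod (trunc_fun r \<phi> x) \<le> cotlar_const * A + 2^i * A")
    case True
    define n where "n = (LEAST i. cmod (trunc_fun r \<phi> x) \<le> cotlar_const * A + 2^i * A)"
    have n: "cmod (trunc_fun r \<phi> x) \<le> cotlar_const * A + 2^n * A"
      unfolding n_def using True by (rule LeastI_ex)
    show ?thesis
    proof (cases n)
      case 0
      then have "cmod (trunc_fun r \<phi> x) \<le> (cotlar_const + 1) * A" using n by (simp add: algebra_simps)
      then have "ennreal (cmod (trunc_fun r \<phi> x)) \<le> ennreal ((cotlar_const + 1) * A)" by (rule ennreal_leI)
      then show ?thesis unfolding h_def by (simp add: add_increasing2)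
    next
      case (Suc k)
      \<comment> \<open>\<open>n\<close> is the least level bounding the truncation, so level
        \<open>k\<close> is exceeded and \<open>x\<close> lies in \<open>U k\<close>; the single
        term \<open>2^Suc k * A\<close> of the series then suffices.\<close>
      then have "k < (LEAST i. cmod (trunc_fun r \<phi> x) \<le> cotlar_const * A + 2^i * A)" unfolding n_def by simp
      from not_less_Least[OF this] have "x \<in> U k" using U(2)[OF that] by simp
      have "ennreal (cmod (trunc_fun r \<phi> x)) \<le> ennreal ((cotlar_const + 1) * A + 2^Suc k * A)"
        using n Suc \<open>0 < A\<close> by (intro ennreal_leI) (simp add: algebra_simps)
      also have "\<dots> = ennreal ((cotlar_const + 1) * A) + ennreal (2^Suc k * A) * indicator (U k) x"
        using \<open>0 < A\<close> c0 \<open>x \<in> U k\<close> by (subst ennreal_plus) auto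
      also have "\<dots> \<le> h x" unfolding h_def by (intro add_left_mono ennreal_le_suminf[where f = "\<lambda>i. ennreal (2^Suc i * A) * indicator (U i) x"])
      finally show ?thesis .
    qed
  next
    case False
    obtain i :: nat where "cmod (trunc_fun r \<phi> x) / A < 2^i" using real_arch_pow[of 2] by auto
    then have "cmod (trunc_fun r \<phi> x) < 2^i * A" using \<open>0 < A\<close> by (simp add: pos_divide_less_eq)
    then have "cmod (trunc_fun r \<phi> x) \<le> cotlar_const * A + 2^i * A" using c0 \<open>0 < A\<close> by (simp add: add_increasing)
    with False show ?thesis by blast
  qed
  have h_int: "(\<integral>\<^sup>+x\<in>B. h x \<partial>\<mu>) \<le> ennreal ((cotlar_const + 1) * A) * emeasure \<mu> B + ennreal (320 * N\<^sup>2 * S / A)"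
    if [measurable]: "B \<in> sets borel" for B
  proof -
    have "(\<integral>\<^sup>+x\<in>B. h x \<partial>\<mu>) \<le> (\<integral>\<^sup>+x. ennreal ((cotlar_const + 1) * A) * indicator B x + (\<Sum>i. ennreal (2^Suc i * A) * indicator (U i) x) \<partial>\<mu>)"
      by (intro nn_integral_mono) (auto simp: h_def indicator_def)
    also have "\<dots> = ennreal ((cotlar_const + 1) * A) * emeasure \<mu> B + (\<Sum>i. ennreal (2^Suc i * A) * emeasure \<mu> (U i))"
      using U(1) that by (subst nn_integral_add)
        (auto simp: nn_integral_suminf measurable_mu nn_integral_cmult_indicator)
    also have "(\<Sum>i. ennreal (2^Suc i * A) * emeasure \<mu> (U i)) \<le> (\<Sum>i. ennreal (160 * N\<^sup>2 * S / A * (1/2)^i))"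
    proof (intro suminf_le summableI)
      fix i
      have "ennreal (2^Suc i * A) * emeasure \<mu> (U i) \<le> ennreal (2^Suc i * A) * ennreal (80 * N\<^sup>2 * S / (2^i * A)\<^sup>2)"
        by (intro mult_left_mono U) auto
      also have "\<dots> = ennreal (2^Suc i * A * (80 * N\<^sup>2 * S / (2^i * A)\<^sup>2))"
        using \<open>0 < A\<close> \<open>0 \<le> S\<close> by (intro ennreal_mult[symmetric]) auto
      \<comment> \<open>One factor \<open>2^i\<close> of the denominator survives, and the geometric
        series turns 160 into 320.\<close>
      also have "2^Suc i * A * (80 * N\<^sup>2 * S / (2^i * A)\<^sup>2) = 160 * N\<^sup>2 * S / A * (1/2)^i"
        using \<open>0 < A\<close> by (simp add: power2_eq_square power_one_over field_simps)
      finally show "ennreal (2^Suc i * A) * emeasure \<mu> (U i) \<le> ennreal (160 * N\<^sup>2 * S / A * (1/2)^i)" .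
    qed
    also have "(\<Sum>i. ennreal (160 * N\<^sup>2 * S / A * (1/2)^i)) = ennreal (\<Sum>i. 160 * N\<^sup>2 * S / A * (1/2)^i)"
      using \<open>0 < A\<close> \<open>0 \<le> S\<close> by (intro suminf_ennreal2 summable_mult summable_geometric) auto
    also have "(\<Sum>i. 160 * N\<^sup>2 * S / A * (1/2)^i) = 320 * N\<^sup>2 * S / A"
      by (subst suminf_mult) (auto simp: suminf_geometric summable_geometric)
    finally show ?thesis by (simp add: add_left_mono)
  qed
  show ?thesis using that[of h] hm h_ge h_int unfolding S_def by blast
qed

section \<open>The weak type estimate\<close>

lemma trunc_fun_sum:
  assumes "finite P" "\<And>p. p \<in> P \<Longrightarrow> integrable \<mu> (\<phi> p)" "0 < r"
  shows "trunc_fun r (\<lambda>y. \<Sum>p\<in>P. \<phi> p y) x = (\<Sum>p\<in>P. trunc_fun r (\<phi> p) x)"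
proof -
  have "trunc_fun r (\<lambda>y. \<Sum>p\<in>P. \<phi> p y) x = (\<integral>y. (\<Sum>p\<in>P. indicat_real (- ball x r) y *\<^sub>R (K x y * \<phi> p y)) \<partial>\<mu>)"
    unfolding trunc_fun_def by (simp add: sum_distrib_left scaleR_sum_right)
  also have "\<dots> = (\<Sum>p\<in>P. trunc_fun r (\<phi> p) x)"
    unfolding trunc_fun_def using assms
    by (intro Bochner_Integration.integral_sum integrable_trunc_fun) auto
  finally show ?thesis .
qed

text \<open>Crude bound by total mass times kernel size, for truncation radii above half the
  distance to the point mass, where cancellation may be lost.\<close>

lemma trunc_fun_le:
  assumes f: "has_bochner_integral \<mu> f a" "\<And>y. 0 \<le> f y" and "0 < r"
  shows "cmod (trunc_fun r (\<lambda>y. complex_of_real (f y)) x) \<le> a / r"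
proof -
  have fi: "integrable \<mu> f" "integral\<^sup>L \<mu> f = a" using f by (auto simp: has_bochner_integral_iff)
  have "cmod (trunc_fun r (\<lambda>y. complex_of_real (f y)) x)
     \<le> (\<integral>y. norm (indicat_real (- ball x r) y *\<^sub>R (K x y * complex_of_real (f y))) \<partial>\<mu>)"
    unfolding trunc_fun_def by (rule integral_norm_bound)
  also have "\<dots> \<le> (\<integral>y. (1 / r) * f y \<partial>\<mu>)"
  proof (rule integral_mono)
    show "integrable \<mu> (\<lambda>y. norm (indicat_real (- ball x r) y *\<^sub>R (K x y * complex_of_real (f y))))"
      using fi \<open>0 < r\<close> by (intro integrable_norm integrable_trunc_fun integrable_of_real) auto
    fix y
    have "norm (indicat_real (- ball x r) y *\<^sub>R (K x y * complex_of_real (f y)))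
      = cmod (indicat_real (- ball x r) y *\<^sub>R K x y) * f y"
      using f(2)[of y] by (simp add: norm_mult)
    also have "\<dots> \<le> (1 / r) * f y"
      using f(2) by (intro mult_right_mono CZ_kernel_trunc_le[OF CZ \<open>0 < r\<close>])
    finally show "norm (indicat_real (- ball x r) y *\<^sub>R (K x y * complex_of_real (f y))) \<le> (1 / r) * f y" .
  qed (use fi in simp)
  also have "\<dots> = a / r" using fi by simp
  finally show ?thesis .
qed

text \<open>The density has the mass of the atom, so the difference is the integral of
  \<open>f y\<close> times \<open>K x p - K x y\<close>. As \<open>2 * r\<close> and
  \<open>2 * R\<close> are both at most the distance from \<open>x\<close> to \<open>p\<close>, the
  whole of \<open>ball p R\<close> lies outside \<open>ball x r\<close> and the truncation cuts
  nothing off.\<close>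

lemma cancellation_far:
  assumes f: "has_bochner_integral \<mu> f a" "\<And>y. 0 \<le> f y" "\<And>y. y \<notin> ball p R \<Longrightarrow> f y = 0"
    and "0 < r" "0 < R" "2 * r \<le> cmod (x - p)" "2 * R \<le> cmod (x - p)"
  shows "cmod (a *\<^sub>R (indicat_real (- ball x r) p *\<^sub>R K x p) - trunc_fun r (\<lambda>y. complex_of_real (f y)) x)
    \<le> a * (R powr \<epsilon> / cmod (x - p) powr (1 + \<epsilon>))"
proof -
  have fi: "integrable \<mu> f" "integral\<^sup>L \<mu> f = a" using f by (auto simp: has_bochner_integral_iff)
  have "x \<noteq> p" using assms by auto
  let ?e = "\<lambda>y. f y *\<^sub>R K x p - indicat_real (- ball x r) y *\<^sub>R (K x y * complex_of_real (f y))"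
  have i1: "integrable \<mu> (\<lambda>y. f y *\<^sub>R K x p)" using fi by simp
  have i2: "integrable \<mu> (\<lambda>y. indicat_real (- ball x r) y *\<^sub>R (K x y * complex_of_real (f y)))"
    using fi \<open>0 < r\<close> by (intro integrable_trunc_fun integrable_of_real) auto
  have "p \<in> - ball x r" using assms by (simp add: dist_norm)
  then have "a *\<^sub>R (indicat_real (- ball x r) p *\<^sub>R K x p) = (\<integral>y. f y *\<^sub>R K x p \<partial>\<mu>)"
    using fi by simp
  then have "a *\<^sub>R (indicat_real (- ball x r) p *\<^sub>R K x p) - trunc_fun r (\<lambda>y. complex_of_real (f y)) x = integral\<^sup>L \<mu> ?e"
    unfolding trunc_fun_def using i1 i2 by (simp add: Bochner_Integration.integral_diff)
  then have "cmod (a *\<^sub>R (indicat_real (- ball x r) p *\<^sub>R K x p) - trunc_fun r (\<lambda>y. complex_of_real (f y)) x)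
     \<le> (\<integral>y. norm (?e y) \<partial>\<mu>)" by (simp only: integral_norm_bound)
  also have "\<dots> \<le> (\<integral>y. (R powr \<epsilon> / cmod (x - p) powr (1 + \<epsilon>)) * f y \<partial>\<mu>)"
  proof (rule integral_mono)
    show "integrable \<mu> (\<lambda>y. norm (?e y))" using i1 i2 by (intro integrable_norm Bochner_Integration.integrable_diff)
    fix y
    show "norm (?e y) \<le> (R powr \<epsilon> / cmod (x - p) powr (1 + \<epsilon>)) * f y"
    proof (cases "y \<in> ball p R")
      case True
      then have py: "cmod (p - y) < R" by (simp add: dist_norm)
      have "cmod (x - p) \<le> cmod (x - y) + cmod (p - y)"
        using norm_triangle_ineq[of "x - y" "y - p"] by (simp add: norm_minus_commute)
      then have "y \<in> - ball x r" using py assms by (simp add: dist_norm)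
      then have "norm (?e y) = cmod ((K x p - K x y) * complex_of_real (f y))"
        by (simp add: scaleR_conv_of_real algebra_simps)
      also have "\<dots> = cmod (K x p - K x y) * f y" using f(2)[of y] by (simp add: norm_mult)
      also have "\<dots> \<le> (cmod (p - y) powr \<epsilon> / cmod (p - x) powr (1 + \<epsilon>)) * f y"
        using \<open>x \<noteq> p\<close> py assms by (intro mult_right_mono CZ_kernel_smooth(2)[OF CZ] f(2)) (auto simp: norm_minus_commute)
      also have "\<dots> \<le> (R powr \<epsilon> / cmod (x - p) powr (1 + \<epsilon>)) * f y"
        using py eps by (intro mult_right_mono f(2)) (auto simp: norm_minus_commute intro!: divide_right_mono powr_mono2)
      finally show ?thesis .
    qed (use f(3) in simp)
  qed (use fi in simp)
  also have "\<dots> = a * (R powr \<epsilon> / cmod (x - p) powr (1 + \<epsilon>))" using fi by simp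
  finally show ?thesis .
qed

text \<open>60 is for the atom on the shell,
  \<open>80 * (cotlar_const + 1) + 320 * N\<^sup>2\<close> for the truncations of the density near
  \<open>p\<close>, and \<open>tail_const \<epsilon>\<close> for the cancellation far away.\<close>

definition piece_const :: real where
  "piece_const = 60 + 80 * (cotlar_const + 1) + 320 * N\<^sup>2 + tail_const \<epsilon>"

lemma cotlar_const_pos: "0 < cotlar_const"
  unfolding cotlar_const_def using tail_const_pos N by linarith

lemma piece_const_pos: "0 < piece_const"
  unfolding piece_const_def using tail_const_pos cotlar_const_pos by (simp add: add_pos_pos add_pos_nonneg)

text \<open>Near \<open>p\<close> the atom and its density are estimated separately, far from
  \<open>p\<close> by cancellation. One integrable \<open>g\<close> serves all radii except those
  with \<open>cmod (x - p) < 2 * r\<close>, which are charged to the last term. Points of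
  \<open>ball p (2 * \<rho>)\<close>, too close to the singularity, are left to an exceptional
  set.\<close>

lemma bad_piece:
  assumes "0 < \<alpha>" "0 < \<rho>" "2 * \<rho> \<le> R" "0 < m p R" "m p (20 * R) \<le> 40 * m p R"
    and shell: "(\<integral>\<^sup>+y\<in>ball p (20 * R) - ball p (2 * \<rho>). ennreal (1 / cmod (p - y)) \<partial>\<mu>) \<le> 60"
    and f: "has_bochner_integral \<mu> f \<alpha>" "\<And>y. 0 \<le> f y" "\<And>y. y \<notin> ball p R \<Longrightarrow> f y = 0"
      "\<And>y. f y \<le> 2 * \<alpha> / m p R"
  obtains g where "g \<in> borel_measurable borel" "(\<integral>\<^sup>+x. g x \<partial>\<mu>) \<le> ennreal (piece_const * \<alpha>)"
    "\<And>x r. 0 < r \<Longrightarrow> x \<notin> ball p (2 * \<rho>) \<Longrightarrow>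
      ennreal (cmod (\<alpha> *\<^sub>R (indicat_real (- ball x r) p *\<^sub>R K x p) - trunc_fun r (\<lambda>y. complex_of_real (f y)) x))
      \<le> g x + ennreal (if p \<in> ball x (2 * r) then 2 * \<alpha> / r else 0)"
proof -
  define A where "A = 2 * \<alpha> / m p R"
  have "0 < A" unfolding A_def using assms by simp
  have "0 < R" using assms by linarith
  have fi: "integrable \<mu> f" "integral\<^sup>L \<mu> f = \<alpha>" using f by (auto simp: has_bochner_integral_iff)
  have "integrable \<mu> (\<lambda>y. complex_of_real (f y))" using fi by (intro integrable_of_real)
  moreover have "cmod (complex_of_real (f y)) \<le> A" for y using f(2)[of y] f(4)[of y] unfolding A_def by simp
  ultimately obtain h where h: "h \<in> borel_measurable borel"
    "\<And>x r. 0 < r \<Longrightarrow> ennreal (cmod (trunc_fun r (\<lambda>y. complex_of_real (f y)) x)) \<le> h x"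
    "\<And>B. B \<in> sets borel \<Longrightarrow> (\<integral>\<^sup>+x\<in>B. h x \<partial>\<mu>) \<le>
       ennreal ((cotlar_const + 1) * A) * emeasure \<mu> B + ennreal (320 * N\<^sup>2 * (\<integral>y. (cmod (complex_of_real (f y)))\<^sup>2 \<partial>\<mu>) / A)"
    using \<open>0 < A\<close> by (rule cotlar_majorant) blast
  note [measurable] = h(1)
  \<comment> \<open>\<open>g1\<close> bounds the atom near \<open>p\<close>, \<open>g2\<close> the
    truncated density near \<open>p\<close>, and \<open>g3\<close> their difference beyond
    \<open>2 * R\<close>.\<close>
  define g1 where "g1 x = ennreal \<alpha> * (ennreal (1 / cmod (p - x)) * indicator (ball p (20 * R) - ball p (2 * \<rho>)) x)" for x
  define g2 where "g2 x = h x * indicator (ball p (2 * R)) x" for x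
  define g3 where "g3 x = ennreal \<alpha> * (ennreal ((2 * R) powr \<epsilon> / cmod (p - x) powr (1 + \<epsilon>)) * indicator (- ball p (2 * R)) x)" for x
  have [measurable]: "g1 \<in> borel_measurable borel" "g2 \<in> borel_measurable borel" "g3 \<in> borel_measurable borel"
    unfolding g1_def g2_def g3_def by measurable
  have I1: "(\<integral>\<^sup>+x. g1 x \<partial>\<mu>) \<le> ennreal (\<alpha> * 60)"
  proof -
    have "(\<integral>\<^sup>+x. g1 x \<partial>\<mu>) = ennreal \<alpha> * (\<integral>\<^sup>+y\<in>ball p (20 * R) - ball p (2 * \<rho>). ennreal (1 / cmod (p - y)) \<partial>\<mu>)"
      unfolding g1_def by (intro nn_integral_cmult) (auto simp: measurable_mu)
    also have "\<dots> \<le> ennreal \<alpha> * 60" by (intro mult_left_mono shell) auto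
    also have "\<dots> = ennreal (\<alpha> * 60)" using assms by (simp add: ennreal_mult)
    finally show ?thesis .
  qed
  have I3: "(\<integral>\<^sup>+x. g3 x \<partial>\<mu>) \<le> ennreal (\<alpha> * tail_const \<epsilon>)"
  proof -
    have "(\<integral>\<^sup>+x. g3 x \<partial>\<mu>) = ennreal \<alpha> * (\<integral>\<^sup>+x\<in>- ball p (2 * R). ennreal ((2 * R) powr \<epsilon> / cmod (p - x) powr (1 + \<epsilon>)) \<partial>\<mu>)"
      unfolding g3_def by (intro nn_integral_cmult) (auto simp: measurable_mu)
    also have "\<dots> \<le> ennreal \<alpha> * ennreal (tail_const \<epsilon>)" using \<open>0 < R\<close> by (intro mult_left_mono nn_integral_tail eps) auto
    also have "\<dots> = ennreal (\<alpha> * tail_const \<epsilon>)" using assms tail_const_pos by (simp add: ennreal_mult)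
    finally show ?thesis .
  qed
  have I2: "(\<integral>\<^sup>+x. g2 x \<partial>\<mu>) \<le> ennreal (80 * (cotlar_const + 1) * \<alpha> + 320 * N\<^sup>2 * \<alpha>)"
  proof -
    \<comment> \<open>Since \<open>f\<close> lies between 0 and \<open>A\<close>, its square has
      integral at most \<open>A * \<alpha>\<close>, which cancels the \<open>A\<close> in the
      denominator of the bound for \<open>h\<close>.\<close>
    have "(\<integral>y. (f y)\<^sup>2 \<partial>\<mu>) \<le> (\<integral>y. A * f y \<partial>\<mu>)"
    proof (intro integral_mono)
      show "integrable \<mu> (\<lambda>y. (f y)\<^sup>2)"
      proof (rule Bochner_Integration.integrable_bound)
        show "integrable \<mu> (\<lambda>y. A * f y)" using fi by simp
        show "(\<lambda>y. (f y)\<^sup>2) \<in> borel_measurable \<mu>" using fi by measurable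
        show "AE y in \<mu>. norm ((f y)\<^sup>2) \<le> norm (A * f y)"
          using f(2,4) \<open>0 < A\<close> by (intro AE_I2) (auto simp: power2_eq_square A_def[symmetric] intro!: mult_right_mono)
      qed
      show "(f y)\<^sup>2 \<le> A * f y" for y
        using f(2)[of y] f(4)[of y] by (auto simp: power2_eq_square A_def[symmetric] intro!: mult_right_mono)
    qed (use fi in simp)
    also have "\<dots> = A * \<alpha>" using fi by simp
    finally have sq: "(\<integral>y. (cmod (complex_of_real (f y)))\<^sup>2 \<partial>\<mu>) \<le> A * \<alpha>" by simp
    have "320 * N\<^sup>2 * (\<integral>y. (cmod (complex_of_real (f y)))\<^sup>2 \<partial>\<mu>) / A \<le> 320 * N\<^sup>2 * (A * \<alpha>) / A"
      using sq \<open>0 < A\<close> by (intro divide_right_mono mult_left_mono) auto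
    also have "\<dots> = 320 * N\<^sup>2 * \<alpha>" using \<open>0 < A\<close> by simp
    finally have 1: "320 * N\<^sup>2 * (\<integral>y. (cmod (complex_of_real (f y)))\<^sup>2 \<partial>\<mu>) / A \<le> 320 * N\<^sup>2 * \<alpha>" .
    have "m p (2 * R) \<le> 40 * m p R" using assms(5) m_mono[of "2 * R" "20 * R" p] \<open>0 < R\<close> by linarith
    then have "(cotlar_const + 1) * A * m p (2 * R) \<le> (cotlar_const + 1) * A * (40 * m p R)"
      using cotlar_const_pos \<open>0 < A\<close> by (intro mult_left_mono) auto
    \<comment> \<open>\<open>A\<close> is \<open>2 * \<alpha> / m p R\<close>, so the doubling
      constant 40 becomes 80.\<close>
    also have "\<dots> = 80 * (cotlar_const + 1) * \<alpha>" using assms(4) by (simp add: A_def field_simps)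
    finally have 2: "(cotlar_const + 1) * A * m p (2 * R) \<le> 80 * (cotlar_const + 1) * \<alpha>" .
    have "(\<integral>\<^sup>+x. g2 x \<partial>\<mu>) \<le> ennreal ((cotlar_const + 1) * A) * ennreal (m p (2 * R)) + ennreal (320 * N\<^sup>2 * (\<integral>y. (cmod (complex_of_real (f y)))\<^sup>2 \<partial>\<mu>) / A)"
      unfolding g2_def using h(3)[of "ball p (2 * R)"] by (simp add: emeasure_ball)
    also have "\<dots> \<le> ennreal (80 * (cotlar_const + 1) * \<alpha>) + ennreal (320 * N\<^sup>2 * \<alpha>)"
      using 1 2 cotlar_const_pos \<open>0 < A\<close> by (intro add_mono) (auto simp: ennreal_mult[symmetric] intro!: ennreal_leI)
    also have "\<dots> = ennreal (80 * (cotlar_const + 1) * \<alpha> + 320 * N\<^sup>2 * \<alpha>)"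
      using cotlar_const_pos assms(1) by (intro ennreal_plus[symmetric]) auto
    finally show ?thesis .
  qed
  define g where "g x = g1 x + g2 x + g3 x" for x
  have [measurable]: "g \<in> borel_measurable borel" unfolding g_def by measurable
  have "(\<integral>\<^sup>+x. g x \<partial>\<mu>) = (\<integral>\<^sup>+x. g1 x \<partial>\<mu>) + (\<integral>\<^sup>+x. g2 x \<partial>\<mu>) + (\<integral>\<^sup>+x. g3 x \<partial>\<mu>)"
    unfolding g_def by (simp add: nn_integral_add measurable_mu)
  also have "\<dots> \<le> ennreal (\<alpha> * 60) + ennreal (80 * (cotlar_const + 1) * \<alpha> + 320 * N\<^sup>2 * \<alpha>) + ennreal (\<alpha> * tail_const \<epsilon>)"
    by (intro add_mono I1 I2 I3)
  also have "\<dots> = ennreal (piece_const * \<alpha>)"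
    using cotlar_const_pos tail_const_pos assms(1)
    by (simp add: piece_const_def algebra_simps flip: ennreal_plus)
  finally have gI: "(\<integral>\<^sup>+x. g x \<partial>\<mu>) \<le> ennreal (piece_const * \<alpha>)" .
  have g_bd: "ennreal (cmod (\<alpha> *\<^sub>R (indicat_real (- ball x r) p *\<^sub>R K x p) - trunc_fun r (\<lambda>y. complex_of_real (f y)) x))
      \<le> g x + ennreal (if p \<in> ball x (2 * r) then 2 * \<alpha> / r else 0)" (is "ennreal (cmod (?a - ?b)) \<le> _")
    if r: "0 < r" and x: "x \<notin> ball p (2 * \<rho>)" for x r
  proof (cases "p \<in> ball x (2 * r)")
    case True
    have "cmod ?a \<le> \<alpha> * (1 / r)" using CZ_kernel_trunc_le[OF CZ r, of x p] assms(1)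
      by (simp only: norm_scaleR abs_of_pos mult_left_mono less_imp_le)
    moreover have "cmod ?b \<le> \<alpha> / r" by (rule trunc_fun_le[OF f(1,2) r])
    ultimately have "cmod (?a - ?b) \<le> 2 * \<alpha> / r" using norm_triangle_ineq4[of ?a ?b] by simp
    then have "ennreal (cmod (?a - ?b)) \<le> ennreal (2 * \<alpha> / r)" by (rule ennreal_leI)
    then show ?thesis using True by (simp add: add_increasing)
  next
    case False
    then have r2: "2 * r \<le> cmod (x - p)" by (simp add: dist_norm)
    then have "x \<noteq> p" using r by auto
    have "ennreal (cmod (?a - ?b)) \<le> g x"
    proof (cases "x \<in> ball p (2 * R)")
      case True
      have "p \<in> - ball x r" using r2 r by (simp add: dist_norm)
      then have "cmod ?a = \<alpha> * cmod (K x p)" using assms(1) by simp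
      also have "\<dots> \<le> \<alpha> * (1 / cmod (p - x))" using CZ_kernel_le[OF CZ \<open>x \<noteq> p\<close>] assms(1)
        by (intro mult_left_mono) (auto simp: norm_minus_commute)
      finally have "ennreal (cmod ?a) \<le> ennreal (\<alpha> * (1 / cmod (p - x)))" by (rule ennreal_leI)
      also have "\<dots> = g1 x" unfolding g1_def using True x \<open>0 < R\<close> assms(1) by (subst ennreal_mult) auto
      finally have 1: "ennreal (cmod ?a) \<le> g1 x" .
      have 2: "ennreal (cmod ?b) \<le> g2 x" unfolding g2_def using h(2)[OF r, of x] True by simp
      have "ennreal (cmod (?a - ?b)) \<le> ennreal (cmod ?a + cmod ?b)" by (intro ennreal_leI norm_triangle_ineq4)
      also have "\<dots> = ennreal (cmod ?a) + ennreal (cmod ?b)" by (rule ennreal_plus) auto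
      also have "\<dots> \<le> g1 x + g2 x" by (intro add_mono 1 2)
      also have "\<dots> \<le> g x" unfolding g_def by simp
      finally show ?thesis .
    next
      case False
      then have R2: "2 * R \<le> cmod (x - p)" by (simp add: dist_norm norm_minus_commute)
      have "cmod (?a - ?b) \<le> \<alpha> * (R powr \<epsilon> / cmod (x - p) powr (1 + \<epsilon>))"
        by (rule cancellation_far[OF f(1-3) r \<open>0 < R\<close> r2 R2])
      also have "\<dots> \<le> \<alpha> * ((2 * R) powr \<epsilon> / cmod (p - x) powr (1 + \<epsilon>))"
        using assms(1) \<open>0 < R\<close> eps unfolding norm_minus_commute[of p x]
        by (intro mult_left_mono divide_right_mono powr_mono2) auto
      finally have "ennreal (cmod (?a - ?b)) \<le> ennreal (\<alpha> * ((2 * R) powr \<epsilon> / cmod (p - x) powr (1 + \<epsilon>)))" by (rule ennreal_leI)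
      also have "\<dots> = g3 x" unfolding g3_def using False assms(1) by (subst ennreal_mult) auto
      also have "\<dots> \<le> g x" unfolding g_def by (simp add: add_increasing)
      finally show ?thesis .
    qed
    then show ?thesis using False by simp
  qed
  show ?thesis using that[of g] gI g_bd by auto
qed

section \<open>Finite sums of point masses\<close>

text \<open>The density \<open>F\<close> is at most \<open>160 * t\<close> and costs
  \<open>160 * cotlar_const + 1\<close>; the remaining 5 is 1 for the majorant \<open>G\<close> and
  4 for the radii without cancellation.\<close>

definition discrete_level :: real where "discrete_level = 160 * cotlar_const + 6"
text \<open>The four exceptional sets: 1 for \<open>\<Omega>\<close> and 5 for \<open>UM\<close>,
  \<open>12800 * N\<^sup>2\<close> for \<open>UF\<close>, and \<open>piece_const\<close> for
  \<open>UG\<close>.\<close>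

definition discrete_const :: real where "discrete_const = 6 + 12800 * N\<^sup>2 + piece_const"

text \<open>Calderon-Zygmund decomposition: the atoms are the bounded density \<open>F\<close> plus
  differences of total mass zero. The exceptional set consists of the stopping balls
  \<open>\<Omega>\<close>, the set \<open>UF\<close> for truncations of \<open>F\<close>, the set
  \<open>UG\<close> where the summed majorant of the differences is large, and \<open>UM\<close>,
  where the maximal function of the atoms is large.\<close>

lemma weak_type_discrete:
  assumes "finite P" "\<And>p. p \<in> P \<Longrightarrow> 0 < \<alpha> p" "0 < t"
  obtains U where "U \<in> sets borel"
    "\<And>x r. 0 < r \<Longrightarrow> discrete_level * t < cmod (\<Sum>p\<in>P. \<alpha> p *\<^sub>R (indicat_real (- ball x r) p *\<^sub>R K x p)) \<Longrightarrow> x \<in> U"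
    "emeasure \<mu> U \<le> ennreal (discrete_const * (\<Sum>p\<in>P. \<alpha> p) / t)"
proof (cases "emeasure \<mu> UNIV \<le> ennreal ((\<Sum>p\<in>P. \<alpha> p) / t)")
  \<comment> \<open>If \<open>\<mu>\<close> has so little mass, the whole plane is an admissible
    \<open>U\<close>; otherwise stopping radii exist.\<close>
  case True
  have "0 \<le> (\<Sum>p\<in>P. \<alpha> p)" using assms by (intro sum_nonneg) (auto intro: less_imp_le)
  moreover have "1 \<le> discrete_const" using piece_const_pos by (simp add: discrete_const_def)
  ultimately have "1 * (\<Sum>p\<in>P. \<alpha> p) / t \<le> discrete_const * (\<Sum>p\<in>P. \<alpha> p) / t"
    using assms by (intro divide_right_mono mult_right_mono) auto
  then have "ennreal ((\<Sum>p\<in>P. \<alpha> p) / t) \<le> ennreal (discrete_const * (\<Sum>p\<in>P. \<alpha> p) / t)"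
    by (intro ennreal_leI) simp
  with True have "emeasure \<mu> UNIV \<le> ennreal (discrete_const * (\<Sum>p\<in>P. \<alpha> p) / t)" by (rule order_trans)
  then show ?thesis using that[of UNIV] by simp
next
  case False
  define a where "a = (\<Sum>p\<in>P. \<alpha> p)"
  have "0 \<le> a" unfolding a_def using assms by (intro sum_nonneg) (auto intro: less_imp_le)
  have big: "ennreal (a / t) < emeasure \<mu> UNIV" using False unfolding a_def by (simp add: not_le)
  then have nz: "emeasure \<mu> UNIV \<noteq> 0" by auto
  define V where "V B = (\<Sum>p\<in>P \<inter> B. \<alpha> p)" for B
  have V_mono: "V B \<le> V C" if "B \<subseteq> C" for B C
    unfolding V_def using assms that by (intro sum_mono2) (auto intro: less_imp_le)
  have V_le: "V B \<le> a" for B using V_mono[of B UNIV] unfolding a_def V_def by simp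
  have V_ge: "\<alpha> p \<le> V B" if "p \<in> P" "p \<in> B" for p B
    using V_mono[of "{p}" B] that unfolding V_def by simp
  obtain \<kappa> :: "complex measure" where \<kappa>: "sets \<kappa> = sets borel" "\<And>B. B \<in> sets borel \<Longrightarrow> emeasure \<kappa> B = ennreal (V B)"
    using discrete_measure_exists[of P \<alpha>] assms(1) less_imp_le[OF assms(2)] unfolding V_def by blast
  have \<kappa>U: "emeasure \<kappa> UNIV = ennreal a" using \<kappa>(2)[of UNIV] by (simp add: V_def a_def)
  have "\<exists>\<rho>>0. t * m p (10 * \<rho>) < V (ball p \<rho>) \<and> (\<forall>r\<ge>2 * \<rho>. V (ball p r) \<le> t * m p (10 * r))" if "p \<in> P" for p
    using assms(2)[OF that] \<open>0 < t\<close> by (rule stopping_radius_exists) (use that V_ge V_le big in auto)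
  then obtain \<rho> where \<rho>: "\<And>p. p \<in> P \<Longrightarrow> 0 < \<rho> p" "\<And>p. p \<in> P \<Longrightarrow> t * m p (10 * \<rho> p) < V (ball p (\<rho> p))"
    "\<And>p r. p \<in> P \<Longrightarrow> 2 * \<rho> p \<le> r \<Longrightarrow> V (ball p r) \<le> t * m p (10 * r)" by metis
  define good where "good p R \<longleftrightarrow> 2 * \<rho> p \<le> R \<and> 0 < m p R \<and> m p (20 * R) \<le> 40 * m p R \<and>
    (\<integral>\<^sup>+y\<in>ball p (20 * R) - ball p (2 * \<rho> p). ennreal (1 / cmod (p - y)) \<partial>\<mu>) \<le> 60" for p R
  have "\<forall>p\<in>P. \<exists>R. good p R"
  proof
    fix p assume "p \<in> P"
    then have "0 < 2 * \<rho> p" using \<rho>(1) by simp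
    then show "\<exists>R. good p R"
      by (rule doubling_scale[OF nz, of _ p]) (unfold good_def, intro exI conjI; assumption)
  qed
  then obtain R where "\<forall>p\<in>P. good p (R p)" using bchoice[of P good] by blast
  then have R: "\<And>p. p \<in> P \<Longrightarrow> 2 * \<rho> p \<le> R p" "\<And>p. p \<in> P \<Longrightarrow> 0 < m p (R p)"
    "\<And>p. p \<in> P \<Longrightarrow> m p (20 * R p) \<le> 40 * m p (R p)"
    "\<And>p. p \<in> P \<Longrightarrow> (\<integral>\<^sup>+y\<in>ball p (20 * R p) - ball p (2 * \<rho> p). ennreal (1 / cmod (p - y)) \<partial>\<mu>) \<le> 60"
    unfolding good_def by simp_all
  have Rpos: "0 < R p" if "p \<in> P" for p using R(1)[OF that] \<rho>(1)[OF that] by linarith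
  have "\<exists>f. (\<forall>p\<in>P. has_bochner_integral \<mu> (f p) (\<alpha> p) \<and> (\<forall>x. 0 \<le> f p x) \<and> (\<forall>x. x \<notin> ball p (R p) \<longrightarrow> f p x = 0) \<and>
      (\<forall>x. f p x \<le> 2 * \<alpha> p / m p (R p))) \<and> (\<forall>x. (\<Sum>p\<in>P. f p x) \<le> 4 * (40 * t))"
  proof (rule bounded_packing)
    fix p assume p: "p \<in> P"
    \<comment> \<open>The smaller balls meeting \<open>ball p (R p)\<close> have their centres in
      \<open>ball p (2 * R p)\<close>. The stopping condition compares the mass there with
      \<open>m p (20 * R p)\<close>, and doubling returns to \<open>m p (R p)\<close>; this is why
      doubling was arranged with the factor 20.\<close>
    have "(\<Sum>k | k \<in> P \<and> R k \<le> R p \<and> ball k (R k) \<inter> ball p (R p) \<noteq> {}. \<alpha> k) \<le> V (ball p (2 * R p))"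
      unfolding V_def
    proof (rule sum_mono2)
      show "{k \<in> P. R k \<le> R p \<and> ball k (R k) \<inter> ball p (R p) \<noteq> {}} \<subseteq> P \<inter> ball p (2 * R p)"
      proof
        fix k assume "k \<in> {k \<in> P. R k \<le> R p \<and> ball k (R k) \<inter> ball p (R p) \<noteq> {}}"
        then have k: "k \<in> P" "R k \<le> R p" "ball k (R k) \<inter> ball p (R p) \<noteq> {}" by auto
        then obtain z where "dist k z < R k" "dist p z < R p" by auto
        then have "dist p k < 2 * R p" using dist_triangle2[of p k z] k(2) by linarith
        then show "k \<in> P \<inter> ball p (2 * R p)" using k by simp
      qed
    qed (use assms in \<open>auto intro: less_imp_le\<close>)
    also have "\<dots> \<le> t * m p (10 * (2 * R p))" using R(1)[OF p] \<rho>(1)[OF p] by (intro \<rho>(3)[OF p]) linarith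
    also have "\<dots> \<le> t * (40 * m p (R p))" using R(3)[OF p] \<open>0 < t\<close> by (intro mult_left_mono) auto
    finally show "(\<Sum>k | k \<in> P \<and> R k \<le> R p \<and> ball k (R k) \<inter> ball p (R p) \<noteq> {}. \<alpha> k) \<le> 40 * t * m p (R p)" by simp
  qed (use assms R in \<open>auto intro: less_imp_le\<close>)
  then obtain f where f': "\<forall>p\<in>P. has_bochner_integral \<mu> (f p) (\<alpha> p) \<and> (\<forall>x. 0 \<le> f p x) \<and>
      (\<forall>x. x \<notin> ball p (R p) \<longrightarrow> f p x = 0) \<and> (\<forall>x. f p x \<le> 2 * \<alpha> p / m p (R p))"
    and f'_sum: "\<forall>x. (\<Sum>p\<in>P. f p x) \<le> 4 * (40 * t)"
    by (elim exE conjE)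
  have f: "\<And>p. p \<in> P \<Longrightarrow> has_bochner_integral \<mu> (f p) (\<alpha> p)" "\<And>p x. p \<in> P \<Longrightarrow> 0 \<le> f p x"
    "\<And>p x. p \<in> P \<Longrightarrow> x \<notin> ball p (R p) \<Longrightarrow> f p x = 0" "\<And>p x. p \<in> P \<Longrightarrow> f p x \<le> 2 * \<alpha> p / m p (R p)"
    "\<And>x. (\<Sum>p\<in>P. f p x) \<le> 160 * t" using f' f'_sum by simp_all
  have fi: "integrable \<mu> (f p)" "integral\<^sup>L \<mu> (f p) = \<alpha> p" if "p \<in> P" for p
    using f(1)[OF that] by (auto simp: has_bochner_integral_iff)

  define \<Omega> where "\<Omega> = (\<Union>(p, s)\<in>{(p, 2 * \<rho> p) | p. p \<in> P}. ball p s)"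
  have \<Omega>_open: "open \<Omega>" unfolding \<Omega>_def by auto
  have "ennreal t * emeasure \<mu> \<Omega> \<le> emeasure \<kappa> UNIV"
    unfolding \<Omega>_def
  proof (rule Vitali_measure_bound[OF \<kappa>(1)])
    fix p s assume "(p, s) \<in> {(p, 2 * \<rho> p) | p. p \<in> P}"
    then have p: "p \<in> P" "s = 2 * \<rho> p" by auto
    \<comment> \<open>\<open>5 * s\<close> is \<open>10 * \<rho> p\<close>, the radius built into
      the stopping condition.\<close>
    have "t * m p (5 * s) \<le> V (ball p (\<rho> p))" using \<rho>(2)[OF p(1)] p(2) by simp
    also have "\<dots> \<le> V (ball p s)" using p \<rho>(1)[OF p(1)] by (intro V_mono subset_ball) auto
    finally have "t * m p (5 * s) \<le> V (ball p s)" .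
    then show "0 < s \<and> ennreal t * emeasure \<mu> (ball p (5 * s)) \<le> emeasure \<kappa> (ball p s)"
      using p \<rho>(1) \<open>0 < t\<close> by (auto simp: emeasure_ball \<kappa>(2) ennreal_mult[symmetric] intro!: ennreal_leI)
  qed
  then have \<Omega>_le: "ennreal t * emeasure \<mu> \<Omega> \<le> ennreal a" unfolding \<kappa>U .

  define F where "F y = complex_of_real (\<Sum>p\<in>P. f p y)" for y
  have F_eq: "F = (\<lambda>y. \<Sum>p\<in>P. complex_of_real (f p y))" unfolding F_def by auto
  have F_int: "integrable \<mu> F" unfolding F_def using fi by (intro integrable_of_real Bochner_Integration.integrable_sum) auto
  have s_nn: "0 \<le> (\<Sum>p\<in>P. f p y)" for y using f(2) by (intro sum_nonneg) auto
  have F_bd: "cmod (F y) \<le> 160 * t" for y unfolding F_def norm_of_real using s_nn[of y] f(5)[of y] by simp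
  have F_sq: "(\<integral>y. (cmod (F y))\<^sup>2 \<partial>\<mu>) \<le> 160 * t * a"
  proof -
    have "(\<integral>y. (cmod (F y))\<^sup>2 \<partial>\<mu>) \<le> (\<integral>y. 160 * t * (\<Sum>p\<in>P. f p y) \<partial>\<mu>)"
    proof (intro integral_mono)
      show "integrable \<mu> (\<lambda>y. (cmod (F y))\<^sup>2)" using L2I[OF F_int F_bd] unfolding L2_functions_def by auto
      show "integrable \<mu> (\<lambda>y. 160 * t * (\<Sum>p\<in>P. f p y))"
        using fi by (intro integrable_mult_right Bochner_Integration.integrable_sum) auto
      show "(cmod (F y))\<^sup>2 \<le> 160 * t * (\<Sum>p\<in>P. f p y)" for y
        using f(5)[of y] s_nn[of y] unfolding F_def norm_of_real by (simp add: power2_eq_square mult_right_mono)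
    qed
    also have "\<dots> = 160 * t * a" using fi by (simp add: Bochner_Integration.integral_sum a_def)
    finally show ?thesis .
  qed
  obtain UF where UF: "UF \<in> sets borel"
    "\<And>x r. 0 < r \<Longrightarrow> cotlar_const * (160 * t) + t < cmod (trunc_fun r F x) \<Longrightarrow> x \<in> UF"
    "emeasure \<mu> UF \<le> ennreal (80 * N\<^sup>2 * (\<integral>y. (cmod (F y))\<^sup>2 \<partial>\<mu>) / t\<^sup>2)"
    using cotlar_weak[OF F_int F_bd \<open>0 < t\<close>] by blast
  have "80 * N\<^sup>2 * (\<integral>y. (cmod (F y))\<^sup>2 \<partial>\<mu>) / t\<^sup>2 \<le> 80 * N\<^sup>2 * (160 * t * a) / t\<^sup>2"
    by (intro divide_right_mono mult_left_mono F_sq) auto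
  also have "\<dots> = 12800 * N\<^sup>2 * a / t" using \<open>0 < t\<close> by (simp add: power2_eq_square)
  finally have UF_le: "emeasure \<mu> UF \<le> ennreal (12800 * N\<^sup>2 * a / t)"
    using UF(3) by (meson ennreal_leI order_trans)

  define major where "major p g \<longleftrightarrow> g \<in> borel_measurable borel \<and> (\<integral>\<^sup>+x. g x \<partial>\<mu>) \<le> ennreal (piece_const * \<alpha> p) \<and>
    (\<forall>x r. 0 < r \<longrightarrow> x \<notin> ball p (2 * \<rho> p) \<longrightarrow>
      ennreal (cmod (\<alpha> p *\<^sub>R (indicat_real (- ball x r) p *\<^sub>R K x p) - trunc_fun r (\<lambda>y. complex_of_real (f p y)) x))
      \<le> g x + ennreal (if p \<in> ball x (2 * r) then 2 * \<alpha> p / r else 0))" for p g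
  have "\<forall>p\<in>P. \<exists>g. major p g"
  proof
    fix p assume p: "p \<in> P"
    show "\<exists>g. major p g"
    proof (rule bad_piece[OF assms(2)[OF p] \<rho>(1)[OF p] R(1)[OF p] R(2)[OF p] R(3)[OF p] R(4)[OF p]
          f(1)[OF p] f(2)[OF p] f(3)[OF p] f(4)[OF p]])
      fix g assume "g \<in> borel_measurable borel" "(\<integral>\<^sup>+x. g x \<partial>\<mu>) \<le> ennreal (piece_const * \<alpha> p)"
        "\<And>x r. 0 < r \<Longrightarrow> x \<notin> ball p (2 * \<rho> p) \<Longrightarrow>
          ennreal (cmod (\<alpha> p *\<^sub>R (indicat_real (- ball x r) p *\<^sub>R K x p) - trunc_fun r (\<lambda>y. complex_of_real (f p y)) x))
          \<le> g x + ennreal (if p \<in> ball x (2 * r) then 2 * \<alpha> p / r else 0)"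
      then show "\<exists>g. major p g" unfolding major_def by blast
    qed
  qed
  then obtain g where "\<forall>p\<in>P. major p (g p)" using bchoice[of P major] by blast
  then have g: "\<And>p. p \<in> P \<Longrightarrow> g p \<in> borel_measurable borel"
    "\<And>p. p \<in> P \<Longrightarrow> (\<integral>\<^sup>+x. g p x \<partial>\<mu>) \<le> ennreal (piece_const * \<alpha> p)"
    "\<And>p x r. p \<in> P \<Longrightarrow> 0 < r \<Longrightarrow> x \<notin> ball p (2 * \<rho> p) \<Longrightarrow>
      ennreal (cmod (\<alpha> p *\<^sub>R (indicat_real (- ball x r) p *\<^sub>R K x p) - trunc_fun r (\<lambda>y. complex_of_real (f p y)) x))
      \<le> g p x + ennreal (if p \<in> ball x (2 * r) then 2 * \<alpha> p / r else 0)"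
    unfolding major_def by blast+
  define G where "G x = (\<Sum>p\<in>P. g p x)" for x
  have G_meas [measurable]: "G \<in> borel_measurable borel" unfolding G_def using g(1) by (intro borel_measurable_sum)
  have G_int: "(\<integral>\<^sup>+x. G x \<partial>\<mu>) \<le> ennreal (piece_const * a)"
  proof -
    have "(\<integral>\<^sup>+x. G x \<partial>\<mu>) = (\<Sum>p\<in>P. \<integral>\<^sup>+x. g p x \<partial>\<mu>)"
      unfolding G_def using g(1) by (intro nn_integral_sum) (auto simp: measurable_mu)
    also have "\<dots> \<le> (\<Sum>p\<in>P. ennreal (piece_const * \<alpha> p))" by (intro sum_mono g(2))
    also have "\<dots> = ennreal (piece_const * a)"
      using assms piece_const_pos by (subst sum_ennreal) (auto simp: a_def sum_distrib_left intro: less_imp_le)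
    finally show ?thesis .
  qed
  define UG where "UG = {x. ennreal t \<le> G x}"
  have UG_meas [measurable]: "UG \<in> sets borel" unfolding UG_def by measurable
  have "ennreal t * emeasure \<mu> UG = (\<integral>\<^sup>+x. ennreal t * indicator UG x \<partial>\<mu>)"
    by (simp add: nn_integral_cmult_indicator)
  also have "\<dots> \<le> (\<integral>\<^sup>+x. G x \<partial>\<mu>)" by (intro nn_integral_mono) (auto simp: UG_def indicator_def)
  also note G_int
  finally have UG_le: "ennreal t * emeasure \<mu> UG \<le> ennreal (piece_const * a)" .

  \<comment> \<open>Linear growth gives \<open>m x (5 * s) \<le> 5 * s\<close>, so balls heavy
    relative to their radius satisfy the hypothesis of Vitali's lemma with weight
    \<open>t / 5\<close>.\<close>
  define UM where "UM = (\<Union>(x, s)\<in>{(x, s). 0 < s \<and> t * s \<le> V (ball x s)}. ball x s)"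
  have UM_open: "open UM" unfolding UM_def by auto
  have "ennreal (t / 5) * emeasure \<mu> UM \<le> emeasure \<kappa> UNIV"
    unfolding UM_def
  proof (rule Vitali_measure_bound[OF \<kappa>(1)])
    fix x s assume "(x, s) \<in> {(x, s). 0 < s \<and> t * s \<le> V (ball x s)}"
    then have s: "0 < s" "t * s \<le> V (ball x s)" by auto
    have "t / 5 * m x (5 * s) \<le> t / 5 * (5 * s)" using s \<open>0 < t\<close> by (intro mult_left_mono m_le) auto
    also have "\<dots> \<le> V (ball x s)" using s by simp
    finally show "0 < s \<and> ennreal (t / 5) * emeasure \<mu> (ball x (5 * s)) \<le> emeasure \<kappa> (ball x s)"
      using s \<open>0 < t\<close> by (auto simp: emeasure_ball \<kappa>(2) ennreal_mult[symmetric] intro!: ennreal_leI)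
  qed
  then have UM_le: "ennreal (t / 5) * emeasure \<mu> UM \<le> ennreal a" unfolding \<kappa>U .

  have scale: "emeasure \<mu> B \<le> ennreal (c / s)" if "ennreal s * emeasure \<mu> B \<le> ennreal c" "0 < s" "0 \<le> c" for s c B
  proof -
    have "emeasure \<mu> B = ennreal (1 / s) * (ennreal s * emeasure \<mu> B)"
      using that by (simp add: mult.assoc[symmetric] ennreal_mult[symmetric])
    also have "\<dots> \<le> ennreal (1 / s) * ennreal c" by (intro mult_left_mono that) auto
    also have "\<dots> = ennreal (c / s)" using that by (simp add: ennreal_mult[symmetric])
    finally show ?thesis .
  qed
  define U where "U = \<Omega> \<union> UF \<union> UG \<union> UM"
  have [measurable]: "\<Omega> \<in> sets borel" "UF \<in> sets borel" "UM \<in> sets borel" using \<Omega>_open UF UM_open by auto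
  have "U \<in> sets borel" unfolding U_def by measurable
  moreover have "emeasure \<mu> U \<le> ennreal (discrete_const * (\<Sum>p\<in>P. \<alpha> p) / t)"
  proof -
    have "emeasure \<mu> U \<le> emeasure \<mu> \<Omega> + emeasure \<mu> UF + emeasure \<mu> UG + emeasure \<mu> UM"
      unfolding U_def by (intro order_trans[OF emeasure_subadditive] add_mono order_refl) auto
    also have "\<dots> \<le> ennreal (a / t) + ennreal (12800 * N\<^sup>2 * a / t) + ennreal (piece_const * a / t) + ennreal (a / (t / 5))"
      using piece_const_pos \<open>0 \<le> a\<close> \<open>0 < t\<close>
      by (intro add_mono UF_le scale \<Omega>_le UG_le UM_le) auto
    also have "\<dots> = ennreal (a / t + 12800 * N\<^sup>2 * a / t + piece_const * a / t + a / (t / 5))"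
    proof -
      have "0 \<le> a / t" "0 \<le> 12800 * N\<^sup>2 * a / t" "0 \<le> piece_const * a / t" "0 \<le> a / (t / 5)"
        using piece_const_pos \<open>0 \<le> a\<close> \<open>0 < t\<close> by simp_all
      then show ?thesis by (simp only: ennreal_plus add_nonneg_nonneg)
    qed
    also have "a / t + 12800 * N\<^sup>2 * a / t + piece_const * a / t + a / (t / 5) = discrete_const * a / t"
      using \<open>0 < t\<close> by (simp add: discrete_const_def field_simps)
    finally show ?thesis unfolding a_def .
  qed
  moreover have "x \<in> U" if r: "0 < r" and large: "discrete_level * t < cmod (\<Sum>p\<in>P. \<alpha> p *\<^sub>R (indicat_real (- ball x r) p *\<^sub>R K x p))" for x r
  proof (rule ccontr)
    assume "x \<notin> U"
    then have nU: "x \<notin> \<Omega>" "x \<notin> UF" "x \<notin> UG" "x \<notin> UM" unfolding U_def by auto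
    let ?a = "\<lambda>p. \<alpha> p *\<^sub>R (indicat_real (- ball x r) p *\<^sub>R K x p)"
    let ?b = "\<lambda>p. trunc_fun r (\<lambda>y. complex_of_real (f p y)) x"
    let ?w = "\<lambda>p. if p \<in> ball x (2 * r) then 2 * \<alpha> p / r else 0"
    have F_small: "cmod (trunc_fun r F x) \<le> cotlar_const * (160 * t) + t" using UF(2)[OF r, of x] nU(2) by linarith
    have F_sum: "trunc_fun r F x = (\<Sum>p\<in>P. ?b p)"
      unfolding F_eq using fi r assms(1) by (intro trunc_fun_sum integrable_of_real) auto
    have w_nn: "0 \<le> ?w p" if "p \<in> P" for p using assms(2)[OF that] r by simp
    \<comment> \<open>The terms without cancellation: outside \<open>UM\<close> the atoms in
      \<open>ball x (2 * r)\<close> have mass at most \<open>t * (2 * r)\<close>.\<close>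
    have "(\<Sum>p\<in>P. ?w p) = (\<Sum>p\<in>P \<inter> ball x (2 * r). 2 * \<alpha> p / r)"
      using assms(1) by (simp add: sum.inter_restrict)
    also have "\<dots> = 2 / r * V (ball x (2 * r))" unfolding V_def by (simp add: sum_distrib_left)
    also have "\<dots> \<le> 2 / r * (t * (2 * r))"
    proof (intro mult_left_mono)
      show "V (ball x (2 * r)) \<le> t * (2 * r)"
      proof (rule ccontr)
        assume "\<not> V (ball x (2 * r)) \<le> t * (2 * r)"
        then have "(x, 2 * r) \<in> {(x, s). 0 < s \<and> t * s \<le> V (ball x s)}" using r by auto
        moreover have "x \<in> ball x (2 * r)" using r by simp
        ultimately have "x \<in> UM" unfolding UM_def by blast
        with nU show False by simp
      qed
    qed (use r in auto)
    also have "\<dots> = 4 * t" using r by simp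
    finally have w_sum: "(\<Sum>p\<in>P. ?w p) \<le> 4 * t" .
    have w_eq: "(\<Sum>p\<in>P. ennreal (?w p)) = ennreal (\<Sum>p\<in>P. ?w p)"
      by (rule sum_ennreal) (rule w_nn)
    have "ennreal (\<Sum>p\<in>P. cmod (?a p - ?b p)) = (\<Sum>p\<in>P. ennreal (cmod (?a p - ?b p)))"
      by (rule sum_ennreal[symmetric]) auto
    also have "\<dots> \<le> (\<Sum>p\<in>P. g p x + ennreal (?w p))"
    proof (intro sum_mono g(3) r)
      fix p assume "p \<in> P"
      then show "x \<notin> ball p (2 * \<rho> p)" using nU(1) unfolding \<Omega>_def by blast
    qed
    also have "\<dots> = G x + ennreal (\<Sum>p\<in>P. ?w p)"
      unfolding G_def sum.distrib w_eq ..
    also have "\<dots> \<le> ennreal t + ennreal (4 * t)"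
      using nU(3) w_sum by (intro add_mono ennreal_leI) (auto simp: UG_def)
    also have "\<dots> = ennreal (5 * t)" using \<open>0 < t\<close> by (subst ennreal_plus[symmetric]) auto
    finally have diff: "(\<Sum>p\<in>P. cmod (?a p - ?b p)) \<le> 5 * t" using \<open>0 < t\<close> by (subst (asm) ennreal_le_iff) auto
    \<comment> \<open>The density contributes at most \<open>cotlar_const * (160 * t) + t\<close>
      and the differences at most \<open>5 * t\<close>, which together make up the level.\<close>
    have "(\<Sum>p\<in>P. ?a p) = trunc_fun r F x + (\<Sum>p\<in>P. ?a p - ?b p)" unfolding F_sum sum_subtractf by simp
    then have "cmod (\<Sum>p\<in>P. ?a p) \<le> cmod (trunc_fun r F x) + (\<Sum>p\<in>P. cmod (?a p - ?b p))"
      by (simp only:) (rule norm_triangle_mono[OF order_refl norm_sum])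
    also have "\<dots> \<le> discrete_level * t" using F_small diff unfolding discrete_level_def by (simp add: algebra_simps)
    finally show False using large by linarith
  qed
  ultimately show ?thesis using that[of U] by blast
qed

section \<open>From point masses to finite measures\<close>

definition trunc_meas :: "complex measure \<Rightarrow> real \<Rightarrow> complex \<Rightarrow> complex" where
  "trunc_meas \<kappa> r x = (\<integral>y. indicat_real (- ball x r) y *\<^sub>R K x y \<partial>\<kappa>)"

text \<open>The truncation jumps across the sphere of radius \<open>r\<close>, whence the mass of the sphere on the right.\<close>

lemma trunc_meas_approx:
  assumes "finite_measure \<kappa>" and \<kappa> [measurable_cong]: "sets \<kappa> = sets borel"
    and F: "\<And>i. F i \<in> borel_measurable \<kappa>" "\<And>y. (\<lambda>i. F i y) \<longlonglongrightarrow> y"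
    and "0 < r" "0 < \<delta>"
  shows "\<forall>\<^sub>F i in sequentially. cmod (trunc_meas \<kappa> r x) \<le>
    cmod (\<integral>y. indicat_real (- ball x r) (F i y) *\<^sub>R K x (F i y) \<partial>\<kappa>) + 2 * measure \<kappa> (sphere x r) / r + \<delta>"
proof -
  interpret finite_measure \<kappa> by fact
  have space: "space \<kappa> = UNIV" using sets_eq_imp_space_eq[OF \<kappa>] by simp
  let ?k = "\<lambda>y. indicat_real (- ball x r) y *\<^sub>R K x y"
  let ?S = "sphere x r"
  have k_meas [measurable]: "?k \<in> borel_measurable borel" by (rule CZ_kernel_trunc_measurable[OF CZ eps \<open>0 < r\<close>])
  have k_le: "cmod (?k y) \<le> 1 / r" for y by (rule CZ_kernel_trunc_le[OF CZ \<open>0 < r\<close>])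
  note [measurable] = F(1)
  have S_meas [measurable]: "?S \<in> sets borel" by (simp add: borel_closed)
  have kF_meas: "(\<lambda>y. ?k (F i y)) \<in> borel_measurable \<kappa>" for i
    by (rule measurable_compose[OF F(1) k_meas])
  have k_meas': "?k \<in> borel_measurable \<kappa>" using k_meas measurable_cong_sets[OF \<kappa> refl] by blast
  have k_int: "integrable \<kappa> ?k" by (rule integrable_const_bound[where B = "1 / r"]) (use k_le k_meas' in auto)
  have kF_int: "integrable \<kappa> (\<lambda>y. ?k (F i y))" for i
    by (rule integrable_const_bound[where B = "1 / r"]) (use k_le kF_meas in auto)
  define d where "d i y = ?k y - ?k (F i y)" for i y
  have d_int: "integrable \<kappa> (d i)" for i unfolding d_def using k_int kF_int by (intro Bochner_Integration.integrable_diff)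
  have d_le: "cmod (d i y) \<le> 2 / r" for i y
    unfolding d_def using norm_triangle_ineq4[of "?k y" "?k (F i y)"] k_le[of y] k_le[of "F i y"] by simp
  \<comment> \<open>Off the sphere the truncated kernel is continuous at \<open>y\<close>: it
    vanishes on the open ball, and outside the closed ball it agrees with
    \<open>K x\<close>.\<close>
  have lim: "(\<lambda>i. d i y) \<longlonglongrightarrow> 0" if "y \<notin> ?S" for y
  proof -
    have "(\<lambda>i. ?k (F i y)) \<longlonglongrightarrow> ?k y"
    proof (cases "y \<in> ball x r")
      case True
      then have "\<forall>\<^sub>F i in sequentially. F i y \<in> ball x r"
        using topological_tendstoD[OF F(2)] by blast
      then have "\<forall>\<^sub>F i in sequentially. ?k (F i y) = ?k y"
        by eventually_elim (use True in auto)
      then show ?thesis by (rule tendsto_eventually)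
    next
      case False
      with that have y: "y \<in> - cball x r" by auto
      have "open (- cball x r)" by auto
      with y have ev: "\<forall>\<^sub>F i in sequentially. F i y \<in> - cball x r"
        using topological_tendstoD[OF F(2)] by blast
      have "y \<noteq> x" using y \<open>0 < r\<close> by auto
      then have "(\<lambda>i. K x (F i y)) \<longlonglongrightarrow> K x y"
        using CZ_kernel_isCont[OF CZ eps] F(2) by (intro isCont_tendsto_compose[of y "K x"])
      moreover have "\<forall>\<^sub>F i in sequentially. ?k (F i y) = K x (F i y)"
        using ev by eventually_elim auto
      ultimately have "(\<lambda>i. ?k (F i y)) \<longlonglongrightarrow> K x y" by (simp add: tendsto_cong)
      then show ?thesis using False by simp
    qed
    then have "(\<lambda>i. ?k y - ?k (F i y)) \<longlonglongrightarrow> ?k y - ?k y" by (intro tendsto_diff tendsto_const)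
    then show ?thesis unfolding d_def by simp
  qed
  \<comment> \<open>Dominated convergence handles the complement of the sphere; on the sphere only
    the uniform bound \<open>2 / r\<close> remains.\<close>
  have "(\<lambda>i. \<integral>y. indicat_real (- ?S) y *\<^sub>R d i y \<partial>\<kappa>) \<longlonglongrightarrow> (\<integral>y. 0 \<partial>\<kappa>)"
  proof (rule integral_dominated_convergence[where w = "\<lambda>_. 2 / r"])
    show "(\<lambda>y. indicat_real (- ?S) y *\<^sub>R d i y) \<in> borel_measurable \<kappa>" for i
      using d_int[of i] S_meas by (intro borel_measurable_scaleR) (auto simp: \<kappa>)
    show "AE y in \<kappa>. (\<lambda>i. indicat_real (- ?S) y *\<^sub>R d i y) \<longlonglongrightarrow> 0"
    proof (intro AE_I2)
      fix y show "(\<lambda>i. indicat_real (- ?S) y *\<^sub>R d i y) \<longlonglongrightarrow> 0"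
        using lim[of y] by (cases "y \<in> ?S") auto
    qed
    show "AE y in \<kappa>. norm (indicat_real (- ?S) y *\<^sub>R d i y) \<le> 2 / r" for i
      using d_le[of i] \<open>0 < r\<close> by (intro AE_I2) (auto simp: indicator_def)
  qed auto
  then have "(\<lambda>i. \<integral>y. indicat_real (- ?S) y *\<^sub>R d i y \<partial>\<kappa>) \<longlonglongrightarrow> 0" by simp
  from tendstoD[OF this \<open>0 < \<delta>\<close>]
  have "\<forall>\<^sub>F i in sequentially. cmod (\<integral>y. indicat_real (- ?S) y *\<^sub>R d i y \<partial>\<kappa>) < \<delta>"
    by (simp add: dist_norm)
  then show ?thesis
  proof eventually_elim
    case (elim i)
    have iS: "integrable \<kappa> (\<lambda>y. indicat_real B y *\<^sub>R d i y)" if "B \<in> sets borel" for B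
      using that by (intro integrable_mult_indicator d_int) (simp add: \<kappa>)
    have "(\<integral>y. d i y \<partial>\<kappa>) = (\<integral>y. indicat_real (- ?S) y *\<^sub>R d i y + indicat_real ?S y *\<^sub>R d i y \<partial>\<kappa>)"
      by (intro Bochner_Integration.integral_cong) (auto simp: indicator_def)
    also have "\<dots> = (\<integral>y. indicat_real (- ?S) y *\<^sub>R d i y \<partial>\<kappa>) + (\<integral>y. indicat_real ?S y *\<^sub>R d i y \<partial>\<kappa>)"
      using S_meas by (intro Bochner_Integration.integral_add iS) auto
    finally have split: "(\<integral>y. d i y \<partial>\<kappa>) = (\<integral>y. indicat_real (- ?S) y *\<^sub>R d i y \<partial>\<kappa>) + (\<integral>y. indicat_real ?S y *\<^sub>R d i y \<partial>\<kappa>)" .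
    have "cmod (\<integral>y. indicat_real ?S y *\<^sub>R d i y \<partial>\<kappa>) \<le> (\<integral>y. norm (indicat_real ?S y *\<^sub>R d i y) \<partial>\<kappa>)"
      by (rule integral_norm_bound)
    also have "\<dots> \<le> (\<integral>y. 2 / r * indicat_real ?S y \<partial>\<kappa>)"
    proof (rule integral_mono)
      show "integrable \<kappa> (\<lambda>y. norm (indicat_real ?S y *\<^sub>R d i y))"
        using iS[OF S_meas] by (rule integrable_norm)
      show "integrable \<kappa> (\<lambda>y. 2 / r * indicat_real ?S y)"
        using S_meas by (intro integrable_mult_right integrable_real_indicator) (auto simp: \<kappa> less_top[symmetric])
      show "norm (indicat_real ?S y *\<^sub>R d i y) \<le> 2 / r * indicat_real ?S y" for y
        using d_le[of i y] by (simp add: indicator_def)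
    qed
    also have "\<dots> = 2 * measure \<kappa> ?S / r" by (simp add: space)
    finally have "cmod (\<integral>y. indicat_real ?S y *\<^sub>R d i y \<partial>\<kappa>) \<le> 2 * measure \<kappa> ?S / r" .
    moreover have "trunc_meas \<kappa> r x = (\<integral>y. ?k (F i y) \<partial>\<kappa>) + (\<integral>y. d i y \<partial>\<kappa>)"
      unfolding trunc_meas_def d_def using k_int kF_int[of i] by (simp add: Bochner_Integration.integral_diff)
    then have "cmod (trunc_meas \<kappa> r x) \<le> cmod (\<integral>y. ?k (F i y) \<partial>\<kappa>) + cmod (\<integral>y. d i y \<partial>\<kappa>)"
      by (simp only: norm_triangle_ineq)
    moreover have "cmod (\<integral>y. d i y \<partial>\<kappa>) \<le> cmod (\<integral>y. indicat_real (- ?S) y *\<^sub>R d i y \<partial>\<kappa>) + cmod (\<integral>y. indicat_real ?S y *\<^sub>R d i y \<partial>\<kappa>)"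
      unfolding split by (rule norm_triangle_ineq)
    ultimately show ?case using elim by linarith
  qed
qed

text \<open>The added 5 is 4 for the mass of the sphere and 1 for the approximation error
  \<open>\<delta> = t\<close>. The 5 in \<open>weak_const\<close> is the fivefold enlargement for
  the maximal function of the measure.\<close>

definition weak_level :: real where "weak_level = discrete_level + 5"
definition weak_const :: real where "weak_const = discrete_const + 5"

text \<open>Composing with simple functions that converge to the identity replaces
  \<open>\<kappa>\<close> by finite sums of point masses of no larger total mass. Their exceptional
  sets obey a common bound, which passes to the set of points lying in all but finitely many of
  them.\<close>

lemma weak_type_measure:
  assumes "finite_measure \<kappa>" and \<kappa>: "sets \<kappa> = sets borel" and "0 < t"
  obtains U where "U \<in> sets borel"
    "\<And>x r. 0 < r \<Longrightarrow> weak_level * t < cmod (trunc_meas \<kappa> r x) \<Longrightarrow> x \<in> U"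
    "emeasure \<mu> U \<le> ennreal (weak_const * measure \<kappa> UNIV / t)"
proof -
  interpret finite_measure \<kappa> by fact
  have space: "space \<kappa> = UNIV" using sets_eq_imp_space_eq[OF \<kappa>] by simp
  define a where "a = measure \<kappa> UNIV"
  have "0 \<le> a" unfolding a_def by simp
  have id: "(\<lambda>y. y) \<in> borel_measurable \<kappa>" using measurable_ident_sets[OF \<kappa>] by simp
  obtain F where F: "\<And>i. simple_function \<kappa> (F i)" "\<And>y. (\<lambda>i. F i y) \<longlonglongrightarrow> y"
    using borel_measurable_implies_sequence_metric[OF id, of 0] unfolding space by blast
  have F_meas: "F i \<in> borel_measurable \<kappa>" for i using F(1) by (rule borel_measurable_simple_function)
  have disc_nn: "0 \<le> discrete_const" unfolding discrete_const_def using piece_const_pos by simp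
  have "\<exists>U. U \<in> sets borel \<and>
    (\<forall>x r. 0 < r \<longrightarrow> discrete_level * t < cmod (\<integral>y. indicat_real (- ball x r) (F i y) *\<^sub>R K x (F i y) \<partial>\<kappa>) \<longrightarrow> x \<in> U) \<and>
    emeasure \<mu> U \<le> ennreal (discrete_const * a / t)" for i
  proof -
    note sc = integral_simple_composition[OF assms(1) F(1)[of i]]
    let ?P = "{p \<in> F i ` space \<kappa>. 0 < measure \<kappa> (F i -` {p} \<inter> space \<kappa>)}"
    let ?\<alpha> = "\<lambda>p. measure \<kappa> (F i -` {p} \<inter> space \<kappa>)"
    obtain U where U: "U \<in> sets borel"
      "\<And>x r. 0 < r \<Longrightarrow> discrete_level * t < cmod (\<Sum>p\<in>?P. ?\<alpha> p *\<^sub>R (indicat_real (- ball x r) p *\<^sub>R K x p)) \<Longrightarrow> x \<in> U"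
      "emeasure \<mu> U \<le> ennreal (discrete_const * (\<Sum>p\<in>?P. ?\<alpha> p) / t)"
      by (rule weak_type_discrete[of ?P ?\<alpha> t]) (use sc(3) \<open>0 < t\<close> in auto)
    have "discrete_const * (\<Sum>p\<in>?P. ?\<alpha> p) / t \<le> discrete_const * a / t"
      using sc(2) disc_nn \<open>0 < t\<close> unfolding a_def space by (intro divide_right_mono mult_left_mono) auto
    then have "emeasure \<mu> U \<le> ennreal (discrete_const * a / t)" using U(3) by (meson ennreal_leI order_trans)
    moreover have "(\<integral>y. indicat_real (- ball x r) (F i y) *\<^sub>R K x (F i y) \<partial>\<kappa>)
        = (\<Sum>p\<in>?P. ?\<alpha> p *\<^sub>R (indicat_real (- ball x r) p *\<^sub>R K x p))" for x r
      using sc(1)[of "\<lambda>y. indicat_real (- ball x r) y *\<^sub>R K x y"] .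
    ultimately show ?thesis using U(1,2) by auto
  qed
  then obtain U where U: "\<And>i. U i \<in> sets borel"
    "\<And>i x r. 0 < r \<Longrightarrow> discrete_level * t < cmod (\<integral>y. indicat_real (- ball x r) (F i y) *\<^sub>R K x (F i y) \<partial>\<kappa>) \<Longrightarrow> x \<in> U i"
    "\<And>i. emeasure \<mu> (U i) \<le> ennreal (discrete_const * a / t)" by metis
  note [measurable] = U(1)
  \<comment> \<open>The union of the \<open>W n\<close> is the lower limit of the
    \<open>U i\<close>. The \<open>W n\<close> increase and \<open>W n\<close> lies in
    \<open>U n\<close>, so the bound is not summed over \<open>i\<close>.\<close>
  define W where "W n = (\<Inter>i\<in>{n..}. U i)" for n
  have W_meas [measurable]: "W n \<in> sets borel" for n unfolding W_def by measurable
  have "emeasure \<mu> (\<Union>n. W n) = (SUP n. emeasure \<mu> (W n))"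
    by (intro SUP_emeasure_incseq[symmetric]) (auto simp: incseq_def W_def)
  also have "\<dots> \<le> ennreal (discrete_const * a / t)"
  proof (intro SUP_least)
    fix n
    have "emeasure \<mu> (W n) \<le> emeasure \<mu> (U n)" by (intro emeasure_mono) (auto simp: W_def)
    also note U(3)
    finally show "emeasure \<mu> (W n) \<le> ennreal (discrete_const * a / t)" .
  qed
  finally have W_le: "emeasure \<mu> (\<Union>n. W n) \<le> ennreal (discrete_const * a / t)" .

  define UM where "UM = (\<Union>(x, s)\<in>{(x, s). 0 < s \<and> t * s \<le> measure \<kappa> (ball x s)}. ball x s)"
  have "open UM" unfolding UM_def by auto
  then have [measurable]: "UM \<in> sets borel" by simp
  have "ennreal (t / 5) * emeasure \<mu> UM \<le> emeasure \<kappa> UNIV"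
    unfolding UM_def
  proof (rule Vitali_measure_bound[OF \<kappa>])
    fix x s assume "(x, s) \<in> {(x, s). 0 < s \<and> t * s \<le> measure \<kappa> (ball x s)}"
    then have s: "0 < s" "t * s \<le> measure \<kappa> (ball x s)" by auto
    have "t / 5 * m x (5 * s) \<le> t / 5 * (5 * s)" using s \<open>0 < t\<close> by (intro mult_left_mono m_le) auto
    also have "\<dots> \<le> measure \<kappa> (ball x s)" using s by simp
    finally show "0 < s \<and> ennreal (t / 5) * emeasure \<mu> (ball x (5 * s)) \<le> emeasure \<kappa> (ball x s)"
      using s \<open>0 < t\<close> by (auto simp: emeasure_ball emeasure_eq_measure ennreal_mult[symmetric] intro!: ennreal_leI)
  qed
  then have UM_le: "ennreal (t / 5) * emeasure \<mu> UM \<le> ennreal a" unfolding a_def by (simp add: emeasure_eq_measure)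
  have "emeasure \<mu> UM = ennreal (5 / t) * (ennreal (t / 5) * emeasure \<mu> UM)"
    using \<open>0 < t\<close> by (simp add: mult.assoc[symmetric] ennreal_mult[symmetric])
  also have "\<dots> \<le> ennreal (5 / t) * ennreal a" by (intro mult_left_mono UM_le) auto
  also have "\<dots> = ennreal (5 * a / t)" using \<open>0 < t\<close> \<open>0 \<le> a\<close> by (simp add: ennreal_mult[symmetric])
  finally have UM_le: "emeasure \<mu> UM \<le> ennreal (5 * a / t)" .

  have "emeasure \<mu> ((\<Union>n. W n) \<union> UM) \<le> emeasure \<mu> (\<Union>n. W n) + emeasure \<mu> UM"
    by (intro emeasure_subadditive) auto
  also have "\<dots> \<le> ennreal (discrete_const * a / t) + ennreal (5 * a / t)" by (intro add_mono W_le UM_le)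
  also have "\<dots> = ennreal (discrete_const * a / t + 5 * a / t)"
    using disc_nn \<open>0 \<le> a\<close> \<open>0 < t\<close> by (intro ennreal_plus[symmetric]) auto
  also have "discrete_const * a / t + 5 * a / t = weak_const * a / t"
    by (simp add: weak_const_def algebra_simps add_divide_distrib)
  finally have "emeasure \<mu> ((\<Union>n. W n) \<union> UM) \<le> ennreal (weak_const * a / t)" .
  moreover have "x \<in> (\<Union>n. W n) \<union> UM" if r: "0 < r" and large: "weak_level * t < cmod (trunc_meas \<kappa> r x)" for x r
  proof (rule ccontr)
    assume n: "x \<notin> (\<Union>n. W n) \<union> UM"
    have "measure \<kappa> (ball x (2 * r)) \<le> t * (2 * r)"
    proof (rule ccontr)
      assume "\<not> measure \<kappa> (ball x (2 * r)) \<le> t * (2 * r)"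
      then have "(x, 2 * r) \<in> {(x, s). 0 < s \<and> t * s \<le> measure \<kappa> (ball x s)}" using r by auto
      moreover have "x \<in> ball x (2 * r)" using r by simp
      ultimately have "x \<in> UM" unfolding UM_def by blast
      with n show False by simp
    qed
    \<comment> \<open>The sphere lies in \<open>ball x (2 * r)\<close>, whose mass is controlled off
      \<open>UM\<close>.\<close>
    moreover have "measure \<kappa> (sphere x r) \<le> measure \<kappa> (ball x (2 * r))"
      using r by (intro finite_measure_mono) (auto simp: \<kappa>)
    ultimately have "2 * measure \<kappa> (sphere x r) / r \<le> 2 * (t * (2 * r)) / r"
      using r by (intro divide_right_mono mult_left_mono) auto
    then have sph: "2 * measure \<kappa> (sphere x r) / r \<le> 4 * t" using r by simp
    have "\<forall>\<^sub>F i in sequentially. cmod (trunc_meas \<kappa> r x) \<le>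
      cmod (\<integral>y. indicat_real (- ball x r) (F i y) *\<^sub>R K x (F i y) \<partial>\<kappa>) + 2 * measure \<kappa> (sphere x r) / r + t"
      by (rule trunc_meas_approx[OF assms(1) \<kappa> F_meas F(2) r \<open>0 < t\<close>])
    then have "\<forall>\<^sub>F i in sequentially. x \<in> U i"
    proof eventually_elim
      case (elim i)
      then have "discrete_level * t < cmod (\<integral>y. indicat_real (- ball x r) (F i y) *\<^sub>R K x (F i y) \<partial>\<kappa>)"
        using sph large unfolding weak_level_def by (simp add: distrib_right)
      then show ?case by (rule U(2)[OF r])
    qed
    then obtain k where "\<And>i. k \<le> i \<Longrightarrow> x \<in> U i" unfolding eventually_sequentially by blast
    then have "x \<in> W k" unfolding W_def by simp
    with n show False by blast
  qed
  moreover have "(\<Union>n. W n) \<union> UM \<in> sets borel" by measurable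
  ultimately show ?thesis using that[of "(\<Union>n. W n) \<union> UM"] unfolding a_def by blast
qed

section \<open>Signed measures\<close>

text \<open>The truncation is the difference of those of the upper variations of
  \<open>\<nu>\<close> and \<open>- \<nu>\<close>, each of mass at most \<open>v\<close>. If it
  exceeds twice a level, one of the two exceeds the level; hence the factor 2 in the level, while
  the union of two exceptional sets gives the 2 in the bound.\<close>

lemma weak_type_signed:
  assumes \<nu>: "finite_signed_borel_measure \<nu>" and "0 < t" "total_variation \<nu> = ennreal v" "0 \<le> v"
  shows "emeasure \<mu> {x. maximal_op K \<nu> x > ennreal (2 * weak_level * t)} \<le> ennreal (2 * weak_const * v / t)"
proof -
  have wc: "0 < weak_const" unfolding weak_const_def discrete_const_def using piece_const_pos by (simp add: add_pos_pos add_nonneg_pos)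
  have "\<exists>U. U \<in> sets borel \<and> (\<forall>x r. 0 < r \<longrightarrow> weak_level * t < cmod (trunc_meas (upper_variation \<eta>) r x) \<longrightarrow> x \<in> U) \<and>
      emeasure \<mu> U \<le> ennreal (weak_const * v / t)"
    if \<eta>: "finite_signed_borel_measure \<eta>" "total_variation \<eta> = ennreal v" for \<eta>
  proof -
    have le: "emeasure (upper_variation \<eta>) UNIV \<le> ennreal v" using upper_variation_le[OF \<eta>(1)] \<eta>(2) by simp
    have sp: "space (upper_variation \<eta>) = UNIV" using sets_eq_imp_space_eq[OF sets_upper_variation[of \<eta>]] by simp
    have "finite_measure (upper_variation \<eta>)"
      using le_less_trans[OF le ennreal_less_top] by (intro finite_measureI) (simp add: sp less_top)
    then interpret U: finite_measure "upper_variation \<eta>" .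
    have mle: "measure (upper_variation \<eta>) UNIV \<le> v" using le \<open>0 \<le> v\<close> by (simp add: U.emeasure_eq_measure)
    obtain U where U: "U \<in> sets borel"
      "\<And>x r. 0 < r \<Longrightarrow> weak_level * t < cmod (trunc_meas (upper_variation \<eta>) r x) \<Longrightarrow> x \<in> U"
      "emeasure \<mu> U \<le> ennreal (weak_const * measure (upper_variation \<eta>) UNIV / t)"
      using weak_type_measure[OF U.finite_measure_axioms sets_upper_variation \<open>0 < t\<close>] by blast
    have "weak_const * measure (upper_variation \<eta>) UNIV / t \<le> weak_const * v / t"
      using mle wc \<open>0 < t\<close> by (intro divide_right_mono mult_left_mono) auto
    then have "emeasure \<mu> U \<le> ennreal (weak_const * v / t)" using U(3) by (meson ennreal_leI order_trans)
    with U show ?thesis by blast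
  qed
  note ex = this
  obtain U1 where U1: "U1 \<in> sets borel"
    "\<And>x r. 0 < r \<Longrightarrow> weak_level * t < cmod (trunc_meas (upper_variation \<nu>) r x) \<Longrightarrow> x \<in> U1"
    "emeasure \<mu> U1 \<le> ennreal (weak_const * v / t)"
    using ex[OF \<nu> assms(3)] by blast
  obtain U2 where U2: "U2 \<in> sets borel"
    "\<And>x r. 0 < r \<Longrightarrow> weak_level * t < cmod (trunc_meas (upper_variation (\<lambda>E. - \<nu> E)) r x) \<Longrightarrow> x \<in> U2"
    "emeasure \<mu> U2 \<le> ennreal (weak_const * v / t)"
    using ex[OF finite_signed_borel_measure_uminus[OF \<nu>]] assms(3) unfolding total_variation_uminus by blast
  have "{x. maximal_op K \<nu> x > ennreal (2 * weak_level * t)} \<subseteq> U1 \<union> U2"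
  proof
    fix x assume "x \<in> {x. maximal_op K \<nu> x > ennreal (2 * weak_level * t)}"
    then obtain r where r: "0 < r" "ennreal (2 * weak_level * t) < ennreal (cmod (truncated_op K r \<nu> x))"
      unfolding maximal_op_def by (auto simp: less_SUP_iff)
    from r(2) have "2 * weak_level * t < cmod (truncated_op K r \<nu> x)"
      by (rule contrapos_pp) (simp add: not_less ennreal_leI)
    moreover have "truncated_op K r \<nu> x = trunc_meas (upper_variation \<nu>) r x - trunc_meas (upper_variation (\<lambda>E. - \<nu> E)) r x"
      by (simp add: truncated_op_def signed_integral_def trunc_meas_def)
    ultimately have "2 * (weak_level * t) < cmod (trunc_meas (upper_variation \<nu>) r x) + cmod (trunc_meas (upper_variation (\<lambda>E. - \<nu> E)) r x)"
      using norm_triangle_ineq4[of "trunc_meas (upper_variation \<nu>) r x" "trunc_meas (upper_variation (\<lambda>E. - \<nu> E)) r x"]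
      by simp
    then have "weak_level * t < cmod (trunc_meas (upper_variation \<nu>) r x) \<or>
       weak_level * t < cmod (trunc_meas (upper_variation (\<lambda>E. - \<nu> E)) r x)" by linarith
    then show "x \<in> U1 \<union> U2" using U1(2)[OF r(1)] U2(2)[OF r(1)] by blast
  qed
  then have "emeasure \<mu> {x. maximal_op K \<nu> x > ennreal (2 * weak_level * t)} \<le> emeasure \<mu> (U1 \<union> U2)"
    using U1 U2 by (intro emeasure_mono) auto
  also have "\<dots> \<le> emeasure \<mu> U1 + emeasure \<mu> U2" using U1 U2 by (intro emeasure_subadditive) auto
  also have "\<dots> \<le> ennreal (weak_const * v / t) + ennreal (weak_const * v / t)" by (intro add_mono U1 U2)
  also have "\<dots> = ennreal (2 * weak_const * v / t)"
    using wc \<open>0 < t\<close> \<open>0 \<le> v\<close> by (simp flip: ennreal_plus)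
  finally show ?thesis .
qed

end

theorem theorem3:
  fixes \<epsilon> N :: real
  assumes "\<epsilon> > 0" and "N \<ge> 0"
  shows "\<exists>A::real. A \<ge> 0 \<and>
    (\<forall>(\<mu> :: complex measure) (K :: complex \<Rightarrow> complex \<Rightarrow> complex) T.
       sets \<mu> = sets borel \<longrightarrow>
       (\<forall>x r. r > 0 \<longrightarrow> emeasure \<mu> (ball x r) \<le> ennreal r) \<longrightarrow>
       CZ_kernel \<epsilon> K \<longrightarrow>
       L2_bounded_linear \<mu> T \<longrightarrow>
       has_kernel \<mu> T K \<longrightarrow>
       L2_onorm \<mu> T \<le> N \<longrightarrow>
       (\<forall>(\<nu> :: complex set \<Rightarrow> real) t::real.
          finite_signed_borel_measure \<nu> \<longrightarrow> t > 0 \<longrightarrow>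
          emeasure \<mu> {x. maximal_op K \<nu> x > ennreal t}
            \<le> ennreal A * total_variation \<nu> / ennreal t))"
proof -
  \<comment> \<open>Outside the locale these constants take only \<open>\<epsilon>\<close> and
    \<open>N\<close> as arguments, so \<open>A\<close> is fixed before \<open>\<mu>\<close>,
    \<open>K\<close> and \<open>T\<close> are introduced.\<close>
  define L where "L = CZ_operator.weak_level \<epsilon> N"
  define C where "C = CZ_operator.weak_const \<epsilon> N"
  \<comment> \<open>The maximum with 1 keeps \<open>A\<close> positive, so that the product with an
    infinite total variation is infinite rather than 0.\<close>
  define A where "A = max 1 (4 * C * L)"
  show ?thesis
  proof (intro exI[of _ A] conjI allI impI)
    show "0 \<le> A" unfolding A_def by simp
  next
    fix \<mu> :: "complex measure" and K T and \<nu> :: "complex set \<Rightarrow> real" and t :: real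
    assume h: "sets \<mu> = sets borel" "\<forall>x r. 0 < r \<longrightarrow> emeasure \<mu> (ball x r) \<le> ennreal r"
      "CZ_kernel \<epsilon> K" "L2_bounded_linear \<mu> T" "has_kernel \<mu> T K" "L2_onorm \<mu> T \<le> N"
      and \<nu>: "finite_signed_borel_measure \<nu>" and t: "0 < t"
    interpret CZ_operator \<mu> \<epsilon> N K T
      using h assms by unfold_locales auto
    have L: "0 < L" unfolding L_def weak_level_def discrete_level_def using cotlar_const_pos by simp
    show "emeasure \<mu> {x. maximal_op K \<nu> x > ennreal t} \<le> ennreal A * total_variation \<nu> / ennreal t"
    proof (cases "total_variation \<nu>")
      case top
      have "ennreal A * total_variation \<nu> / ennreal t = top"
        using t unfolding top A_def by (simp add: ennreal_mult_top ennreal_top_divide)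
      then show ?thesis by simp
    next
      case (real v)
      \<comment> \<open>For this value the level \<open>2 * L * (t / (2 * L))\<close> is
        \<open>t\<close>, and the bound becomes \<open>4 * C * L * v / t\<close>.\<close>
      have "0 < t / (2 * L)" using t L by simp
      from weak_type_signed[OF \<nu> this real(2,1)]
      have "emeasure \<mu> {x. maximal_op K \<nu> x > ennreal t} \<le> ennreal (4 * C * L * v / t)"
        using L t by (simp add: L_def[symmetric] C_def[symmetric] mult_ac)
      also have "\<dots> \<le> ennreal (A * v / t)"
        using t real(1) unfolding A_def by (intro ennreal_leI divide_right_mono mult_right_mono) auto
      also have "\<dots> = ennreal A * total_variation \<nu> / ennreal t"
        using t real unfolding A_def by (simp add: divide_ennreal ennreal_mult[symmetric])
      finally show ?thesis .
    qed
  qed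
qed

end
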